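(* Let $(M^d,c)$ be a connected Riemannian conformal manifold of dimension $d\geq 3$, and let $K_1,K_2$ be linearly independent parallel standard tractors on $(M,c)$ with $S_{K_2}<0$ and $\Sigma_{K_2}\neq\emptyset$. If $K_1$ and $K_2$ are spacelike (i.e. $h(K_1,K_1)>0$ and $h(K_2,K_2)>0$) and orthogonal (i.e. $h(K_1,K_2)=0$), then $\Sigma_{K_1}\cap\Sigma_{K_2}$ is either empty or else is a totally umbilic hypersurface in $(\Sigma_{K_2},c_{K_2})$, where $c_{K_2}$ is the conformal structure on $\Sigma_{K_2}$ induced by $c$.
   Context: All manifolds and structures are smooth. A Riemannian conformal structure $c$ on $M^d$ is an equivalence class of Riemannian metrics under $g\sim e^{2\omega}g$, $\omega\in C^\infty(M)$. For $w\in\mathbb{R}$, $\mathcal{E}[w]$ is the line bundle of conformal densities: a section is a family of functions $(f_g)_{g\in c}$ with $f_{e^{2\omega}g}=e^{w\omega}f_g$; $[w]$ denotes tensoring with $\mathcal{E}[w]$. The conformal metric $\mathbf{g}\in S^2T^*M[2]$ is the tautological section represented by $g$ in the scale $g$; it is used to raise and lower indices. The Schouten tensor $P$ of $g$ is defined by $\mathrm{Ric}=(d-2)P+Jg$, $J=\mathrm{tr}_gP$. The standard tractor bundle $\mathcal{T}$ of $(M,c)$: each $g\in c$ identifies $\mathcal{T}$ with $\mathcal{E}[1]\oplus T^*M[1]\oplus\mathcal{E}[-1]$, so sections are triples $(\sigma,\mu_a,\rho)$; for $\hat g=e^{2\omega}g$ and $\Upsilon=d\omega$ the identifications are related by $(\hat\sigma,\hat\mu_b,\hat\rho)=(\sigma,\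 \mu_b+\sigma\Upsilon_b,\ \rho-\mathbf{g}^{bc}\Upsilon_b\mu_c-\tfrac12\sigma\mathbf{g}^{bc}\Upsilon_b\Upsilon_c)$. The tractor metric $h$, of signature $(d+1,1)$, is given by $h(U,U)=2\sigma\rho+\mu^a\mu_a$ for $U=(\sigma,\mu_a,\rho)$. The tractor connection, which preserves $h$, is $$\nabla_a(\sigma,\mu^b,\rho)=(\nabla_a\sigma-\mu_a,\ \nabla_a\mu^b+\delta_a{}^b\rho+P_a{}^b\sigma,\ \nabla_a\rho-P_{ac}\mu^c).$$ The canonical tractor $X$ is the section of $\mathcal{T}[1]$ with $h(X,U)=\sigma$. For a non-zero parallel tractor $K$ put $\sigma_K:=h(X,K)$, $S_K:=-h(K,K)$ (a constant), and let $\Sigma_K$ (the scale singularity set) be the zero set of $\sigma_K$. It is known that if $S_K<0$ and $\Sigma_K\neq\emptyset$ then $\Sigma_K$ is a smooth totally umbilic hypersurface of $(M,c)$. *)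

theory Defs
  imports "HOL-Analysis.Analysis"
begin

section \<open>Smooth maps between open subsets of Euclidean spaces\<close>

primrec Ck_on :: "nat \<Rightarrow> (real^'n::finite) set \<Rightarrow> (real^'n \<Rightarrow> 'b::real_normed_vector) \<Rightarrow> bool" where
  "Ck_on 0 S f \<longleftrightarrow> continuous_on S f"
| "Ck_on (Suc k) S f \<longleftrightarrow> (\<forall>x\<in>S. f differentiable (at x)) \<and>
     (\<forall>i. Ck_on k S (\<lambda>x. frechet_derivative f (at x) (axis i 1)))"

text \<open>Only used for open \<open>S\<close>.\<close>

definition smooth_on :: "(real^'n::finite) set \<Rightarrow> (real^'n \<Rightarrow> 'b::real_normed_vector) \<Rightarrow> bool" where
  "smooth_on S f \<longleftrightarrow> (\<forall>k. Ck_on k S f)"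


section \<open>Smooth manifolds\<close>

text \<open>
  A chart is a pair \<open>(U, \<phi>)\<close>; the values of \<open>\<phi>\<close> outside \<open>U\<close> are irrelevant.
  Manifolds are arbitrary topologies on subsets of a type, so that a submanifold is again a
  manifold over the same type (with charts in a coordinate space of smaller dimension).
\<close>

type_synonym ('a, 'n) chart = "'a set \<times> ('a \<Rightarrow> real^'n)"

abbreviation chart_dom :: "('a, 'n) chart \<Rightarrow> 'a set" where
  "chart_dom \<kappa> \<equiv> fst \<kappa>"

abbreviation chart_map :: "('a, 'n) chart \<Rightarrow> 'a \<Rightarrow> real^'n" where
  "chart_map \<kappa> \<equiv> snd \<kappa>"

definition chart_inv :: "('a, 'n) chart \<Rightarrow> real^'n \<Rightarrow> 'a" where
  "chart_inv \<kappa> = inv_into (chart_dom \<kappa>) (chart_map \<kappa>)"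

definition chart_on :: "'a topology \<Rightarrow> ('a, 'n::finite) chart \<Rightarrow> bool" where
  "chart_on M \<kappa> \<longleftrightarrow> openin M (chart_dom \<kappa>) \<and> open (chart_map \<kappa> ` chart_dom \<kappa>) \<and>
     homeomorphic_map (subtopology M (chart_dom \<kappa>))
       (top_of_set (chart_map \<kappa> ` chart_dom \<kappa>)) (chart_map \<kappa>)"

definition compatible :: "('a, 'n::finite) chart \<Rightarrow> ('a, 'n) chart \<Rightarrow> bool" where
  "compatible \<kappa> \<kappa>' \<longleftrightarrow>
     smooth_on (chart_map \<kappa> ` (chart_dom \<kappa> \<inter> chart_dom \<kappa>')) (chart_map \<kappa>' \<circ> chart_inv \<kappa>) \<and>
     smooth_on (chart_map \<kappa>' ` (chart_dom \<kappa> \<inter> chart_dom \<kappa>')) (chart_map \<kappa> \<circ> chart_inv \<kappa>')"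

text \<open>
  A smooth structure is a maximal atlas. The equation below says at once that the charts in \<open>A\<close>
  are pairwise compatible and that \<open>A\<close> is maximal with this property.
\<close>

definition smooth_manifold :: "'a topology \<Rightarrow> ('a, 'n::finite) chart set \<Rightarrow> bool" where
  "smooth_manifold M A \<longleftrightarrow> Hausdorff_space M \<and> second_countable M \<and>
     (\<Union>\<kappa>\<in>A. chart_dom \<kappa>) = topspace M \<and>
     A = {\<kappa>. chart_on M \<kappa> \<and> (\<forall>\<kappa>'\<in>A. compatible \<kappa> \<kappa>')}"

definition chart_smooth :: "('a, 'n::finite) chart \<Rightarrow> ('a \<Rightarrow> 'b::real_normed_vector) \<Rightarrow> bool" where
  "chart_smooth \<kappa> f \<longleftrightarrow> smooth_on (chart_map \<kappa> ` chart_dom \<kappa>) (f \<circ> chart_inv \<kappa>)"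

definition smooth_fun :: "('a, 'n::finite) chart set \<Rightarrow> ('a \<Rightarrow> real) \<Rightarrow> bool" where
  "smooth_fun A f \<longleftrightarrow> (\<forall>\<kappa>\<in>A. chart_smooth \<kappa> f)"

text \<open>The coordinate partial derivative \<open>\<partial>\<^sub>i f\<close>, as a function on the chart domain.\<close>

definition pd :: "('a, 'n::finite) chart \<Rightarrow> 'n \<Rightarrow> ('a \<Rightarrow> real) \<Rightarrow> 'a \<Rightarrow> real" where
  "pd \<kappa> i f p = frechet_derivative (f \<circ> chart_inv \<kappa>) (at (chart_map \<kappa> p)) (axis i 1)"


section \<open>Tensor fields and Riemannian metrics\<close>

text \<open>
  Covariant tensor fields are represented by their components in all charts of the atlas.
  \<open>pullback_tensor A B g \<gamma>\<close> says that \<open>\<gamma>\<close> (in charts of \<open>B\<close>) is the pullback of \<open>g\<close> (in charts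
  of \<open>A\<close>) under the inclusion of one manifold into another; for \<open>B = A\<close> and \<open>\<gamma> = g\<close> it is the
  usual transformation law of the components of a covariant 2-tensor.
\<close>

type_synonym ('a, 'n) covector_field = "('a, 'n) chart \<Rightarrow> 'a \<Rightarrow> real^'n"
type_synonym ('a, 'n) metric = "('a, 'n) chart \<Rightarrow> 'a \<Rightarrow> real^'n^'n"

definition smooth_covector_field ::
    "('a, 'n::finite) chart set \<Rightarrow> ('a, 'n) covector_field \<Rightarrow> bool" where
  "smooth_covector_field A \<alpha> \<longleftrightarrow> (\<forall>\<kappa>\<in>A. chart_smooth \<kappa> (\<alpha> \<kappa>)) \<and>
     (\<forall>\<kappa>\<in>A. \<forall>\<kappa>'\<in>A. \<forall>p \<in> chart_dom \<kappa> \<inter> chart_dom \<kappa>'. \<forall>i.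
        \<alpha> \<kappa>' p $ i = (\<Sum>a\<in>UNIV. pd \<kappa>' i (\<lambda>q. chart_map \<kappa> q $ a) p * \<alpha> \<kappa> p $ a))"

definition pullback_tensor :: "('a, 'n::finite) chart set \<Rightarrow> ('a, 'm::finite) chart set \<Rightarrow>
    ('a, 'n) metric \<Rightarrow> ('a, 'm) metric \<Rightarrow> bool" where
  "pullback_tensor A B g \<gamma> \<longleftrightarrow>
     (\<forall>\<kappa>\<in>A. \<forall>\<kappa>'\<in>B. \<forall>p \<in> chart_dom \<kappa> \<inter> chart_dom \<kappa>'. \<forall>i j.
        \<gamma> \<kappa>' p $ i $ j = (\<Sum>a\<in>UNIV. \<Sum>b\<in>UNIV.
          pd \<kappa>' i (\<lambda>q. chart_map \<kappa> q $ a) p * pd \<kappa>' j (\<lambda>q. chart_map \<kappa> q $ b) p * g \<kappa> p $ a $ b))"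

definition ip :: "real^'n^'n \<Rightarrow> real^'n \<Rightarrow> real^'n::finite \<Rightarrow> real" where
  "ip G v w = (\<Sum>a\<in>UNIV. \<Sum>b\<in>UNIV. G $ a $ b * v $ a * w $ b)"

definition riemannian_metrics :: "('a, 'n::finite) chart set \<Rightarrow> ('a, 'n) metric set" where
  "riemannian_metrics A = {g. pullback_tensor A A g g \<and>
     (\<forall>\<kappa>\<in>A. (\<forall>i j. chart_smooth \<kappa> (\<lambda>p. g \<kappa> p $ i $ j)) \<and>
        (\<forall>p\<in>chart_dom \<kappa>. (\<forall>i j. g \<kappa> p $ i $ j = g \<kappa> p $ j $ i) \<and>
           (\<forall>v. v \<noteq> 0 \<longrightarrow> ip (g \<kappa> p) v v > 0)))}"


section \<open>Conformal structures\<close>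

definition rescaled :: "('a, 'n::finite) chart set \<Rightarrow> ('a \<Rightarrow> real) \<Rightarrow>
    ('a, 'n) metric \<Rightarrow> ('a, 'n) metric \<Rightarrow> bool" where
  "rescaled A \<omega> g g' \<longleftrightarrow> (\<forall>\<kappa>\<in>A. \<forall>p\<in>chart_dom \<kappa>. g' \<kappa> p = exp (2 * \<omega> p) *\<^sub>R g \<kappa> p)"

definition conformal_rel ::
    "('a, 'n::finite) chart set \<Rightarrow> (('a, 'n) metric \<times> ('a, 'n) metric) set" where
  "conformal_rel A = {(g, g'). g \<in> riemannian_metrics A \<and> g' \<in> riemannian_metrics A \<and>
     (\<exists>\<omega>. smooth_fun A \<omega> \<and> rescaled A \<omega> g g')}"

definition conformal_manifold ::
    "'a topology \<Rightarrow> ('a, 'n::finite) chart set \<Rightarrow> ('a, 'n) metric set \<Rightarrow> bool" where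
  "conformal_manifold M A c \<longleftrightarrow>
     smooth_manifold M A \<and> c \<in> riemannian_metrics A // conformal_rel A"


section \<open>Levi-Civita connection and Schouten tensor\<close>

definition christoffel ::
    "('a, 'n::finite) metric \<Rightarrow> ('a, 'n) chart \<Rightarrow> 'n \<Rightarrow> 'n \<Rightarrow> 'n \<Rightarrow> 'a \<Rightarrow> real" where
  "christoffel g \<kappa> a b c p = (\<Sum>e\<in>UNIV. matrix_inv (g \<kappa> p) $ a $ e *
     (pd \<kappa> b (\<lambda>q. g \<kappa> q $ e $ c) p + pd \<kappa> c (\<lambda>q. g \<kappa> q $ e $ b) p
       - pd \<kappa> e (\<lambda>q. g \<kappa> q $ b $ c) p)) / 2"

text \<open>The components \<open>\<nabla>\<^sub>b Y\<^sup>a\<close>, for a vector field with components \<open>Y\<close> in the chart.\<close>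

definition cov_deriv :: "('a, 'n::finite) metric \<Rightarrow> ('a, 'n) chart \<Rightarrow> 'n \<Rightarrow>
    ('a \<Rightarrow> real^'n) \<Rightarrow> 'a \<Rightarrow> real^'n" where
  "cov_deriv g \<kappa> b Y p = (\<chi> a. pd \<kappa> b (\<lambda>q. Y q $ a) p +
     (\<Sum>c\<in>UNIV. christoffel g \<kappa> a b c p * Y p $ c))"

text \<open>
  \<open>riemann g \<kappa> a b c e\<close> is \<open>R\<^sub>a\<^sub>b\<^sup>c\<^sub>e\<close>, where
  \<open>(\<nabla>\<^sub>a \<nabla>\<^sub>b - \<nabla>\<^sub>b \<nabla>\<^sub>a) V\<^sup>c = R\<^sub>a\<^sub>b\<^sup>c\<^sub>e V\<^sup>e\<close>. The Ricci tensor is \<open>R\<^sub>b\<^sub>e = R\<^sub>a\<^sub>b\<^sup>a\<^sub>e\<close>,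
  which is positive on round spheres.
\<close>

definition riemann ::
    "('a, 'n::finite) metric \<Rightarrow> ('a, 'n) chart \<Rightarrow> 'n \<Rightarrow> 'n \<Rightarrow> 'n \<Rightarrow> 'n \<Rightarrow> 'a \<Rightarrow> real" where
  "riemann g \<kappa> a b c e p =
     pd \<kappa> a (christoffel g \<kappa> c b e) p - pd \<kappa> b (christoffel g \<kappa> c a e) p +
     (\<Sum>f\<in>UNIV. christoffel g \<kappa> c a f p * christoffel g \<kappa> f b e p
             - christoffel g \<kappa> c b f p * christoffel g \<kappa> f a e p)"

definition ricci :: "('a, 'n::finite) metric \<Rightarrow> ('a, 'n) chart \<Rightarrow> 'a \<Rightarrow> real^'n^'n" where
  "ricci g \<kappa> p = (\<chi> b e. \<Sum>a\<in>UNIV. riemann g \<kappa> a b a e p)"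

definition metric_trace :: "real^'n^'n \<Rightarrow> real^'n^'n::finite \<Rightarrow> real" where
  "metric_trace G P = (\<Sum>a\<in>UNIV. \<Sum>b\<in>UNIV. matrix_inv G $ a $ b * P $ a $ b)"

text \<open>\<open>schouten_explicit\<close> below justifies the definite description for \<open>d \<ge> 3\<close>.\<close>

definition schouten :: "('a, 'n::finite) metric \<Rightarrow> ('a, 'n) chart \<Rightarrow> 'a \<Rightarrow> real^'n^'n" where
  "schouten g \<kappa> p = (THE P. ricci g \<kappa> p =
     (real CARD('n) - 2) *\<^sub>R P + metric_trace (g \<kappa> p) P *\<^sub>R g \<kappa> p)"

lemma metric_trace_linear:
  "metric_trace G (a *\<^sub>R P + b *\<^sub>R Q) = a * metric_trace G P + b * metric_trace G Q"
  by (simp add: metric_trace_def sum.distrib sum_distrib_left algebra_simps)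

lemma pos_def_invertible:
  fixes G :: "real^'n^'n::finite"
  assumes pos: "\<And>v. v \<noteq> 0 \<Longrightarrow> ip G v v > 0"
  shows "invertible G"
proof -
  have eq: "ip G v v = v \<bullet> (G *v v)" for v
    by (simp add: ip_def inner_vec_def matrix_vector_mult_def sum_distrib_left mult_ac)
  have "v = 0" if "G *v v = 0" for v
    using pos[of v] eq[of v] that by force
  then have "\<exists>B. B ** G = mat 1"
    by (simp add: matrix_left_invertible_ker)
  then show ?thesis
    by (metis invertible_def matrix_left_right_inverse)
qed

lemma metric_trace_self:
  fixes G :: "real^'n^'n::finite"
  assumes sym: "\<And>i j. G $ i $ j = G $ j $ i" and pos: "\<And>v. v \<noteq> 0 \<Longrightarrow> ip G v v > 0"
  shows "metric_trace G G = real CARD('n)"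
proof -
  have "\<exists>B. G ** B = mat 1 \<and> B ** G = mat 1"
    using pos_def_invertible[OF pos] by (simp add: invertible_def)
  then have "matrix_inv G ** G = mat 1"
    unfolding matrix_inv_def by (rule someI2_ex) simp
  then have "(matrix_inv G ** G) $ a $ a = 1" for a
    by (simp add: mat_def)
  then have *: "(\<Sum>b\<in>UNIV. matrix_inv G $ a $ b * G $ b $ a) = 1" for a
    by (simp add: matrix_matrix_mult_def)
  have "metric_trace G G = (\<Sum>a\<in>UNIV. \<Sum>b\<in>UNIV. matrix_inv G $ a $ b * G $ b $ a)"
    unfolding metric_trace_def by (intro sum.cong refl) (simp add: sym)
  then show ?thesis
    by (simp add: *)
qed

lemma schouten_explicit:
  fixes g :: "('a, 'n::finite) metric"
  assumes dim: "CARD('n) \<ge> 3"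
    and g: "\<And>i j. g \<kappa> p $ i $ j = g \<kappa> p $ j $ i" "\<And>v. v \<noteq> 0 \<Longrightarrow> ip (g \<kappa> p) v v > 0"
  defines "d \<equiv> real CARD('n)"
  shows "schouten g \<kappa> p = (1 / (d - 2)) *\<^sub>R (ricci g \<kappa> p -
           (metric_trace (g \<kappa> p) (ricci g \<kappa> p) / (2 * (d - 1))) *\<^sub>R g \<kappa> p)" (is "_ = ?P")
    and "ricci g \<kappa> p = (d - 2) *\<^sub>R schouten g \<kappa> p +
           metric_trace (g \<kappa> p) (schouten g \<kappa> p) *\<^sub>R g \<kappa> p"
proof -
  let ?G = "g \<kappa> p" and ?R = "ricci g \<kappa> p"
  let ?s = "metric_trace ?G ?R"
  have d: "d \<ge> 3" using dim by (simp add: d_def)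
  have tG: "metric_trace ?G ?G = d"
    using metric_trace_self[OF g] by (simp add: d_def)
  have P': "?P = (1 / (d - 2)) *\<^sub>R ?R + (- ?s / (2 * (d - 1) * (d - 2))) *\<^sub>R ?G"
    using d by (simp add: algebra_simps)
  have tP: "metric_trace ?G ?P = ?s / (2 * (d - 1))"
    unfolding P' metric_trace_linear tG using d by (simp add: divide_simps) (simp add: algebra_simps)
  have ex: "?R = (d - 2) *\<^sub>R ?P + metric_trace ?G ?P *\<^sub>R ?G"
    unfolding tP using d by simp
  have un: "Q = ?P" if Q: "?R = (d - 2) *\<^sub>R Q + metric_trace ?G Q *\<^sub>R ?G" for Q
  proof -
    have "?s = (d - 2) * metric_trace ?G Q + metric_trace ?G Q * d"
      using metric_trace_linear[of ?G "d - 2" Q "metric_trace ?G Q" ?G] Q tG by simp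
    then have s: "?s = metric_trace ?G Q * (2 * (d - 1))" by (simp add: algebra_simps)
    then have "?s / (2 * (d - 1)) = metric_trace ?G Q" using d by simp
    then have "?P = (1 / (d - 2)) *\<^sub>R (?R - metric_trace ?G Q *\<^sub>R ?G)" by simp
    also have "?R - metric_trace ?G Q *\<^sub>R ?G = (d - 2) *\<^sub>R Q"
      using Q by (metis add_diff_cancel_right')
    finally show ?thesis using d by simp
  qed
  show eq: "schouten g \<kappa> p = ?P"
    unfolding schouten_def d_def[symmetric] using ex un by (intro the_equality)
  show "?R = (d - 2) *\<^sub>R schouten g \<kappa> p + metric_trace ?G (schouten g \<kappa> p) *\<^sub>R ?G"
    unfolding eq by (rule ex)
qed


section \<open>Standard tractors\<close>

text \<open>
  A section of \<open>\<T>[w]\<close> is given, for each metric \<open>g\<close> in the conformal class, by the triple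
  \<open>(\<sigma>, \<mu>\<^sub>a, \<rho>)\<close> of a function, a covector field and a function which represent its components in
  \<open>\<E>[w+1]\<close>, \<open>T\<^sup>*M[w+1]\<close> and \<open>\<E>[w-1]\<close> in the scale \<open>g\<close>. The exponential factors in the
  transformation law are those of densities of these weights; in the scale \<open>g\<close> the conformal
  metric is represented by \<open>g\<close>, and densities are differentiated as functions.
\<close>

record ('a, 'n) tractor =
  tsigma :: "('a, 'n) metric \<Rightarrow> 'a \<Rightarrow> real"
  tmu :: "('a, 'n) metric \<Rightarrow> ('a, 'n) covector_field"
  trho :: "('a, 'n) metric \<Rightarrow> 'a \<Rightarrow> real"

definition tractor_section :: "('a, 'n::finite) chart set \<Rightarrow> ('a, 'n) metric set \<Rightarrow> real \<Rightarrow>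
    ('a, 'n) tractor \<Rightarrow> bool" where
  "tractor_section A c w U \<longleftrightarrow>
     (\<forall>g\<in>c. smooth_fun A (tsigma U g) \<and> smooth_covector_field A (tmu U g) \<and>
        smooth_fun A (trho U g)) \<and>
     (\<forall>g\<in>c. \<forall>g'\<in>c. \<forall>\<omega>. smooth_fun A \<omega> \<and> rescaled A \<omega> g g' \<longrightarrow>
        (\<forall>\<kappa>\<in>A. \<forall>p\<in>chart_dom \<kappa>.
          let \<sigma> = tsigma U g p; \<mu> = tmu U g \<kappa> p; \<rho> = trho U g p;
              \<Upsilon> = (\<chi> b. pd \<kappa> b \<omega> p); G = matrix_inv (g \<kappa> p)
          in tsigma U g' p = exp ((w + 1) * \<omega> p) * \<sigma> \<and>
             tmu U g' \<kappa> p = exp ((w + 1) * \<omega> p) *\<^sub>R (\<mu> + \<sigma> *\<^sub>R \<Upsilon>) \<and>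
             trho U g' p = exp ((w - 1) * \<omega> p) * (\<rho> - ip G \<Upsilon> \<mu> - \<sigma> * ip G \<Upsilon> \<Upsilon> / 2)))"

text \<open>The tractor metric in the scale \<open>g\<close>, computed in the chart \<open>\<kappa>\<close>.\<close>

definition tractor_metric :: "('a, 'n::finite) metric \<Rightarrow> ('a, 'n) chart \<Rightarrow>
    ('a, 'n) tractor \<Rightarrow> ('a, 'n) tractor \<Rightarrow> 'a \<Rightarrow> real" where
  "tractor_metric g \<kappa> U V p = tsigma U g p * trho V g p + trho U g p * tsigma V g p +
     ip (matrix_inv (g \<kappa> p)) (tmu U g \<kappa> p) (tmu V g \<kappa> p)"

text \<open>The components of \<open>\<nabla>\<^sub>a U\<close>, with the middle slot given as a vector \<open>\<mu>\<^sup>b = g\<^sup>b\<^sup>c \<mu>\<^sub>c\<close>.\<close>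

definition tractor_connection :: "('a, 'n::finite) metric \<Rightarrow> ('a, 'n) chart \<Rightarrow> 'n \<Rightarrow>
    ('a, 'n) tractor \<Rightarrow> 'a \<Rightarrow> real \<times> (real^'n) \<times> real" where
  "tractor_connection g \<kappa> a U p =
     (let \<sigma> = tsigma U g; \<mu> = tmu U g \<kappa>; \<rho> = trho U g; P = schouten g \<kappa> p;
          \<mu>up = (\<lambda>q. matrix_inv (g \<kappa> q) *v \<mu> q)
      in (pd \<kappa> a \<sigma> p - \<mu> p $ a,
          cov_deriv g \<kappa> a \<mu>up p + \<rho> p *\<^sub>R axis a 1
            + \<sigma> p *\<^sub>R (\<chi> b. \<Sum>c\<in>UNIV. matrix_inv (g \<kappa> p) $ b $ c * P $ a $ c),
          pd \<kappa> a \<rho> p - (\<Sum>c\<in>UNIV. P $ a $ c * \<mu>up p $ c)))"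

definition parallel_tractor ::
    "('a, 'n::finite) chart set \<Rightarrow> ('a, 'n) metric set \<Rightarrow> ('a, 'n) tractor \<Rightarrow> bool" where
  "parallel_tractor A c U \<longleftrightarrow> tractor_section A c 0 U \<and>
     (\<forall>g\<in>c. \<forall>\<kappa>\<in>A. \<forall>p\<in>chart_dom \<kappa>. \<forall>a. tractor_connection g \<kappa> a U p = (0, 0, 0))"

definition lin_indep_tractors :: "('a, 'n::finite) chart set \<Rightarrow> ('a, 'n) metric set \<Rightarrow>
    ('a, 'n) tractor \<Rightarrow> ('a, 'n) tractor \<Rightarrow> bool" where
  "lin_indep_tractors A c U V \<longleftrightarrow> (\<forall>s t :: real.
     (\<forall>g\<in>c. \<forall>\<kappa>\<in>A. \<forall>p\<in>chart_dom \<kappa>.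
        s * tsigma U g p + t * tsigma V g p = 0 \<and>
        s *\<^sub>R tmu U g \<kappa> p + t *\<^sub>R tmu V g \<kappa> p = 0 \<and>
        s * trho U g p + t * trho V g p = 0) \<longrightarrow> s = 0 \<and> t = 0)"

definition canonical_tractor :: "('a, 'n::finite) tractor" where
  "canonical_tractor = \<lparr>tsigma = (\<lambda>_ _. 0), tmu = (\<lambda>_ _ _. 0), trho = (\<lambda>_ _. 1)\<rparr>"

lemma tractor_metric_canonical: "tractor_metric g \<kappa> canonical_tractor U p = tsigma U g p"
  by (simp add: tractor_metric_def canonical_tractor_def ip_def)

lemma Ck_on_const: "Ck_on k S (\<lambda>_. x)"
  by (induction k arbitrary: x) (simp_all add: frechet_derivative_const)

lemma canonical_tractor_section: "tractor_section A c 1 canonical_tractor"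
  by (simp add: tractor_section_def canonical_tractor_def smooth_fun_def smooth_covector_field_def
      chart_smooth_def smooth_on_def o_def Ck_on_const ip_def Let_def)

definition tractor_S :: "('a, 'n::finite) metric \<Rightarrow> ('a, 'n) chart \<Rightarrow>
    ('a, 'n) tractor \<Rightarrow> 'a \<Rightarrow> real" where
  "tractor_S g \<kappa> K p = - tractor_metric g \<kappa> K K p"

definition singularity_set ::
    "('a, 'n::finite) chart set \<Rightarrow> ('a, 'n) metric set \<Rightarrow> ('a, 'n) tractor \<Rightarrow> 'a set" where
  "singularity_set A c K = {p \<in> \<Union> (chart_dom ` A). \<forall>g\<in>c. \<forall>\<kappa>\<in>A. p \<in> chart_dom \<kappa> \<longrightarrow>
     tractor_metric g \<kappa> canonical_tractor K p = 0}"


section \<open>Submanifolds and totally umbilic hypersurfaces\<close>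

text \<open>
  The smooth structure that a subset \<open>S\<close> of a manifold carries if it is an embedded submanifold
  of dimension \<open>CARD('m)\<close>: its charts are those for the subspace topology whose inverse is a
  smooth immersion into the ambient manifold.
\<close>

definition submanifold_atlas ::
    "'a topology \<Rightarrow> ('a, 'n::finite) chart set \<Rightarrow> 'a set \<Rightarrow> ('a, 'm::finite) chart set" where
  "submanifold_atlas M A S = {\<psi>. chart_on (subtopology M S) \<psi> \<and>
     (\<forall>\<kappa>\<in>A. smooth_on (chart_map \<psi> ` (chart_dom \<psi> \<inter> chart_dom \<kappa>)) (chart_map \<kappa> \<circ> chart_inv \<psi>) \<and>
        (\<forall>x \<in> chart_map \<psi> ` (chart_dom \<psi> \<inter> chart_dom \<kappa>).
           inj (frechet_derivative (chart_map \<kappa> \<circ> chart_inv \<psi>) (at x))))}"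

definition induced_conformal :: "'a topology \<Rightarrow> ('a, 'n::finite) chart set \<Rightarrow>
    ('a, 'n) metric set \<Rightarrow> 'a set \<Rightarrow> ('a, 'm::finite) metric set" where
  "induced_conformal M A c S = (let B = submanifold_atlas M A S in
     conformal_rel B `` {\<gamma>. \<exists>g\<in>c. pullback_tensor A B g \<gamma>})"

text \<open>Embedded submanifolds of codimension one, via slice charts (of the maximal atlas).\<close>

definition hypersurface :: "'a topology \<Rightarrow> ('a, 'm::finite) chart set \<Rightarrow> 'a set \<Rightarrow> bool" where
  "hypersurface N B S \<longleftrightarrow> S \<subseteq> topspace N \<and>
     (\<forall>p\<in>S. \<exists>\<kappa>\<in>B. \<exists>k. p \<in> chart_dom \<kappa> \<and>
        S \<inter> chart_dom \<kappa> = {q \<in> chart_dom \<kappa>. chart_map \<kappa> q $ k = 0})"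

text \<open>The tangent space of \<open>S\<close> at \<open>p\<close> (velocities of curves in \<open>S\<close>), in the chart \<open>\<kappa>\<close>.\<close>

definition tangent_space :: "('a, 'm::finite) chart \<Rightarrow> 'a set \<Rightarrow> 'a \<Rightarrow> (real^'m) set" where
  "tangent_space \<kappa> S p = {v. \<exists>x :: real \<Rightarrow> 'a. x 0 = p \<and>
     eventually (\<lambda>t. x t \<in> S \<inter> chart_dom \<kappa>) (nhds 0) \<and>
     ((chart_map \<kappa> \<circ> x) has_vector_derivative v) (at 0)}"

definition unit_normal :: "('a, 'm::finite) metric \<Rightarrow> ('a, 'm) chart \<Rightarrow> 'a set \<Rightarrow> 'a \<Rightarrow>
    real^'m \<Rightarrow> bool" where
  "unit_normal \<gamma> \<kappa> S p n \<longleftrightarrow> ip (\<gamma> \<kappa> p) n n = 1 \<and> (\<forall>v \<in> tangent_space \<kappa> S p. ip (\<gamma> \<kappa> p) v n = 0)"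

definition tangent_field :: "('a, 'm::finite) chart \<Rightarrow> 'a set \<Rightarrow> ('a \<Rightarrow> real^'m) \<Rightarrow> bool" where
  "tangent_field \<kappa> S Y \<longleftrightarrow> chart_smooth \<kappa> Y \<and>
     (\<forall>q \<in> S \<inter> chart_dom \<kappa>. Y q \<in> tangent_space \<kappa> S q)"

text \<open>\<open>II(X, Y) = \<gamma>(\<nabla>\<^sub>X Y, n)\<close>\<close>

definition second_fundamental_form :: "('a, 'm::finite) metric \<Rightarrow> ('a, 'm) chart \<Rightarrow> real^'m \<Rightarrow>
    real^'m \<Rightarrow> ('a \<Rightarrow> real^'m) \<Rightarrow> 'a \<Rightarrow> real" where
  "second_fundamental_form \<gamma> \<kappa> n X Y p =
     ip (\<gamma> \<kappa> p) (\<Sum>b\<in>UNIV. X $ b *\<^sub>R cov_deriv \<gamma> \<kappa> b Y p) n"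

text \<open>
  The vector fields \<open>Y\<close> are only required on chart domains. As the atlas is maximal, these can
  be arbitrarily small, so every tangent vector of a hypersurface is covered.
\<close>

definition umbilic_wrt ::
    "('a, 'm::finite) chart set \<Rightarrow> ('a, 'm) metric \<Rightarrow> 'a set \<Rightarrow> bool" where
  "umbilic_wrt B \<gamma> S \<longleftrightarrow> (\<forall>\<kappa>\<in>B. \<forall>p \<in> S \<inter> chart_dom \<kappa>. \<forall>n. unit_normal \<gamma> \<kappa> S p n \<longrightarrow>
     (\<exists>H. \<forall>X \<in> tangent_space \<kappa> S p. \<forall>Y. tangent_field \<kappa> S Y \<longrightarrow>
        second_fundamental_form \<gamma> \<kappa> n X Y p = H * ip (\<gamma> \<kappa> p) X (Y p)))"

definition totally_umbilic_hypersurface ::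
    "'a topology \<Rightarrow> ('a, 'm::finite) chart set \<Rightarrow> ('a, 'm) metric set \<Rightarrow> 'a set \<Rightarrow> bool" where
  "totally_umbilic_hypersurface N B c S \<longleftrightarrow>
     conformal_manifold N B c \<and> hypersurface N B S \<and> (\<forall>\<gamma>\<in>c. umbilic_wrt B \<gamma> S)"

end

theory Submission
  imports Defs
begin

text \<open>
  Let \<open>\<sigma>\<^sub>i\<close>, \<open>\<mu>\<^sub>i\<close>, \<open>\<rho>\<^sub>i\<close> be the components of \<open>K\<^sub>i\<close> in a scale \<open>g\<close>. The first two slots of the tractor
  connection turn parallelism into \<open>d\<sigma>\<^sub>i = \<mu>\<^sub>i\<close> and \<open>Hess \<sigma>\<^sub>i = - \<rho>\<^sub>i g - \<sigma>\<^sub>i P\<close>, and where both \<open>\<sigma>\<^sub>1\<close> and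
  \<open>\<sigma>\<^sub>2\<close> vanish the tractor metric reduces to \<open>h (K\<^sub>i, K\<^sub>j) = g (grad \<sigma>\<^sub>i, grad \<sigma>\<^sub>j)\<close>. So on the
  intersection of the singularity sets the two gradients are nonzero and orthogonal.

  On the whole singularity set \<open>N\<close> of \<open>K\<^sub>2\<close> already \<open>h (K\<^sub>2, K\<^sub>2) = g (grad \<sigma>\<^sub>2, grad \<sigma>\<^sub>2)\<close>, so \<open>N\<close> is a
  regular level set. Along the intersection the gradient of \<open>\<sigma>\<^sub>1\<close> is tangent to \<open>N\<close> (\<open>gradient_tangent\<close>). Therefore \<open>f = \<sigma>\<^sub>1 |\<^sub>N\<close> has nonzero
  differential on its zero set, which makes the intersection a hypersurface of \<open>N\<close>.

  By the Gauss formula (\<open>koszul_pullback\<close>) the Hessian of \<open>f\<close> for the induced metric \<open>\<gamma>\<close> is the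
  restriction of \<open>Hess \<sigma>\<^sub>1\<close> plus a term with the derivative of \<open>\<sigma>\<^sub>1\<close> normal to \<open>N\<close>. That term is zero
  on the intersection because the gradient is tangent, which leaves \<open>Hess f = - \<rho>\<^sub>1 \<gamma>\<close> there. If \<open>X\<close>
  and \<open>Y\<close> are tangent to the intersection, then \<open>df (Y)\<close> vanishes along it and differentiation gives
  \<open>df (\<nabla>\<^sub>X Y) = - Hess f (X, Y) = \<rho>\<^sub>1 \<gamma> (X, Y)\<close>. The unit normal is a multiple of the gradient of \<open>f\<close>, so the
  second fundamental form is a multiple of \<open>\<gamma>\<close>. A general metric of the induced class is
  \<open>exp (2 * \<omega>) *\<^sub>R \<gamma>\<close>, where \<open>\<omega>\<close> need not be given on the ambient manifold; its connection
  differs by terms that contribute one more multiple of the metric (\<open>koszul_rescaled\<close>).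

  The statement also asserts that \<open>N\<close> with its atlas and the induced class is a conformal manifold.
  Charts of \<open>N\<close> come from slice charts, which the inverse function theorem provides
  (\<open>slice_chart\<close>). Any two charts of \<open>N\<close> are smoothly compatible because a continuous map whose
  composition with an immersion is smooth is itself smooth (\<open>smooth_on_continuous_lift\<close>), and this also
  yields the smoothness of inverse functions.
\<close>

section \<open>Calculus of continuously differentiable maps\<close>

lemma Ck_on_continuous: "Ck_on k S f \<Longrightarrow> continuous_on S f"
  by (cases k) (simp_all add: continuous_at_imp_continuous_on differentiable_imp_continuous_within)

lemma Ck_on_SucD: "Ck_on (Suc k) S f \<Longrightarrow> Ck_on k S f"
proof (induction k arbitrary: f)
  case 0
  then show ?case using Ck_on_continuous[of "Suc 0" S f] by simp
next
  case (Suc k)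
  then show ?case using Ck_on.simps(2) by metis
qed

lemma Ck_on_subset: "Ck_on k S f \<Longrightarrow> T \<subseteq> S \<Longrightarrow> Ck_on k T f"
proof (induction k arbitrary: f)
  case 0
  then show ?case using continuous_on_subset by auto
next
  case (Suc k)
  then show ?case unfolding Ck_on.simps by blast
qed

lemma has_derivative_cong_open:
  fixes f g :: "'x::real_normed_vector \<Rightarrow> 'y::real_normed_vector"
  assumes "open S" "x \<in> S" "\<And>y. y \<in> S \<Longrightarrow> f y = g y"
  shows "(f has_derivative f') (at x) \<longleftrightarrow> (g has_derivative f') (at x)"
proof
  show "(g has_derivative f') (at x)" if "(f has_derivative f') (at x)"
    by (rule has_derivative_transform_within_open[OF that assms(1,2)]) (use assms(3) in auto)
  show "(f has_derivative f') (at x)" if "(g has_derivative f') (at x)"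
    by (rule has_derivative_transform_within_open[OF that assms(1,2)]) (use assms(3) in auto)
qed

lemma frechet_derivative_cong_open:
  fixes f g :: "'x::real_normed_vector \<Rightarrow> 'y::real_normed_vector"
  assumes "open S" "x \<in> S" "\<And>y. y \<in> S \<Longrightarrow> f y = g y"
  shows "frechet_derivative f (at x) = frechet_derivative g (at x)"
proof -
  have "(f has_derivative f') (at x) \<longleftrightarrow> (g has_derivative f') (at x)" for f'
    using assms by (rule has_derivative_cong_open)
  then show ?thesis by (simp add: frechet_derivative_def)
qed

lemma differentiable_cong_open:
  fixes f g :: "'x::real_normed_vector \<Rightarrow> 'y::real_normed_vector"
  assumes "open S" "x \<in> S" "\<And>y. y \<in> S \<Longrightarrow> f y = g y"
  shows "f differentiable (at x) \<longleftrightarrow> g differentiable (at x)"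
proof -
  have "(f has_derivative f') (at x) \<longleftrightarrow> (g has_derivative f') (at x)" for f'
    using assms by (rule has_derivative_cong_open)
  then show ?thesis by (simp add: differentiable_def)
qed

lemma Ck_on_cong:
  assumes "open S" "\<And>x. x \<in> S \<Longrightarrow> f x = g x" "Ck_on k S f"
  shows "Ck_on k S g"
  using assms(2,3)
proof (induction k arbitrary: f g)
  case 0
  then show ?case by (simp cong: continuous_on_cong)
next
  case (Suc k)
  have "frechet_derivative f (at x) = frechet_derivative g (at x)" if "x \<in> S" for x
    by (rule frechet_derivative_cong_open[OF assms(1) that Suc.prems(1)])
  then have "Ck_on k S (\<lambda>x. frechet_derivative g (at x) (axis i 1))" for i
    using Suc.prems(2) by (intro Suc.IH[of "\<lambda>x. frechet_derivative f (at x) (axis i 1)"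
          "\<lambda>x. frechet_derivative g (at x) (axis i 1)"]) auto
  moreover have "g differentiable (at x)" if "x \<in> S" for x
  proof -
    have "f differentiable (at x) \<longleftrightarrow> g differentiable (at x)"
      by (rule differentiable_cong_open[OF assms(1) that Suc.prems(1)])
    then show ?thesis using Suc.prems(2) that by simp
  qed
  ultimately show ?case by simp
qed

lemma Ck_on_local:
  assumes "\<And>x. x \<in> S \<Longrightarrow> \<exists>U. open U \<and> x \<in> U \<and> Ck_on k U f"
  shows "Ck_on k S f"
  using assms
proof (induction k arbitrary: f)
  case 0
  have "isCont f x" if "x \<in> S" for x
    using 0[OF that] by (auto simp: continuous_on_eq_continuous_at)
  then show ?case by (simp add: continuous_at_imp_continuous_on)
next
  case (Suc k)
  show ?case
    unfolding Ck_on.simps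
  proof (intro conjI ballI allI)
    show "f differentiable (at x)" if "x \<in> S" for x
      using Suc.prems[OF that] by auto
    show "Ck_on k S (\<lambda>x. frechet_derivative f (at x) (axis i 1))" for i
    proof (rule Suc.IH)
      fix x assume "x \<in> S"
      then obtain U where "open U" "x \<in> U" "Ck_on (Suc k) U f" using Suc.prems by blast
      then show "\<exists>U. open U \<and> x \<in> U \<and> Ck_on k U (\<lambda>x. frechet_derivative f (at x) (axis i 1))"
        by auto
    qed
  qed
qed

lemma Ck_on_SucI:
  assumes "open S" "\<And>x. x \<in> S \<Longrightarrow> (f has_derivative f' x) (at x)"
    and "\<And>i. Ck_on k S (\<lambda>x. f' x (axis i 1))"
  shows "Ck_on (Suc k) S f"
proof -
  have *: "frechet_derivative f (at x) = f' x" if "x \<in> S" for x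
    using frechet_derivative_at[OF assms(2)[OF that]] by simp
  have "Ck_on k S (\<lambda>x. frechet_derivative f (at x) (axis i 1))" for i
    by (rule Ck_on_cong[OF assms(1) _ assms(3)[of i]]) (simp add: *)
  then show ?thesis using assms(2) by (auto simp: differentiable_def)
qed

lemma Ck_on_has_derivative:
  "Ck_on (Suc k) S f \<Longrightarrow> x \<in> S \<Longrightarrow> (f has_derivative frechet_derivative f (at x)) (at x)"
  by (simp flip: frechet_derivative_works)

lemma Ck_on_bounded_linear:
  assumes "bounded_linear L" "open S" "Ck_on k S f"
  shows "Ck_on k S (\<lambda>x. L (f x))"
  using assms(3)
proof (induction k arbitrary: f)
  case 0
  then have "continuous_on S f" by simp
  then have "continuous_on S (\<lambda>x. L (f x))" by (rule bounded_linear.continuous_on[OF assms(1)])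
  then show ?case by simp
next
  case (Suc k)
  show ?case
  proof (rule Ck_on_SucI[OF assms(2)])
    show "((\<lambda>x. L (f x)) has_derivative (\<lambda>v. L (frechet_derivative f (at x) v))) (at x)" if "x \<in> S" for x
      by (rule bounded_linear.has_derivative[OF assms(1) Ck_on_has_derivative[OF Suc.prems that]])
    show "Ck_on k S (\<lambda>x. L (frechet_derivative f (at x) (axis i 1)))" for i
      using Suc.prems by (intro Suc.IH) simp
  qed
qed

lemma Ck_on_add:
  assumes "open S" "Ck_on k S f" "Ck_on k S g"
  shows "Ck_on k S (\<lambda>x. f x + g x)"
  using assms(2,3)
proof (induction k arbitrary: f g)
  case 0
  then show ?case by (simp add: continuous_on_add)
next
  case (Suc k)
  show ?case
  proof (rule Ck_on_SucI[OF assms(1)])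
    show "((\<lambda>x. f x + g x) has_derivative
        (\<lambda>v. frechet_derivative f (at x) v + frechet_derivative g (at x) v)) (at x)" if "x \<in> S" for x
      using Suc.prems[THEN Ck_on_has_derivative, OF that] by (rule has_derivative_add)
    show "Ck_on k S (\<lambda>x. frechet_derivative f (at x) (axis i 1) + frechet_derivative g (at x) (axis i 1))" for i
      using Suc.prems by (intro Suc.IH) simp_all
  qed
qed

lemma Ck_on_sum:
  assumes "open S" "\<And>i. i \<in> I \<Longrightarrow> Ck_on k S (f i)"
  shows "Ck_on k S (\<lambda>x. \<Sum>i\<in>I. f i x)"
  using assms(2) by (induction I rule: infinite_finite_induct) (auto simp: Ck_on_const Ck_on_add[OF assms(1)])

lemma Ck_on_bilinear:
  assumes "bounded_bilinear B" "open S" "Ck_on k S f" "Ck_on k S g"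
  shows "Ck_on k S (\<lambda>x. B (f x) (g x))"
  using assms(3,4)
proof (induction k arbitrary: f g)
  case 0
  then have "continuous_on S f" "continuous_on S g" by simp_all
  then have "continuous_on S (\<lambda>x. B (f x) (g x))" by (rule bounded_bilinear.continuous_on[OF assms(1)])
  then show ?case by simp
next
  case (Suc k)
  show ?case
  proof (rule Ck_on_SucI[OF assms(2)])
    show "((\<lambda>x. B (f x) (g x)) has_derivative
        (\<lambda>v. B (f x) (frechet_derivative g (at x) v) + B (frechet_derivative f (at x) v) (g x))) (at x)"
      if "x \<in> S" for x
      using Suc.prems[THEN Ck_on_has_derivative, OF that] by (rule bounded_bilinear.FDERIV[OF assms(1)])
    show "Ck_on k S (\<lambda>x. B (f x) (frechet_derivative g (at x) (axis i 1)) +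
        B (frechet_derivative f (at x) (axis i 1)) (g x))" for i
      using Suc.prems Suc.prems[THEN Ck_on_SucD] by (intro Ck_on_add assms(2) Suc.IH) simp_all
  qed
qed

lemmas Ck_on_mult = Ck_on_bilinear[OF bounded_bilinear_mult]
lemmas Ck_on_scaleR = Ck_on_bilinear[OF bounded_bilinear_scaleR]

lemma Ck_on_prod:
  fixes f :: "'i \<Rightarrow> real^'n \<Rightarrow> real"
  assumes "open S" "\<And>i. i \<in> I \<Longrightarrow> Ck_on k S (f i)"
  shows "Ck_on k S (\<lambda>x. \<Prod>i\<in>I. f i x)"
  using assms(2) by (induction I rule: infinite_finite_induct) (auto simp: Ck_on_const Ck_on_mult[OF assms(1)])

lemma Ck_on_inverse:
  fixes f :: "real^'n \<Rightarrow> real"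
  assumes "open S" "\<And>x. x \<in> S \<Longrightarrow> f x \<noteq> 0" "Ck_on k S f"
  shows "Ck_on k S (\<lambda>x. inverse (f x))"
  using assms(3)
proof (induction k)
  case 0
  then show ?case using assms(2) by (auto intro: continuous_on_inverse)
next
  case (Suc k)
  have d: "((\<lambda>x. inverse (f x)) has_derivative
      (\<lambda>h. - (inverse (f x) * frechet_derivative f (at x) h * inverse (f x)))) (at x)" if "x \<in> S" for x
    using Deriv.has_derivative_inverse[OF assms(2)[OF that] Ck_on_has_derivative[OF Suc.prems that]] .
  have "Ck_on k S (\<lambda>x. inverse (f x))" using Suc.IH Ck_on_SucD[OF Suc.prems] by blast
  then show ?case
    by (intro Ck_on_SucI[OF assms(1) d] Ck_on_bounded_linear[OF bounded_linear_minus[OF bounded_linear_ident]]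
        Ck_on_mult assms(1)) (use Suc.prems in auto)
qed

lemma linear_eq_sum_axis:
  fixes f :: "real^'n \<Rightarrow> 'b::real_vector"
  assumes "linear f"
  shows "f v = (\<Sum>i\<in>UNIV. v $ i *\<^sub>R f (axis i 1))"
proof -
  have "f v = f (\<Sum>i\<in>UNIV. v $ i *\<^sub>R axis i 1)"
    by (simp add: basis_expansion flip: scalar_mult_eq_scaleR)
  also have "\<dots> = (\<Sum>i\<in>UNIV. v $ i *\<^sub>R f (axis i 1))"
    using assms by (simp add: linear_sum linear_cmul)
  finally show ?thesis .
qed

lemma Ck_on_derivative:
  assumes "open S" "Ck_on (Suc k) S f"
  shows "Ck_on k S (\<lambda>x. frechet_derivative f (at x) v)"
proof (rule Ck_on_cong[OF assms(1)])
  show "Ck_on k S (\<lambda>x. \<Sum>i\<in>UNIV. v $ i *\<^sub>R frechet_derivative f (at x) (axis i 1))"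
    using assms by (auto intro!: Ck_on_sum Ck_on_scaleR Ck_on_const)
  show "(\<Sum>i\<in>UNIV. v $ i *\<^sub>R frechet_derivative f (at x) (axis i 1)) = frechet_derivative f (at x) v"
    if "x \<in> S" for x
    using assms that linear_eq_sum_axis[OF linear_frechet_derivative, of f "at x" v] by simp
qed

lemma Ck_on_vec:
  assumes "open S" "\<And>j. Ck_on k S (\<lambda>x. f x $ j)"
  shows "Ck_on k S (f :: real^'n \<Rightarrow> real^'m)"
proof (rule Ck_on_cong[OF assms(1)])
  show "Ck_on k S (\<lambda>x. \<Sum>j\<in>UNIV. f x $ j *\<^sub>R axis j 1)"
    using assms by (auto intro!: Ck_on_sum Ck_on_scaleR Ck_on_const)
qed (simp add: basis_expansion flip: scalar_mult_eq_scaleR)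

lemma Ck_on_linear:
  assumes "bounded_linear L" "open S"
  shows "Ck_on k S L"
proof (cases k)
  case 0
  have "continuous_on S L" by (rule bounded_linear.continuous_on[OF assms(1) continuous_on_id])
  then show ?thesis using 0 by simp
next
  case (Suc n)
  show ?thesis unfolding Suc
    by (rule Ck_on_SucI[OF assms(2), where f' = "\<lambda>_. L"])
      (use assms in \<open>auto intro!: bounded_linear_imp_has_derivative Ck_on_const\<close>)
qed

lemma Ck_on_compose:
  fixes f :: "real^'n \<Rightarrow> real^'m"
  assumes "open S" "open T" "f ` S \<subseteq> T" "Ck_on k S f" "Ck_on k T g"
  shows "Ck_on k S (\<lambda>x. g (f x))"
  using assms(4,5)
proof (induction k arbitrary: g)
  case 0
  then show ?case using continuous_on_compose2 assms(3) by auto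
next
  case (Suc k)
  have lin: "linear (frechet_derivative g (at (f x)))" if "x \<in> S" for x
    using Suc.prems(2) assms(3) that by (auto intro!: linear_frechet_derivative)
  have d: "((\<lambda>x. g (f x)) has_derivative (\<lambda>v. \<Sum>j\<in>UNIV.
     frechet_derivative f (at x) v $ j *\<^sub>R frechet_derivative g (at (f x)) (axis j 1))) (at x)" if "x \<in> S" for x
  proof -
    have "((\<lambda>x. g (f x)) has_derivative (\<lambda>v. frechet_derivative g (at (f x)) (frechet_derivative f (at x) v))) (at x)"
      using has_derivative_compose[OF Ck_on_has_derivative[OF Suc.prems(1) that] Ck_on_has_derivative[OF Suc.prems(2)]]
        assms(3) that by auto
    then show ?thesis unfolding linear_eq_sum_axis[OF lin[OF that], symmetric] .
  qed
  have "Ck_on k S (\<lambda>x. frechet_derivative g (at (f x)) (axis j 1))" for j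
    using Suc.prems Suc.IH[of "\<lambda>x. frechet_derivative g (at x) (axis j 1)"] Ck_on_SucD by auto
  moreover have "Ck_on k S (\<lambda>x. frechet_derivative f (at x) (axis i 1) $ j)" for i j
    using Suc.prems(1) by (auto intro!: Ck_on_bounded_linear[OF bounded_linear_vec_nth] assms(1))
  ultimately show ?case
    by (intro Ck_on_SucI[OF assms(1) d] Ck_on_sum Ck_on_scaleR assms(1)) auto
qed

lemma Ck_on_det:
  fixes A :: "real^'n \<Rightarrow> real^'m^'m"
  assumes "open S" "\<And>i j. Ck_on k S (\<lambda>x. A x $ i $ j)"
  shows "Ck_on k S (\<lambda>x. det (A x))"
  unfolding det_def using assms
  by (intro Ck_on_sum Ck_on_mult Ck_on_prod Ck_on_const) auto

text \<open>
  Cramer's rule writes the solution of a linear system as a quotient of determinants, so it is as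
  regular as the coefficients. Every matrix inverse below is differentiated through this lemma.
\<close>

lemma Ck_on_solution:
  fixes A :: "real^'n \<Rightarrow> real^'m^'m"
  assumes "open S" "\<And>i j. Ck_on k S (\<lambda>x. A x $ i $ j)" "\<And>i. Ck_on k S (\<lambda>x. b x $ i)"
    and det: "\<And>x. x \<in> S \<Longrightarrow> det (A x) \<noteq> 0" and eq: "\<And>x. x \<in> S \<Longrightarrow> A x *v y x = b x"
  shows "Ck_on k S y"
proof (rule Ck_on_vec[OF assms(1)])
  fix j
  show "Ck_on k S (\<lambda>x. y x $ j)"
  proof (rule Ck_on_cong[OF assms(1)])
    show "Ck_on k S (\<lambda>x. det (\<chi> i l. if l = j then b x $ i else A x $ i $ l) * inverse (det (A x)))"
    proof (intro Ck_on_mult Ck_on_det Ck_on_inverse assms)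
      show "Ck_on k S (\<lambda>x. (\<chi> i l. if l = j then b x $ i else A x $ i $ l) $ i $ l)" for i l
        using assms(2)[of i l] assms(3)[of i] by (cases "l = j") auto
    qed
    show "det (\<chi> i l. if l = j then b x $ i else A x $ i $ l) * inverse (det (A x)) = y x $ j"
      if "x \<in> S" for x
      using cramer[OF det[OF that], of "y x" "b x"] eq[OF that] by (simp add: divide_inverse)
  qed
qed

section \<open>Continuous lifts through immersions\<close>

text \<open>
  If \<open>L\<close> is a left inverse of \<open>F'\<close>, then \<open>T y - T x\<close> differs from \<open>L (G y - G x)\<close> by an error that
  is small compared with \<open>T y - T x\<close> itself. Continuity of \<open>T\<close> allows this error to be absorbed,
  which first gives a Lipschitz estimate for \<open>T\<close> at \<open>x\<close> and then the derivative \<open>L \<circ> G'\<close>.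
\<close>

lemma continuous_lift_has_derivative:
  fixes T :: "'x::euclidean_space \<Rightarrow> 'y::euclidean_space" and F :: "'y \<Rightarrow> 'z::euclidean_space"
  assumes "open U" "x \<in> U" "continuous (at x) T"
    and F: "(F has_derivative F') (at (T x))" and "inj F'"
    and G: "(G has_derivative G') (at x)" and FT: "\<And>y. y \<in> U \<Longrightarrow> F (T y) = G y"
  shows "\<exists>T'. (T has_derivative T') (at x)"
proof -
  have linF: "linear F'" "bounded_linear F'" and linG: "bounded_linear G'"
    using F G has_derivative_bounded_linear has_derivative_linear by blast+
  obtain L where L: "linear L" "L \<circ> F' = id"
    using linear_injective_left_inverse[OF linF(1) \<open>inj F'\<close>] by blast
  have LF: "L (F' v) = v" for v using L(2) by (metis comp_apply id_apply)
  obtain C where C: "C > 0" "\<And>v. norm (L v) \<le> C * norm v"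
    using linear_bounded_pos[OF L(1)] by blast
  obtain K where K: "K > 0" "\<And>v. norm (G' v) \<le> K * norm v"
    using bounded_linear.pos_bounded[OF linG] by (metis mult.commute)
  have "(T has_derivative (\<lambda>v. L (G' v))) (at x)"
    unfolding has_derivative_within_alt2
  proof (intro conjI allI impI)
    show "bounded_linear (\<lambda>v. L (G' v))"
      using linear_conv_bounded_linear L(1) linG bounded_linear_compose by blast
    fix e :: real assume "e > 0"
    have evG: "\<And>e. e > 0 \<Longrightarrow> \<forall>\<^sub>F y in at x. norm (G y - G x - G' (y - x)) \<le> e * norm (y - x)"
      using G unfolding has_derivative_within_alt2 by auto
    have evF: "\<forall>\<^sub>F y in at x. norm (F (T y) - F (T x) - F' (T y - T x)) \<le> e * norm (T y - T x)"
      if "e > 0" for e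
    proof -
      have "\<forall>\<^sub>F z in at (T x). norm (F z - F (T x) - F' (z - T x)) \<le> e * norm (z - T x)"
        using F \<open>e > 0\<close> unfolding has_derivative_within_alt2 by auto
      then have "\<forall>\<^sub>F z in nhds (T x). norm (F z - F (T x) - F' (z - T x)) \<le> e * norm (z - T x)"
        unfolding eventually_at_filter
        by (rule eventually_mono) (metis (no_types, lifting) UNIV_I cancel_comm_monoid_add_class.diff_cancel linF(1) linear_0 norm_zero mult_zero_right order_refl)
      then show ?thesis
        using \<open>continuous (at x) T\<close> unfolding continuous_at
        by (rule eventually_compose_filterlim)
    qed
    \<comment> \<open>\<open>e1\<close> serves the remainder of \<open>G\<close>. The first bound in \<open>e2\<close> absorbs the remainder of \<open>F\<close> into
      half of \<open>norm (T y - T x)\<close>; the second makes it small, as \<open>2 * C * (K + 1)\<close> is the Lipschitz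
      constant of \<open>T\<close> at \<open>x\<close> that results.\<close>
    define e1 where "e1 = e / (2 * C)"
    define e2 where "e2 = min (1 / (2 * C)) (e / (2 * C * (2 * C * (K + 1))))"
    have pos: "e1 > 0" "e2 > 0" using \<open>e > 0\<close> C K by (auto simp: e1_def e2_def)
    have e2C: "C * e2 \<le> 1 / 2" "C * e2 * (2 * C * (K + 1)) \<le> e / 2"
    proof -
      have "C * e2 \<le> C * (1 / (2 * C))" using C(1) by (intro mult_left_mono) (auto simp: e2_def)
      then show "C * e2 \<le> 1 / 2" using C(1) by simp
      define m where "m = 2 * C * (K + 1)"
      have "m > 0" "e2 \<le> e / (2 * C * m)" using C(1) K(1) by (auto simp: m_def e2_def)
      then have "e2 * (2 * C * m) \<le> e" using C(1) by (simp add: pos_le_divide_eq)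
      then show "C * e2 * (2 * C * (K + 1)) \<le> e / 2" unfolding m_def[symmetric] by (simp add: algebra_simps)
    qed
    have "\<forall>\<^sub>F y in at x. y \<in> U" using assms(1,2) eventually_at_in_open' by blast
    then show "\<forall>\<^sub>F y in at x. norm (T y - T x - L (G' (y - x))) \<le> e * norm (y - x)"
      using evG[OF pos(1)] evG[of 1, simplified] evF[OF pos(2)]
    proof eventually_elim
      case (elim y)
      define r where "r = G y - G x - G' (y - x)"
      define s where "s = F (T y) - F (T x) - F' (T y - T x)"
      have Geq: "G y - G x = F' (T y - T x) + s"
        using FT[OF elim(1)] FT[OF assms(2)] by (simp add: s_def)
      have Teq: "T y - T x = L (G y - G x) - L s"
        using Geq LF L(1) by (simp add: linear_add)
      have "norm (G y - G x) \<le> norm r + norm (G' (y - x))"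
        unfolding r_def by (metis diff_add_cancel norm_triangle_ineq)
      also have "\<dots> \<le> norm (y - x) + K * norm (y - x)"
        using elim(3) K(2)[of "y - x"] by (simp add: r_def)
      finally have Gb: "norm (G y - G x) \<le> (K + 1) * norm (y - x)" by (simp add: algebra_simps)
      have Ls: "norm (L s) \<le> C * e2 * norm (T y - T x)"
      proof -
        have "C * norm s \<le> C * (e2 * norm (T y - T x))"
          using elim(4) C(1) by (intro mult_left_mono) (auto simp: s_def)
        then show ?thesis using C(2)[of s] by (simp add: mult.assoc)
      qed
      have "norm (L s) \<le> 1 / 2 * norm (T y - T x)"
        using Ls e2C(1) mult_right_mono[OF e2C(1), of "norm (T y - T x)"] by simp
      then have "norm (T y - T x) \<le> norm (L (G y - G x)) + 1 / 2 * norm (T y - T x)"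
        unfolding Teq[symmetric] using Teq norm_triangle_ineq4[of "L (G y - G x)" "L s"] by simp
      then have "norm (T y - T x) \<le> 2 * norm (L (G y - G x))" by simp
      also have "\<dots> \<le> 2 * (C * norm (G y - G x))" using C(2) by simp
      also have "\<dots> \<le> 2 * (C * ((K + 1) * norm (y - x)))"
        using Gb C(1) by simp
      finally have Tb: "norm (T y - T x) \<le> 2 * C * (K + 1) * norm (y - x)" by simp
      have "norm (L s) \<le> C * e2 * (2 * C * (K + 1) * norm (y - x))"
        using Ls Tb pos(2) C(1) by (meson mult_left_mono mult_nonneg_nonneg less_imp_le order_trans)
      also have "\<dots> \<le> e / 2 * norm (y - x)"
        using mult_right_mono[OF e2C(2), of "norm (y - x)"] by (simp add: mult.assoc)
      finally have 1: "norm (L s) \<le> e / 2 * norm (y - x)" .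
      have "norm (L r) \<le> C * (e1 * norm (y - x))"
        using C elim(2) unfolding r_def by (meson mult_left_mono less_imp_le order_trans)
      then have 2: "norm (L r) \<le> e / 2 * norm (y - x)" using C(1) by (simp add: e1_def)
      have "T y - T x - L (G' (y - x)) = L r - L s"
        unfolding Teq using L(1) by (simp add: r_def linear_diff)
      moreover have "norm (L r - L s) \<le> e * norm (y - x)"
        using 1 2 norm_triangle_ineq4[of "L r" "L s"] by simp
      ultimately show ?case by simp
    qed
  qed
  then show ?thesis by blast
qed

lemma smooth_onD: "smooth_on S f \<Longrightarrow> Ck_on k S f"
  by (simp add: smooth_on_def)

lemma smooth_on_has_derivative:
  "smooth_on S f \<Longrightarrow> x \<in> S \<Longrightarrow> (f has_derivative frechet_derivative f (at x)) (at x)"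
  using Ck_on_has_derivative[OF smooth_onD[of S f "Suc 0"]] by blast

lemma smooth_on_linear_derivative:
  "smooth_on S f \<Longrightarrow> x \<in> S \<Longrightarrow> linear (frechet_derivative f (at x))"
  using smooth_on_has_derivative has_derivative_linear by blast

lemma Ck_on_matrix_mult:
  fixes A :: "real^'n \<Rightarrow> real^'m^'l" and v :: "real^'n \<Rightarrow> real^'m"
  assumes "open S" "\<And>i j. Ck_on k S (\<lambda>x. A x $ i $ j)" "\<And>j. Ck_on k S (\<lambda>x. v x $ j)"
  shows "Ck_on k S (\<lambda>x. (A x *v v x) $ i)"
  unfolding matrix_vector_mult_def using assms by (auto intro!: Ck_on_sum Ck_on_mult)

text \<open>
  The derivative of \<open>T\<close> solves the linear system \<open>F' (T x) (T' x) = G' x\<close>, and the normal equations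
  turn it into an invertible one. Its coefficients involve \<open>T\<close> but no derivative of \<open>T\<close>, so \<open>T\<close>
  gains one order of regularity at a time. This gives both the smoothness of inverse functions
  and the smooth compatibility of the charts of a submanifold.
\<close>

lemma smooth_on_continuous_lift:
  fixes T :: "real^'l \<Rightarrow> real^'m" and F :: "real^'m \<Rightarrow> real^'n"
  assumes "open U" "open V" "continuous_on U T" "T ` U \<subseteq> V"
    and F: "smooth_on V F" "\<And>z. z \<in> V \<Longrightarrow> inj (frechet_derivative F (at z))"
    and G: "smooth_on U G" and FT: "\<And>y. y \<in> U \<Longrightarrow> F (T y) = G y"
  shows "smooth_on U T"
proof -
  have dT: "(T has_derivative frechet_derivative T (at x)) (at x)" if "x \<in> U" for x
  proof -
    have "T x \<in> V" "continuous (at x) T"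
      using assms that by (auto simp: continuous_on_eq_continuous_at)
    then have "\<exists>T'. (T has_derivative T') (at x)"
      using continuous_lift_has_derivative[OF assms(1) that _ smooth_on_has_derivative[OF F(1)] F(2)
          smooth_on_has_derivative[OF G that]] FT by blast
    then show ?thesis using frechet_derivative_works differentiable_def by blast
  qed
  define J where "J x = matrix (frechet_derivative F (at (T x)))" for x
  define N where "N x = transpose (J x) ** J x" for x
  have Jv: "J x *v w = frechet_derivative F (at (T x)) w" if "x \<in> U" for x w
    using smooth_on_linear_derivative[OF F(1)] assms(4) that
    by (auto simp: J_def matrix_works image_subset_iff)
  have det: "det (N x) \<noteq> 0" if "x \<in> U" for x
  proof -
    have "w = 0" if "N x *v w = 0" for w
    proof -
      have "0 = w \<bullet> (N x *v w)" using that by simp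
      also have "\<dots> = (J x *v w) \<bullet> (J x *v w)"
        by (simp add: N_def matrix_vector_mul_assoc[symmetric] dot_lmul_matrix[symmetric] vector_transpose_matrix inner_commute)
      finally have "frechet_derivative F (at (T x)) w = frechet_derivative F (at (T x)) 0"
        using Jv[OF \<open>x \<in> U\<close>] by (metis inner_eq_zero_iff matrix_vector_mult_0_right)
      then show "w = 0" using F(2)[of "T x"] \<open>x \<in> U\<close> assms(4) by (auto dest: injD)
    qed
    then have "\<exists>B. B ** N x = mat 1" by (simp add: matrix_left_invertible_ker)
    then show ?thesis by (metis invertible_det_nz invertible_left_inverse)
  qed
  have dFT: "frechet_derivative F (at (T x)) (frechet_derivative T (at x) w) = frechet_derivative G (at x) w"
    if "x \<in> U" for x w
  proof -
    have "((\<lambda>y. F (T y)) has_derivative (\<lambda>w. frechet_derivative F (at (T x)) (frechet_derivative T (at x) w))) (at x)"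
      using has_derivative_compose[OF dT[OF that] smooth_on_has_derivative[OF F(1)]] that assms(4) by auto
    then have "(G has_derivative (\<lambda>w. frechet_derivative F (at (T x)) (frechet_derivative T (at x) w))) (at x)"
      using has_derivative_transform_within_open[OF _ assms(1) that] FT by blast
    then show ?thesis using frechet_derivative_at by metis
  qed
  have "Ck_on k U T" for k
  proof (induction k)
    case 0
    then show ?case using assms(3) by simp
  next
    case (Suc k)
    have J: "Ck_on k U (\<lambda>x. J x $ a $ b)" for a b
    proof -
      have "Ck_on k V (\<lambda>z. frechet_derivative F (at z) (axis b 1))"
        using smooth_onD[OF F(1), of "Suc k"] by simp
      then have "Ck_on k U (\<lambda>x. frechet_derivative F (at (T x)) (axis b 1))"
        by (rule Ck_on_compose[OF assms(1,2,4) Suc.IH])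
      from Ck_on_bounded_linear[OF bounded_linear_vec_nth assms(1) this, of a]
      show ?thesis by (simp add: J_def matrix_def)
    qed
    have N: "Ck_on k U (\<lambda>x. N x $ a $ b)" for a b
      unfolding N_def matrix_matrix_mult_def transpose_def using J
      by (auto intro!: Ck_on_sum Ck_on_mult assms(1))
    show ?case
    proof (rule Ck_on_SucI[OF assms(1) dT])
      fix i
      show "Ck_on k U (\<lambda>x. frechet_derivative T (at x) (axis i 1))"
      proof (rule Ck_on_solution[OF assms(1) N _ det])
        show "N x *v frechet_derivative T (at x) (axis i 1) =
          transpose (J x) *v frechet_derivative G (at x) (axis i 1)" if "x \<in> U" for x
          using Jv[OF that] dFT[OF that] by (simp add: N_def matrix_vector_mul_assoc[symmetric])
        have "Ck_on k U (\<lambda>x. frechet_derivative G (at x) (axis i 1) $ j)" for j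
          using smooth_onD[OF G, of "Suc k"]
          by (intro Ck_on_bounded_linear[OF bounded_linear_vec_nth assms(1)]) simp
        then show "Ck_on k U (\<lambda>x. (transpose (J x) *v frechet_derivative G (at x) (axis i 1)) $ j)" for j
          by (intro Ck_on_matrix_mult assms(1)) (simp_all add: transpose_def J)
      qed
    qed
  qed
  then show ?thesis by (simp add: smooth_on_def)
qed

lemma linear_eqI_axis:
  fixes f g :: "real^'n \<Rightarrow> 'b::real_vector"
  assumes "linear f" "linear g" "\<And>i. f (axis i 1) = g (axis i 1)"
  shows "f = g"
proof
  show "f v = g v" for v
    using linear_eq_sum_axis[OF assms(1), of v] linear_eq_sum_axis[OF assms(2), of v] by (simp add: assms(3))
qed

text \<open>
  The inverse function theorem yields a differentiable local inverse; it is smooth because it is a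
  continuous lift of the identity through \<open>F\<close>.
\<close>

lemma smooth_on_local_inverse:
  fixes F :: "real^'n \<Rightarrow> real^'n"
  assumes "open W" "smooth_on W F" "x0 \<in> W" "inj (frechet_derivative F (at x0))"
  obtains U V g where "open U" "U \<subseteq> W" "x0 \<in> U" "open V" "homeomorphism U V F g"
    "\<And>x. x \<in> U \<Longrightarrow> inj (frechet_derivative F (at x))" "smooth_on V g"
proof -
  let ?D = "\<lambda>x. frechet_derivative F (at x)"
  have bl: "bounded_linear (?D x)" if "x \<in> W" for x
    using smooth_on_has_derivative[OF assms(2) that] has_derivative_bounded_linear by blast
  define f' where "f' x = Blinfun (?D x)" for x
  have f': "blinfun_apply (f' x) = ?D x" if "x \<in> W" for x
    using bl[OF that] by (simp add: f'_def bounded_linear_Blinfun_apply)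
  have "continuous_on W (\<lambda>x. f' x (axis i 1))" for i
  proof -
    have "continuous_on W (\<lambda>x. ?D x (axis i 1))"
      using smooth_onD[OF assms(2), of "Suc 0"] by simp
    then show ?thesis using f' by (simp cong: continuous_on_cong)
  qed
  then have cont: "continuous_on W f'"
    by (intro continuous_on_blinfun_componentwise) (auto simp: Basis_vec_def)
  obtain L where L: "linear L" "L \<circ> ?D x0 = id"
    using linear_injective_left_inverse assms smooth_on_linear_derivative by metis
  have inv: "Blinfun L o\<^sub>L f' x0 = id_blinfun"
    using L f'[OF assms(3)]
    by (intro blinfun_eqI) (simp add: bounded_linear_Blinfun_apply linear_conv_bounded_linear o_def fun_eq_iff id_def)
  obtain U V g g' where *: "open U" "U \<subseteq> W" "x0 \<in> U" "open V" "F x0 \<in> V" "homeomorphism U V F g"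
    "\<And>y. y \<in> V \<Longrightarrow> (g has_derivative g' y) (at y)"
    "\<And>y. y \<in> V \<Longrightarrow> g' y = inv (blinfun_apply (f' (g y)))"
    "\<And>y. y \<in> V \<Longrightarrow> bij (blinfun_apply (f' (g y)))"
  proof (rule inverse_function_theorem[OF assms(1) _ cont assms(3) inv, of F])
    show "(F has_derivative blinfun_apply (f' x)) (at x)" if "x \<in> W" for x
      using smooth_on_has_derivative[OF assms(2) that] f'[OF that] by simp
  qed (rule that)
  have i: "inj (?D x)" if "x \<in> U" for x
  proof -
    have "F x \<in> V" "g (F x) = x" using *(6) that by (auto simp: homeomorphism_def)
    then show ?thesis using *(9)[of "F x"] f'[of x] *(2) that by (auto simp: bij_def)
  qed
  have "smooth_on V g"
  proof (rule smooth_on_continuous_lift[OF *(4,1)])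
    show "continuous_on V g" "g ` V \<subseteq> U" "\<And>y. y \<in> V \<Longrightarrow> F (g y) = (\<lambda>y. y) y"
      using *(6) by (auto simp: homeomorphism_def)
    show "smooth_on U F" using assms(2) *(2) Ck_on_subset unfolding smooth_on_def by blast
    show "smooth_on V (\<lambda>y. y)" unfolding smooth_on_def
      using Ck_on_linear[OF bounded_linear_ident *(4)] by blast
  qed (use i in auto)
  with * i show ?thesis by (intro that[of U V g]) auto
qed

section \<open>Symmetry of second derivatives\<close>

lemma field_derivative_along_line:
  assumes "(f has_derivative D) (at (p + t *\<^sub>R w))"
  shows "((\<lambda>t. f (p + t *\<^sub>R w)) has_field_derivative D w) (at t)"
proof -
  have "((\<lambda>t. p + t *\<^sub>R w) has_derivative (\<lambda>h. h *\<^sub>R w)) (at t)"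
    by (auto intro!: derivative_eq_intros)
  from has_derivative_compose[OF this, of f D] assms
  have "((\<lambda>t. f (p + t *\<^sub>R w)) has_derivative (\<lambda>h. D (h *\<^sub>R w))) (at t)" by simp
  moreover have "(\<lambda>h. D (h *\<^sub>R w)) = (*) (D w)"
    using has_derivative_linear[OF assms] by (simp add: linear_cmul fun_eq_iff)
  ultimately show ?thesis by (simp add: has_field_derivative_def)
qed

text \<open>
  Applying the mean value theorem in the direction \<open>v\<close> and then in the direction \<open>w\<close> identifies the
  difference quotient with a value of the mixed second derivative at a point close to \<open>x\<close>. The
  quotient is symmetric in \<open>v\<close> and \<open>w\<close>, which forces the mixed derivatives to agree.
\<close>

lemma second_difference_quotient:
  fixes f :: "real^'n \<Rightarrow> real"
  assumes "open S" "x \<in> S" "Ck_on 2 S f" "e > 0"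
  defines "D \<equiv> \<lambda>y. frechet_derivative f (at y)"
  shows "\<exists>d>0. \<forall>t. 0 < t \<and> t < d \<longrightarrow>
    \<bar>(f (x + t *\<^sub>R v + t *\<^sub>R w) - f (x + t *\<^sub>R v) - f (x + t *\<^sub>R w) + f x) / t\<^sup>2
      - frechet_derivative (\<lambda>y. D y v) (at x) w\<bar> < e"
proof -
  define E where "E y = frechet_derivative (\<lambda>y. D y v) (at y) w" for y
  have C1: "Ck_on (Suc 0) S (\<lambda>y. D y v)" unfolding D_def
    using assms(1,3) by (intro Ck_on_derivative) (simp_all add: numeral_2_eq_2)
  have "Ck_on 0 S E" unfolding E_def using assms(1) C1 by (rule Ck_on_derivative)
  then have "isCont E x" using assms(1,2) by (simp add: continuous_on_eq_continuous_at)
  then obtain d1 where d1: "d1 > 0" "\<And>y. dist y x < d1 \<Longrightarrow> dist (E y) (E x) < e"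
    using \<open>e > 0\<close> unfolding continuous_at_eps_delta by blast
  obtain d2 where d2: "d2 > 0" "ball x d2 \<subseteq> S" using assms(1,2) open_contains_ball by blast
  \<comment> \<open>the summand 1 avoids division by zero when \<open>v = w = 0\<close>\<close>
  define d where "d = min d1 d2 / (norm v + norm w + 1)"
  have near: "dist (x + s *\<^sub>R v + u *\<^sub>R w) x < min d1 d2" if "0 \<le> s" "s < d" "0 \<le> u" "u < d" for s u
  proof -
    have "dist (x + s *\<^sub>R v + u *\<^sub>R w) x \<le> s * norm v + u * norm w"
      unfolding dist_norm using norm_triangle_ineq[of "s *\<^sub>R v" "u *\<^sub>R w"] that
      by (simp add: algebra_simps)
    also have "\<dots> \<le> d * norm v + d * norm w"
      using that by (intro add_mono mult_right_mono) auto
    also have "\<dots> < d * (norm v + norm w + 1)" using that by (simp add: algebra_simps)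
    also have "\<dots> = min d1 d2" unfolding d_def using add_nonneg_pos[of "norm v + norm w" 1] by simp
    finally show ?thesis .
  qed
  have "d > 0" using d1(1) d2(1) norm_ge_zero[of v] norm_ge_zero[of w] by (simp add: d_def add_nonneg_pos)
  have S: "x + s *\<^sub>R v + u *\<^sub>R w \<in> S" if "0 \<le> s" "s < d" "0 \<le> u" "u < d" for s u
    using near[OF that] d2(2) by (auto simp: dist_commute subset_iff)
  have df: "(f has_derivative D y) (at y)" if "y \<in> S" for y
    unfolding D_def using Ck_on_has_derivative[of 1 S f y] assms(3) that by (simp add: numeral_2_eq_2)
  have dD: "((\<lambda>y. D y v) has_derivative frechet_derivative (\<lambda>y. D y v) (at y)) (at y)" if "y \<in> S" for y
    using Ck_on_has_derivative[OF C1 that] .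
  have "\<bar>(f (x + t *\<^sub>R v + t *\<^sub>R w) - f (x + t *\<^sub>R v) - f (x + t *\<^sub>R w) + f x) / t\<^sup>2 - E x\<bar> < e"
    if t: "0 < t" "t < d" for t
  proof -
    define \<phi> where "\<phi> s = f (x + s *\<^sub>R v + t *\<^sub>R w) - f (x + s *\<^sub>R v)" for s
    have d\<phi>: "(\<phi> has_field_derivative D (x + s *\<^sub>R v + t *\<^sub>R w) v - D (x + s *\<^sub>R v) v) (at s)"
      if "0 \<le> s" "s \<le> t" for s
    proof -
      have 1: "x + s *\<^sub>R v + t *\<^sub>R w \<in> S" "x + s *\<^sub>R v \<in> S" using S[of s t] S[of s 0] that t by auto
      have 2: "x + s *\<^sub>R v + t *\<^sub>R w = (x + t *\<^sub>R w) + s *\<^sub>R v" for s by simp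
      have "((\<lambda>s. f (x + s *\<^sub>R v + t *\<^sub>R w)) has_field_derivative D (x + s *\<^sub>R v + t *\<^sub>R w) v) (at s)"
        using df[OF 1(1)] unfolding 2 by (rule field_derivative_along_line)
      moreover have "((\<lambda>s. f (x + s *\<^sub>R v)) has_field_derivative D (x + s *\<^sub>R v) v) (at s)"
        by (rule field_derivative_along_line[OF df[OF 1(2)]])
      ultimately show ?thesis unfolding \<phi>_def by (rule DERIV_diff)
    qed
    obtain s where s: "0 < s" "s < t" "\<phi> t - \<phi> 0 = (t - 0) * (D (x + s *\<^sub>R v + t *\<^sub>R w) v - D (x + s *\<^sub>R v) v)"
      using MVT2[OF t(1), of \<phi> "\<lambda>s. D (x + s *\<^sub>R v + t *\<^sub>R w) v - D (x + s *\<^sub>R v) v"] d\<phi> by blast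
    define \<psi> where "\<psi> u = D (x + s *\<^sub>R v + u *\<^sub>R w) v" for u
    have d\<psi>: "(\<psi> has_field_derivative E (x + s *\<^sub>R v + u *\<^sub>R w)) (at u)" if "0 \<le> u" "u \<le> t" for u
    proof -
      have 1: "x + s *\<^sub>R v + u *\<^sub>R w \<in> S" using S[of s u] that s t by auto
      show ?thesis unfolding \<psi>_def E_def by (rule field_derivative_along_line[OF dD[OF 1]])
    qed
    obtain u where u: "0 < u" "u < t" "\<psi> t - \<psi> 0 = (t - 0) * E (x + s *\<^sub>R v + u *\<^sub>R w)"
      using MVT2[OF t(1), of \<psi> "\<lambda>u. E (x + s *\<^sub>R v + u *\<^sub>R w)"] d\<psi> by blast
    have "f (x + t *\<^sub>R v + t *\<^sub>R w) - f (x + t *\<^sub>R v) - f (x + t *\<^sub>R w) + f x = \<phi> t - \<phi> 0"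
      by (simp add: \<phi>_def)
    also have "\<dots> = t * (\<psi> t - \<psi> 0)" using s(3) by (simp add: \<psi>_def)
    also have "\<dots> = t\<^sup>2 * E (x + s *\<^sub>R v + u *\<^sub>R w)" using u(3) by (simp add: power2_eq_square)
    finally have "(f (x + t *\<^sub>R v + t *\<^sub>R w) - f (x + t *\<^sub>R v) - f (x + t *\<^sub>R w) + f x) / t\<^sup>2
        = E (x + s *\<^sub>R v + u *\<^sub>R w)" using t(1) by simp
    then show ?thesis using d1(2)[of "x + s *\<^sub>R v + u *\<^sub>R w"] near[of s u] s u t by (simp add: dist_real_def)
  qed
  with \<open>d > 0\<close> show ?thesis unfolding E_def by blast
qed

lemma second_derivative_symmetric:
  fixes f :: "real^'n \<Rightarrow> real"
  assumes "open S" "x \<in> S" "Ck_on 2 S f"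
  shows "frechet_derivative (\<lambda>y. frechet_derivative f (at y) v) (at x) w =
    frechet_derivative (\<lambda>y. frechet_derivative f (at y) w) (at x) v" (is "?a = ?b")
proof (rule ccontr)
  assume "?a \<noteq> ?b"
  define e where "e = \<bar>?a - ?b\<bar> / 2"
  then have "e > 0" using \<open>?a \<noteq> ?b\<close> by simp
  obtain d1 where d1: "d1 > 0" "\<And>t. 0 < t \<and> t < d1 \<Longrightarrow>
    \<bar>(f (x + t *\<^sub>R v + t *\<^sub>R w) - f (x + t *\<^sub>R v) - f (x + t *\<^sub>R w) + f x) / t\<^sup>2 - ?a\<bar> < e"
    using second_difference_quotient[OF assms \<open>e > 0\<close>, of v w] by blast
  obtain d2 where d2: "d2 > 0" "\<And>t. 0 < t \<and> t < d2 \<Longrightarrow>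
    \<bar>(f (x + t *\<^sub>R w + t *\<^sub>R v) - f (x + t *\<^sub>R w) - f (x + t *\<^sub>R v) + f x) / t\<^sup>2 - ?b\<bar> < e"
    using second_difference_quotient[OF assms \<open>e > 0\<close>, of w v] by blast
  define t where "t = min d1 d2 / 2"
  have t: "0 < t \<and> t < d1" "0 < t \<and> t < d2" using d1(1) d2(1) by (auto simp: t_def)
  have "f (x + t *\<^sub>R v + t *\<^sub>R w) - f (x + t *\<^sub>R v) - f (x + t *\<^sub>R w) + f x =
        f (x + t *\<^sub>R w + t *\<^sub>R v) - f (x + t *\<^sub>R w) - f (x + t *\<^sub>R v) + f x"
    by (simp add: add.assoc add.commute[of "t *\<^sub>R v"])
  then have "\<bar>(f (x + t *\<^sub>R w + t *\<^sub>R v) - f (x + t *\<^sub>R w) - f (x + t *\<^sub>R v) + f x) / t\<^sup>2 - ?a\<bar> < e"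
    using d1(2)[OF t(1)] by (simp only:)
  moreover have "\<bar>q - a\<bar> < e \<Longrightarrow> \<bar>q - b\<bar> < e \<Longrightarrow> \<bar>a - b\<bar> < 2 * e" for q a b :: real by arith
  ultimately have "\<bar>?a - ?b\<bar> < 2 * e" using d2(2)[OF t(2)] by blast
  then show False by (simp add: e_def)
qed

section \<open>Calculus of smooth maps\<close>

lemma smooth_on_cong:
  assumes "open S" "\<And>x. x \<in> S \<Longrightarrow> f x = g x" "smooth_on S f"
  shows "smooth_on S g"
  unfolding smooth_on_def
proof
  show "Ck_on k S g" for k
    by (rule Ck_on_cong[OF assms(1), where f = f]) (use assms(2) smooth_onD[OF assms(3)] in auto)
qed

lemma smooth_on_subset: "smooth_on S f \<Longrightarrow> T \<subseteq> S \<Longrightarrow> smooth_on T f"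
  using Ck_on_subset unfolding smooth_on_def by blast

lemma smooth_on_local:
  assumes "\<And>x. x \<in> S \<Longrightarrow> \<exists>U. open U \<and> x \<in> U \<and> smooth_on U f"
  shows "smooth_on S f"
  unfolding smooth_on_def
proof (intro allI Ck_on_local)
  show "\<exists>U. open U \<and> x \<in> U \<and> Ck_on k U f" if "x \<in> S" for x k
    using assms[OF that] by (auto simp: smooth_on_def)
qed

lemma smooth_on_compose:
  fixes f :: "real^'n \<Rightarrow> real^'m"
  assumes "open S" "open T" "f ` S \<subseteq> T" "smooth_on S f" "smooth_on T g"
  shows "smooth_on S (\<lambda>x. g (f x))"
  using assms(4,5) Ck_on_compose[OF assms(1,2,3)] unfolding smooth_on_def by blast

lemma smooth_on_bounded_linear:
  assumes "bounded_linear L" "open S" "smooth_on S f"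
  shows "smooth_on S (\<lambda>x. L (f x))"
  using assms(3) Ck_on_bounded_linear[OF assms(1,2)] unfolding smooth_on_def by blast

lemma smooth_on_linear: "bounded_linear L \<Longrightarrow> open S \<Longrightarrow> smooth_on S L"
  by (simp add: smooth_on_def Ck_on_linear del: Ck_on.simps)

lemma smooth_on_const: "smooth_on S (\<lambda>_. x)"
  by (simp add: smooth_on_def Ck_on_const)

lemma smooth_on_add: "open S \<Longrightarrow> smooth_on S f \<Longrightarrow> smooth_on S g \<Longrightarrow> smooth_on S (\<lambda>x. f x + g x)"
  by (simp add: smooth_on_def Ck_on_add)

lemma smooth_on_mult:
  fixes f g :: "real^'n \<Rightarrow> real"
  shows "open S \<Longrightarrow> smooth_on S f \<Longrightarrow> smooth_on S g \<Longrightarrow> smooth_on S (\<lambda>x. f x * g x)"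
  by (simp add: smooth_on_def Ck_on_mult)

lemma smooth_on_sum: "open S \<Longrightarrow> (\<And>i. i \<in> I \<Longrightarrow> smooth_on S (f i)) \<Longrightarrow> smooth_on S (\<lambda>x. \<Sum>i\<in>I. f i x)"
  by (simp add: smooth_on_def Ck_on_sum)

lemma smooth_on_vec:
  assumes "open S" "\<And>j. smooth_on S (\<lambda>x. f x $ j)"
  shows "smooth_on S (f :: real^'n \<Rightarrow> real^'m)"
  using assms Ck_on_vec[OF assms(1)] unfolding smooth_on_def by blast

lemma smooth_on_derivative:
  assumes "open S" "smooth_on S f"
  shows "smooth_on S (\<lambda>x. frechet_derivative f (at x) v)"
  using Ck_on_derivative[OF assms(1) smooth_onD[OF assms(2)]] unfolding smooth_on_def by blast

section \<open>Charts\<close>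

lemma chart_on_simps:
  assumes "chart_on M \<kappa>"
  shows chart_on_openin: "openin M (chart_dom \<kappa>)"
    and chart_on_open_image: "open (chart_map \<kappa> ` chart_dom \<kappa>)"
    and chart_on_inj: "inj_on (chart_map \<kappa>) (chart_dom \<kappa>)"
proof -
  show o: "openin M (chart_dom \<kappa>)" "open (chart_map \<kappa> ` chart_dom \<kappa>)"
    using assms by (auto simp: chart_on_def)
  have "topspace (subtopology M (chart_dom \<kappa>)) = chart_dom \<kappa>"
    using openin_subset[OF o(1)] by auto
  then show "inj_on (chart_map \<kappa>) (chart_dom \<kappa>)"
    using assms homeomorphic_imp_injective_map unfolding chart_on_def by metis
qed

lemma chart_inv_map: "inj_on (chart_map \<kappa>) (chart_dom \<kappa>) \<Longrightarrow> p \<in> chart_dom \<kappa> \<Longrightarrow> chart_inv \<kappa> (chart_map \<kappa> p) = p"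
  by (simp add: chart_inv_def)

lemma chart_map_inv: "x \<in> chart_map \<kappa> ` chart_dom \<kappa> \<Longrightarrow> chart_map \<kappa> (chart_inv \<kappa> x) = x"
  by (simp add: chart_inv_def f_inv_into_f)

lemma chart_inv_in: "x \<in> chart_map \<kappa> ` chart_dom \<kappa> \<Longrightarrow> chart_inv \<kappa> x \<in> chart_dom \<kappa>"
  by (simp add: chart_inv_def inv_into_into)

lemma chart_image_open:
  assumes "chart_on M \<kappa>" "openin M U"
  shows "open (chart_map \<kappa> ` (chart_dom \<kappa> \<inter> U))"
proof -
  have "homeomorphic_map (subtopology M (chart_dom \<kappa>)) (top_of_set (chart_map \<kappa> ` chart_dom \<kappa>)) (chart_map \<kappa>)"
    using assms(1) by (simp add: chart_on_def)
  moreover have "openin (subtopology M (chart_dom \<kappa>)) (chart_dom \<kappa> \<inter> U)"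
    using assms(2) by (simp add: openin_subtopology_Int2)
  ultimately have "openin (top_of_set (chart_map \<kappa> ` chart_dom \<kappa>)) (chart_map \<kappa> ` (chart_dom \<kappa> \<inter> U))"
    using homeomorphic_imp_open_map open_map_def by blast
  then show ?thesis using chart_on_open_image[OF assms(1)] openin_open_eq by blast
qed

lemma chart_vimage_open:
  assumes "chart_on M \<kappa>" "open W"
  shows "openin M {q \<in> chart_dom \<kappa>. chart_map \<kappa> q \<in> W}"
proof -
  have o: "openin M (chart_dom \<kappa>)" using chart_on_openin[OF assms(1)] .
  then have t: "topspace (subtopology M (chart_dom \<kappa>)) = chart_dom \<kappa>" using openin_subset by fastforce
  have "homeomorphic_map (subtopology M (chart_dom \<kappa>)) (top_of_set (chart_map \<kappa> ` chart_dom \<kappa>)) (chart_map \<kappa>)"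
    using assms(1) by (simp add: chart_on_def)
  then have "continuous_map (subtopology M (chart_dom \<kappa>)) euclidean (chart_map \<kappa>)"
    using homeomorphic_imp_continuous_map continuous_map_into_fulltopology by blast
  from openin_continuous_map_preimage[OF this, of W] assms(2)
  have "openin (subtopology M (chart_dom \<kappa>)) {q \<in> chart_dom \<kappa>. chart_map \<kappa> q \<in> W}"
    by (simp only: t open_openin)
  then show ?thesis using o openin_trans_full by blast
qed

lemma chart_onI:
  assumes U: "openin M U" and inj: "inj_on f U"
    and op: "\<And>V. openin M V \<Longrightarrow> V \<subseteq> U \<Longrightarrow> open (f ` V)"
    and cont: "\<And>W. open W \<Longrightarrow> openin M {q \<in> U. f q \<in> W}"
  shows "chart_on M (U, f)"
proof -
  have t: "topspace (subtopology M U) = U" using openin_subset[OF U] by auto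
  have oU: "open (f ` U)" using op[OF U] by simp
  have "homeomorphic_map (subtopology M U) (top_of_set (f ` U)) f"
  proof (rule bijective_open_imp_homeomorphic_map)
    show "continuous_map (subtopology M U) (top_of_set (f ` U)) f"
      unfolding continuous_map_in_subtopology
    proof
      have "openin (subtopology M U) {q \<in> U. f q \<in> W}" if "open W" for W
        using cont[OF that] by (metis (no_types, lifting) openin_subset_topspace_eq mem_Collect_eq subsetI openin_open_subtopology U)
      then show "continuous_map (subtopology M U) euclidean f"
        unfolding continuous_map_def t by (simp flip: open_openin)
    qed (use t in auto)
    show "open_map (subtopology M U) (top_of_set (f ` U)) f"
      unfolding open_map_def
    proof (intro allI impI)
      fix V assume "openin (subtopology M U) V"
      then have "openin M V" "V \<subseteq> U" using U openin_open_subtopology by blast+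
      then show "openin (top_of_set (f ` U)) (f ` V)"
        using op oU by (metis image_mono openin_open_eq)
    qed
  qed (use t inj in auto)
  then show ?thesis using U oU by (simp add: chart_on_def)
qed

lemma transition_continuous:
  assumes "chart_on M \<kappa>" "chart_on M \<kappa>'"
  shows "continuous_on (chart_map \<kappa> ` (chart_dom \<kappa> \<inter> chart_dom \<kappa>')) (chart_map \<kappa>' \<circ> chart_inv \<kappa>)"
proof -
  let ?S = "chart_map \<kappa> ` (chart_dom \<kappa> \<inter> chart_dom \<kappa>')"
  have oS: "open ?S" by (rule chart_image_open[OF assms(1) chart_on_openin[OF assms(2)]])
  note inv = chart_inv_map[OF chart_on_inj[OF assms(1)]]
  show ?thesis
    unfolding continuous_on_open_vimage[OF oS]
  proof (intro allI impI)
    fix W :: "(real^'c) set" assume "open W"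
    have "(chart_map \<kappa>' \<circ> chart_inv \<kappa>) -` W \<inter> ?S =
        chart_map \<kappa> ` (chart_dom \<kappa> \<inter> {q \<in> chart_dom \<kappa>'. chart_map \<kappa>' q \<in> W})"
      using inv by fastforce
    then show "open ((chart_map \<kappa>' \<circ> chart_inv \<kappa>) -` W \<inter> ?S)"
      using chart_image_open[OF assms(1) chart_vimage_open[OF assms(2) \<open>open W\<close>]] by simp
  qed
qed

text \<open>
  A transition from \<open>\<psi>\<close> to \<open>\<kappa>\<close>, where the coordinate spaces may have different dimensions. It is
  a change of charts of one manifold or the local form of the inclusion of a submanifold, so that
  the chain rules below serve both.
\<close>

definition smooth_transition :: "('a, 'm::finite) chart \<Rightarrow> ('a, 'n::finite) chart \<Rightarrow> bool" where
  "smooth_transition \<psi> \<kappa> \<longleftrightarrow> open (chart_map \<psi> ` (chart_dom \<psi> \<inter> chart_dom \<kappa>)) \<and>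
     inj_on (chart_map \<psi>) (chart_dom \<psi>) \<and> inj_on (chart_map \<kappa>) (chart_dom \<kappa>) \<and>
     open (chart_map \<kappa> ` chart_dom \<kappa>) \<and>
     smooth_on (chart_map \<psi> ` (chart_dom \<psi> \<inter> chart_dom \<kappa>)) (chart_map \<kappa> \<circ> chart_inv \<psi>)"

lemma smooth_transitionD:
  assumes "smooth_transition \<psi> \<kappa>"
  shows "open (chart_map \<psi> ` (chart_dom \<psi> \<inter> chart_dom \<kappa>))"
    "inj_on (chart_map \<psi>) (chart_dom \<psi>)" "inj_on (chart_map \<kappa>) (chart_dom \<kappa>)"
    "open (chart_map \<kappa> ` chart_dom \<kappa>)"
    "smooth_on (chart_map \<psi> ` (chart_dom \<psi> \<inter> chart_dom \<kappa>)) (chart_map \<kappa> \<circ> chart_inv \<psi>)"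
  using assms by (simp_all add: smooth_transition_def)

text \<open>
  The differential of \<open>f\<close> at \<open>p\<close> in the coordinates of \<open>\<kappa>\<close>. Applied to \<open>f = chart_map \<kappa>'\<close> it is the
  Jacobian of a transition.
\<close>

definition chart_deriv :: "('a, 'm::finite) chart \<Rightarrow> ('a \<Rightarrow> 'b::real_normed_vector) \<Rightarrow> 'a \<Rightarrow> real^'m \<Rightarrow> 'b" where
  "chart_deriv \<kappa> f p = frechet_derivative (f \<circ> chart_inv \<kappa>) (at (chart_map \<kappa> p))"

lemma pd_chart_deriv: "pd \<kappa> i f p = chart_deriv \<kappa> f p (axis i 1)"
  by (simp add: pd_def chart_deriv_def)

lemma chart_smooth_has_derivative:
  "chart_smooth \<kappa> f \<Longrightarrow> p \<in> chart_dom \<kappa> \<Longrightarrow>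
    (f \<circ> chart_inv \<kappa> has_derivative chart_deriv \<kappa> f p) (at (chart_map \<kappa> p))"
  unfolding chart_smooth_def chart_deriv_def by (rule smooth_on_has_derivative) auto

lemma transition_has_derivative:
  assumes "smooth_transition \<psi> \<kappa>" "p \<in> chart_dom \<psi>" "p \<in> chart_dom \<kappa>"
  shows "(chart_map \<kappa> \<circ> chart_inv \<psi> has_derivative chart_deriv \<psi> (chart_map \<kappa>) p) (at (chart_map \<psi> p))"
  unfolding chart_deriv_def
  by (intro smooth_on_has_derivative[OF smooth_transitionD(5)[OF assms(1)]]) (use assms in auto)

lemma transition_linear:
  assumes "smooth_transition \<psi> \<kappa>" "p \<in> chart_dom \<psi>" "p \<in> chart_dom \<kappa>"
  shows "linear (chart_deriv \<psi> (chart_map \<kappa>) p)"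
  using transition_has_derivative[OF assms] has_derivative_linear by blast

lemma transition_factor:
  assumes "smooth_transition \<psi> \<kappa>" "x \<in> chart_map \<psi> ` (chart_dom \<psi> \<inter> chart_dom \<kappa>)"
  shows "(f \<circ> chart_inv \<kappa>) ((chart_map \<kappa> \<circ> chart_inv \<psi>) x) = (f \<circ> chart_inv \<psi>) x"
proof -
  obtain p where "p \<in> chart_dom \<psi>" "p \<in> chart_dom \<kappa>" "x = chart_map \<psi> p" using assms(2) by blast
  then show ?thesis
    using chart_inv_map[OF smooth_transitionD(2)[OF assms(1)]] chart_inv_map[OF smooth_transitionD(3)[OF assms(1)]]
    by simp
qed

lemma chart_deriv_chain_has_derivative:
  assumes "smooth_transition \<psi> \<kappa>" "p \<in> chart_dom \<psi>" "p \<in> chart_dom \<kappa>"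
    and f: "(f \<circ> chart_inv \<kappa> has_derivative f') (at (chart_map \<kappa> p))"
  shows "(f \<circ> chart_inv \<psi> has_derivative (\<lambda>v. f' (chart_deriv \<psi> (chart_map \<kappa>) p v))) (at (chart_map \<psi> p))"
proof -
  let ?S = "chart_map \<psi> ` (chart_dom \<psi> \<inter> chart_dom \<kappa>)"
  have S: "open ?S" "chart_map \<psi> p \<in> ?S" using smooth_transitionD(1)[OF assms(1)] assms(2,3) by auto
  have "(chart_map \<kappa> \<circ> chart_inv \<psi>) (chart_map \<psi> p) = chart_map \<kappa> p"
    using chart_inv_map[OF smooth_transitionD(2)[OF assms(1)] assms(2)] by simp
  then have "((\<lambda>x. (f \<circ> chart_inv \<kappa>) ((chart_map \<kappa> \<circ> chart_inv \<psi>) x)) has_derivative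
      (\<lambda>v. f' (chart_deriv \<psi> (chart_map \<kappa>) p v))) (at (chart_map \<psi> p))"
    using has_derivative_compose[OF transition_has_derivative[OF assms(1-3)], of "f \<circ> chart_inv \<kappa>" f'] f
    by (simp only:)
  then show ?thesis
    by (rule has_derivative_transform_within_open[OF _ S]) (rule transition_factor[OF assms(1)])
qed

lemma chart_deriv_chain:
  assumes "smooth_transition \<psi> \<kappa>" "p \<in> chart_dom \<psi>" "p \<in> chart_dom \<kappa>"
    and f: "(f \<circ> chart_inv \<kappa> has_derivative f') (at (chart_map \<kappa> p))"
  shows "chart_deriv \<psi> f p v = f' (chart_deriv \<psi> (chart_map \<kappa>) p v)"
  using fun_cong[OF frechet_derivative_at[OF chart_deriv_chain_has_derivative[OF assms]], of v]
  by (simp add: chart_deriv_def)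

lemma transition_smooth_on_Int:
  assumes tr: "smooth_transition \<psi> \<kappa>"
    and o: "open (chart_map \<psi> ` (chart_dom \<psi> \<inter> chart_dom \<kappa> \<inter> W))" "open (chart_map \<kappa> ` (chart_dom \<kappa> \<inter> W))"
    and f: "smooth_on (chart_map \<kappa> ` (chart_dom \<kappa> \<inter> W)) (f \<circ> chart_inv \<kappa>)"
  shows "smooth_on (chart_map \<psi> ` (chart_dom \<psi> \<inter> chart_dom \<kappa> \<inter> W)) (f \<circ> chart_inv \<psi>)"
proof (rule smooth_on_cong[OF o(1)])
  let ?S = "chart_map \<psi> ` (chart_dom \<psi> \<inter> chart_dom \<kappa> \<inter> W)"
  show "smooth_on ?S (\<lambda>x. (f \<circ> chart_inv \<kappa>) ((chart_map \<kappa> \<circ> chart_inv \<psi>) x))"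
  proof (rule smooth_on_compose[OF o _ _ f])
    show "(chart_map \<kappa> \<circ> chart_inv \<psi>) ` ?S \<subseteq> chart_map \<kappa> ` (chart_dom \<kappa> \<inter> W)"
      using chart_inv_map[OF smooth_transitionD(2)[OF tr]] by auto
    show "smooth_on ?S (chart_map \<kappa> \<circ> chart_inv \<psi>)"
      by (rule smooth_on_subset[OF smooth_transitionD(5)[OF tr]]) auto
  qed
qed (rule transition_factor[OF tr], blast)

lemma transition_smooth_on:
  assumes "smooth_transition \<psi> \<kappa>" "chart_smooth \<kappa> f"
  shows "smooth_on (chart_map \<psi> ` (chart_dom \<psi> \<inter> chart_dom \<kappa>)) (f \<circ> chart_inv \<psi>)"
  using transition_smooth_on_Int[OF assms(1), of UNIV f] smooth_transitionD(1,4)[OF assms(1)] assms(2)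
  by (simp add: chart_smooth_def)

lemma chart_smooth_from_cover:
  assumes tr: "\<And>\<kappa>. \<kappa> \<in> A \<Longrightarrow> smooth_transition \<psi> \<kappa>" and f: "\<And>\<kappa>. \<kappa> \<in> A \<Longrightarrow> chart_smooth \<kappa> f"
    and cover: "chart_dom \<psi> \<subseteq> (\<Union>\<kappa>\<in>A. chart_dom \<kappa>)"
  shows "chart_smooth \<psi> f"
  unfolding chart_smooth_def
proof (rule smooth_on_local)
  fix x assume "x \<in> chart_map \<psi> ` chart_dom \<psi>"
  then obtain \<kappa> where \<kappa>: "\<kappa> \<in> A" "x \<in> chart_map \<psi> ` (chart_dom \<psi> \<inter> chart_dom \<kappa>)" using cover by fast
  then show "\<exists>U. open U \<and> x \<in> U \<and> smooth_on U (f \<circ> chart_inv \<psi>)"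
    using transition_smooth_on[OF tr f, OF \<kappa>(1) \<kappa>(1)] smooth_transitionD(1)[OF tr[OF \<kappa>(1)]] by blast
qed

section \<open>Slice charts and regular level sets\<close>

lemma smooth_manifold_chart_on: "smooth_manifold M A \<Longrightarrow> \<kappa> \<in> A \<Longrightarrow> chart_on M \<kappa>"
  unfolding smooth_manifold_def by blast

lemma smooth_manifold_cover: "smooth_manifold M A \<Longrightarrow> (\<Union>\<kappa>\<in>A. chart_dom \<kappa>) = topspace M"
  unfolding smooth_manifold_def by blast

lemma smooth_manifold_maximal:
  "smooth_manifold M A \<Longrightarrow> chart_on M \<kappa> \<Longrightarrow> (\<And>\<kappa>'. \<kappa>' \<in> A \<Longrightarrow> compatible \<kappa> \<kappa>') \<Longrightarrow> \<kappa> \<in> A"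
  unfolding smooth_manifold_def by blast

lemma smooth_transition_if_smooth:
  assumes "chart_on M \<kappa>" "chart_on M \<kappa>'"
    "smooth_on (chart_map \<kappa> ` (chart_dom \<kappa> \<inter> chart_dom \<kappa>')) (chart_map \<kappa>' \<circ> chart_inv \<kappa>)"
  shows "smooth_transition \<kappa> \<kappa>'"
  using assms(3) chart_on_simps[OF assms(1)] chart_on_simps[OF assms(2)]
    chart_image_open[OF assms(1) chart_on_openin[OF assms(2)]]
  by (simp add: smooth_transition_def)

lemma smooth_manifold_transition:
  assumes "smooth_manifold M A" "\<kappa> \<in> A" "\<kappa>' \<in> A"
  shows "smooth_transition \<kappa> \<kappa>'"
proof -
  have "compatible \<kappa> \<kappa>'" using assms unfolding smooth_manifold_def by blast
  then show ?thesis
    using smooth_transition_if_smooth[of M \<kappa> \<kappa>'] smooth_manifold_chart_on[OF assms(1)] assms(2,3)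
    by (simp add: compatible_def)
qed

lemma chart_deriv_self:
  assumes "chart_on M \<kappa>" "p \<in> chart_dom \<kappa>"
  shows "chart_deriv \<kappa> (chart_map \<kappa>) p v = v"
proof -
  have "chart_deriv \<kappa> (chart_map \<kappa>) p = frechet_derivative (\<lambda>x. x) (at (chart_map \<kappa> p))"
    unfolding chart_deriv_def
  proof (rule frechet_derivative_cong_open[OF chart_on_open_image[OF assms(1)]])
    show "(chart_map \<kappa> \<circ> chart_inv \<kappa>) y = y" if "y \<in> chart_map \<kappa> ` chart_dom \<kappa>" for y
      using chart_map_inv[OF that] by simp
  qed (use assms(2) in blast)
  then show ?thesis by simp
qed

lemma transition_derivative_inverse:
  assumes "smooth_transition \<kappa> \<kappa>'" "smooth_transition \<kappa>' \<kappa>" "chart_on M \<kappa>'"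
    "p \<in> chart_dom \<kappa>" "p \<in> chart_dom \<kappa>'"
  shows "chart_deriv \<kappa> (chart_map \<kappa>') p (chart_deriv \<kappa>' (chart_map \<kappa>) p v) = v"
proof -
  have "chart_deriv \<kappa>' (chart_map \<kappa>') p v = chart_deriv \<kappa> (chart_map \<kappa>') p (chart_deriv \<kappa>' (chart_map \<kappa>) p v)"
    by (rule chart_deriv_chain[OF assms(2,5,4) transition_has_derivative[OF assms(1,4,5)]])
  then show ?thesis using chart_deriv_self[OF assms(3,5)] by simp
qed

text \<open>
  Composing a chart with a local diffeomorphism keeps all transitions smooth, so maximality of the
  atlas puts the result into the atlas.
\<close>

lemma reparametrized_chart:
  fixes A :: "('a, 'n::finite) chart set"
  assumes M: "smooth_manifold M A" and \<kappa>: "\<kappa> \<in> A"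
    and U: "open U" "U \<subseteq> chart_map \<kappa> ` chart_dom \<kappa>" and V: "open V"
    and F: "homeomorphism U V F G" "smooth_on U F" "smooth_on V G"
  shows "({q \<in> chart_dom \<kappa>. chart_map \<kappa> q \<in> U}, F \<circ> chart_map \<kappa>) \<in> A" (is "(?D, ?f) \<in> A")
proof -
  note on = smooth_manifold_chart_on[OF M \<kappa>]
  note inj = chart_on_inj[OF on]
  have FG: "\<And>x. x \<in> U \<Longrightarrow> G (F x) = x" "\<And>y. y \<in> V \<Longrightarrow> F (G y) = y" "F ` U = V" "G ` V = U"
    "continuous_on U F" "continuous_on V G"
    using F(1) by (auto simp: homeomorphism_def)
  have injF: "inj_on F U" using FG(1) by (metis inj_onI)
  have oD: "openin M ?D" by (rule chart_vimage_open[OF on U(1)])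
  have injf: "inj_on ?f ?D"
  proof (rule comp_inj_on)
    show "inj_on (chart_map \<kappa>) ?D" using inj by (rule inj_on_subset) auto
    show "inj_on F (chart_map \<kappa> ` ?D)" using injF by (rule inj_on_subset) auto
  qed
  have openF: "open (F ` W)" if "open W" "W \<subseteq> U" for W
  proof -
    have "F ` W = G -` W \<inter> V" using FG that by force
    then show ?thesis using FG(6) that(1) V continuous_on_open_vimage by metis
  qed
  have on': "chart_on M (?D, ?f)"
  proof (rule chart_onI[OF oD injf])
    fix W assume "openin M W" "W \<subseteq> ?D"
    then have "open (chart_map \<kappa> ` (chart_dom \<kappa> \<inter> W))" using chart_image_open on by blast
    moreover have "chart_dom \<kappa> \<inter> W = W" "chart_map \<kappa> ` W \<subseteq> U" using \<open>W \<subseteq> ?D\<close> by auto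
    ultimately have "open (F ` (chart_map \<kappa> ` W))" using openF by simp
    then show "open (?f ` W)" by (simp add: image_comp)
  next
    fix W :: "(real^'n) set" assume "open W"
    then have "open (F -` W \<inter> U)" using FG(5) U(1) continuous_on_open_vimage by blast
    moreover have "{q \<in> ?D. ?f q \<in> W} = {q \<in> chart_dom \<kappa>. chart_map \<kappa> q \<in> F -` W \<inter> U}" by auto
    ultimately show "openin M {q \<in> ?D. ?f q \<in> W}" using chart_vimage_open[OF on] by (simp only:)
  qed
  let ?\<kappa>' = "(?D, ?f)"
  have inv': "chart_inv ?\<kappa>' (F (chart_map \<kappa> q)) = q" if "q \<in> ?D" for q
    using chart_inv_map[of ?\<kappa>' q] injf that by simp
  show ?thesis
  proof (rule smooth_manifold_maximal[OF M on'])
    fix \<kappa>2 assume \<kappa>2: "\<kappa>2 \<in> A"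
    note on2 = smooth_manifold_chart_on[OF M \<kappa>2]
    note t1 = smooth_manifold_transition[OF M \<kappa> \<kappa>2]
    note t2 = smooth_manifold_transition[OF M \<kappa>2 \<kappa>]
    have o1: "open (?f ` (?D \<inter> chart_dom \<kappa>2))" using chart_image_open[OF on' chart_on_openin[OF on2]] by simp
    have o2: "open (chart_map \<kappa>2 ` (?D \<inter> chart_dom \<kappa>2))"
      using chart_image_open[OF on2 oD] by (simp add: Int_commute)
    have s1: "smooth_on (?f ` (?D \<inter> chart_dom \<kappa>2)) (chart_map \<kappa>2 \<circ> chart_inv ?\<kappa>')"
    proof (rule smooth_on_cong[OF o1])
      show "smooth_on (?f ` (?D \<inter> chart_dom \<kappa>2)) (\<lambda>x. (chart_map \<kappa>2 \<circ> chart_inv \<kappa>) (G x))"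
      proof (rule smooth_on_compose[OF o1 smooth_transitionD(1)[OF t1] _ _ smooth_transitionD(5)[OF t1]])
        show "smooth_on (?f ` (?D \<inter> chart_dom \<kappa>2)) G"
          by (rule smooth_on_subset[OF F(3)]) (use FG(3) in auto)
        show "G ` ?f ` (?D \<inter> chart_dom \<kappa>2) \<subseteq> chart_map \<kappa> ` (chart_dom \<kappa> \<inter> chart_dom \<kappa>2)"
          using FG(1) by auto
      qed
    next
      fix x assume "x \<in> ?f ` (?D \<inter> chart_dom \<kappa>2)"
      then obtain q where q: "q \<in> ?D" "x = F (chart_map \<kappa> q)" by auto
      then show "(chart_map \<kappa>2 \<circ> chart_inv \<kappa>) (G x) = (chart_map \<kappa>2 \<circ> chart_inv ?\<kappa>') x"
        using FG(1) inv'[OF q(1)] chart_inv_map[OF inj] by simp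
    qed
    have s2: "smooth_on (chart_map \<kappa>2 ` (?D \<inter> chart_dom \<kappa>2)) (?f \<circ> chart_inv \<kappa>2)"
    proof (rule smooth_on_cong[OF o2])
      show "smooth_on (chart_map \<kappa>2 ` (?D \<inter> chart_dom \<kappa>2)) (\<lambda>x. F ((chart_map \<kappa> \<circ> chart_inv \<kappa>2) x))"
      proof (rule smooth_on_compose[OF o2 U(1) _ _ F(2)])
        show "smooth_on (chart_map \<kappa>2 ` (?D \<inter> chart_dom \<kappa>2)) (chart_map \<kappa> \<circ> chart_inv \<kappa>2)"
          by (rule smooth_on_subset[OF smooth_transitionD(5)[OF t2]]) auto
        show "(chart_map \<kappa> \<circ> chart_inv \<kappa>2) ` chart_map \<kappa>2 ` (?D \<inter> chart_dom \<kappa>2) \<subseteq> U"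
          using chart_inv_map[OF chart_on_inj[OF on2]] by auto
      qed
    qed simp
    show "compatible ?\<kappa>' \<kappa>2" unfolding compatible_def using s1 s2 by simp
  qed
qed

lemma has_derivative_vecI:
  fixes f :: "'x::real_normed_vector \<Rightarrow> real^'n"
  assumes "\<And>i. ((\<lambda>x. f x $ i) has_derivative (\<lambda>v. f' v $ i)) (at x)"
  shows "(f has_derivative f') (at x)"
proof -
  have "((\<lambda>x. f x \<bullet> b) has_derivative (\<lambda>v. f' v \<bullet> b)) (at x)" if "b \<in> Basis" for b
    using that assms by (auto simp: Basis_vec_def simp flip: cart_eq_inner_axis)
  then show ?thesis using has_derivative_componentwise_within[of f f' x UNIV] by simp
qed

text \<open>
  Replacing the coordinate \<open>x\<^sub>k\<close> by \<open>f\<close> is a local diffeomorphism of the coordinate space, as its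
  Jacobian is invertible exactly when \<open>\<partial>\<^sub>k f \<noteq> 0\<close>.
\<close>

lemma slice_chart:
  fixes A :: "('a, 'n::finite) chart set" and f :: "'a \<Rightarrow> real"
  assumes M: "smooth_manifold M A" and \<kappa>: "\<kappa> \<in> A" "p \<in> chart_dom \<kappa>"
    and f: "chart_smooth \<kappa> f" and k: "pd \<kappa> k f p \<noteq> 0"
  shows "\<exists>\<kappa>'\<in>A. p \<in> chart_dom \<kappa>' \<and> (\<forall>q\<in>chart_dom \<kappa>'. chart_map \<kappa>' q $ k = f q)"
proof -
  note on = smooth_manifold_chart_on[OF M \<kappa>(1)]
  let ?W = "chart_map \<kappa> ` chart_dom \<kappa>" and ?h = "f \<circ> chart_inv \<kappa>"
  define F where "F x = (\<chi> i. if i = k then ?h x else x $ i)" for x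
  have W: "open ?W" "chart_map \<kappa> p \<in> ?W" using chart_on_open_image[OF on] \<kappa>(2) by auto
  have F: "smooth_on ?W F"
  proof (rule smooth_on_vec[OF W(1)])
    show "smooth_on ?W (\<lambda>x. F x $ j)" for j
      using f smooth_on_linear[OF bounded_linear_vec_nth W(1), of j]
      by (cases "j = k") (simp_all add: F_def chart_smooth_def o_def)
  qed
  have dF: "(F has_derivative (\<lambda>v. \<chi> i. if i = k then chart_deriv \<kappa> f p v else v $ i)) (at (chart_map \<kappa> p))"
  proof (rule has_derivative_vecI)
    fix i
    show "((\<lambda>x. F x $ i) has_derivative (\<lambda>v. (\<chi> i. if i = k then chart_deriv \<kappa> f p v else v $ i) $ i)) (at (chart_map \<kappa> p))"
      using chart_smooth_has_derivative[OF f \<kappa>(2)] bounded_linear_imp_has_derivative[OF bounded_linear_vec_nth]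
      by (cases "i = k") (auto simp: F_def o_def)
  qed
  have lin: "linear (chart_deriv \<kappa> f p)"
    using chart_smooth_has_derivative[OF f \<kappa>(2)] has_derivative_linear by blast
  have "inj (\<lambda>v. \<chi> i. if i = k then chart_deriv \<kappa> f p v else v $ i)"
  proof (subst linear_injective_0[OF has_derivative_linear[OF dF]], intro allI impI)
    fix v assume v: "(\<chi> i. if i = k then chart_deriv \<kappa> f p v else v $ i) = 0"
    have vi: "v $ i = 0" if "i \<noteq> k" for i using arg_cong[OF v, of "\<lambda>w. w $ i"] that by simp
    have "v = v $ k *\<^sub>R axis k 1" using vi by (auto simp: vec_eq_iff axis_def)
    then have "chart_deriv \<kappa> f p v = chart_deriv \<kappa> f p (v $ k *\<^sub>R axis k 1)" by (rule arg_cong)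
    then have "chart_deriv \<kappa> f p v = v $ k * pd \<kappa> k f p"
      by (simp add: linear_cmul[OF lin] pd_chart_deriv)
    moreover have "chart_deriv \<kappa> f p v = 0" using arg_cong[OF v, of "\<lambda>w. w $ k"] by simp
    ultimately have "v $ k = 0" using k by simp
    then have "v $ i = 0" for i using vi by (cases "i = k") auto
    then show "v = 0" by (simp add: vec_eq_iff)
  qed
  then have "inj (frechet_derivative F (at (chart_map \<kappa> p)))" using frechet_derivative_at[OF dF] by simp
  then obtain U V G where U: "open U" "U \<subseteq> ?W" "chart_map \<kappa> p \<in> U" "open V" "homeomorphism U V F G" "smooth_on V G"
    using smooth_on_local_inverse[OF W(1) F W(2)] by metis
  have "({q \<in> chart_dom \<kappa>. chart_map \<kappa> q \<in> U}, F \<circ> chart_map \<kappa>) \<in> A"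
    using reparametrized_chart[OF M \<kappa>(1) U(1,2,4,5) smooth_on_subset[OF F U(2)] U(6)] .
  moreover have "F (chart_map \<kappa> q) $ k = f q" if "q \<in> chart_dom \<kappa>" for q
    using chart_inv_map[OF chart_on_inj[OF on] that] by (simp add: F_def)
  ultimately show ?thesis using \<kappa>(2) U(3)
    by (intro bexI[of _ "({q \<in> chart_dom \<kappa>. chart_map \<kappa> q \<in> U}, F \<circ> chart_map \<kappa>)"]) auto
qed

lemma regular_level_hypersurface:
  fixes A :: "('a, 'n::finite) chart set" and f :: "'a \<Rightarrow> real"
  assumes M: "smooth_manifold M A" and f: "smooth_fun A f"
    and reg: "\<And>p \<kappa>. p \<in> topspace M \<Longrightarrow> f p = 0 \<Longrightarrow> \<kappa> \<in> A \<Longrightarrow> p \<in> chart_dom \<kappa> \<Longrightarrow> \<exists>k. pd \<kappa> k f p \<noteq> 0"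
  shows "hypersurface M A {p \<in> topspace M. f p = 0}"
  unfolding hypersurface_def
proof (intro conjI ballI)
  fix p assume p: "p \<in> {p \<in> topspace M. f p = 0}"
  then obtain \<kappa> where \<kappa>: "\<kappa> \<in> A" "p \<in> chart_dom \<kappa>" using smooth_manifold_cover[OF M] by blast
  then obtain k where k: "pd \<kappa> k f p \<noteq> 0" using reg p by blast
  have "chart_smooth \<kappa> f" using f \<kappa>(1) by (simp add: smooth_fun_def)
  then obtain \<kappa>' where \<kappa>': "\<kappa>' \<in> A" "p \<in> chart_dom \<kappa>'" "\<And>q. q \<in> chart_dom \<kappa>' \<Longrightarrow> chart_map \<kappa>' q $ k = f q"
    using slice_chart[OF M \<kappa> _ k] by blast
  have "chart_dom \<kappa>' \<subseteq> topspace M" using smooth_manifold_cover[OF M] \<kappa>'(1) by blast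
  then have "{p \<in> topspace M. f p = 0} \<inter> chart_dom \<kappa>' = {q \<in> chart_dom \<kappa>'. chart_map \<kappa>' q $ k = 0}"
    using \<kappa>'(3) by auto
  then show "\<exists>\<kappa>\<in>A. \<exists>k. p \<in> chart_dom \<kappa> \<and>
      {p \<in> topspace M. f p = 0} \<inter> chart_dom \<kappa> = {q \<in> chart_dom \<kappa>. chart_map \<kappa> q $ k = 0}"
    using \<kappa>'(1,2) by blast
qed auto

section \<open>The smooth structure of a hypersurface\<close>

lemma submanifold_chart_on: "\<psi> \<in> submanifold_atlas M A S \<Longrightarrow> chart_on (subtopology M S) \<psi>"
  by (simp add: submanifold_atlas_def)

lemma submanifold_chart_dom:
  assumes "\<psi> \<in> submanifold_atlas M A S"
  shows "chart_dom \<psi> \<subseteq> S" "chart_dom \<psi> \<subseteq> topspace M"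
  using openin_subset[OF chart_on_openin[OF submanifold_chart_on[OF assms]]] by auto

lemma chart_image_open_ambient:
  assumes "chart_on (subtopology M S) \<psi>" "openin M U"
  shows "open (chart_map \<psi> ` (chart_dom \<psi> \<inter> U))"
proof -
  have "chart_dom \<psi> \<subseteq> S" using openin_subset[OF chart_on_openin[OF assms(1)]] by auto
  then have "chart_dom \<psi> \<inter> U = chart_dom \<psi> \<inter> (S \<inter> U)" by auto
  then show ?thesis
    using chart_image_open[OF assms(1) openin_subtopology_Int2[OF assms(2)]] by simp
qed

lemma submanifold_transition:
  assumes "smooth_manifold M A" "\<psi> \<in> submanifold_atlas M A S" "\<kappa> \<in> A"
  shows "smooth_transition \<psi> \<kappa>"
proof -
  note on = smooth_manifold_chart_on[OF assms(1,3)] and on' = submanifold_chart_on[OF assms(2)]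
  show ?thesis
    unfolding smooth_transition_def
    using chart_image_open_ambient[OF on' chart_on_openin[OF on]] chart_on_simps[OF on] chart_on_simps[OF on'] assms(2,3)
    by (simp add: submanifold_atlas_def)
qed

lemma submanifold_immersion:
  assumes "\<psi> \<in> submanifold_atlas M A S" "\<kappa> \<in> A" "p \<in> chart_dom \<psi>" "p \<in> chart_dom \<kappa>"
  shows "inj (chart_deriv \<psi> (chart_map \<kappa>) p)"
  using assms unfolding submanifold_atlas_def chart_deriv_def by blast

text \<open>
  In an ambient chart the change of charts is a continuous lift of the smooth map
  \<open>chart_map \<kappa> \<circ> chart_inv \<psi>\<close> through the immersion \<open>chart_map \<kappa> \<circ> chart_inv \<psi>'\<close>.
\<close>

lemma submanifold_charts_transition:
  assumes M: "smooth_manifold M A"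
    and \<psi>: "\<psi> \<in> submanifold_atlas M A S" and \<psi>': "\<psi>' \<in> submanifold_atlas M A S"
  shows "smooth_transition \<psi> \<psi>'"
proof (rule smooth_transition_if_smooth)
  note on = submanifold_chart_on[OF \<psi>] and on' = submanifold_chart_on[OF \<psi>']
  show "chart_on (subtopology M S) \<psi>" "chart_on (subtopology M S) \<psi>'" by (fact on, fact on')
  show "smooth_on (chart_map \<psi> ` (chart_dom \<psi> \<inter> chart_dom \<psi>')) (chart_map \<psi>' \<circ> chart_inv \<psi>)"
  proof (rule smooth_on_local)
    fix x assume "x \<in> chart_map \<psi> ` (chart_dom \<psi> \<inter> chart_dom \<psi>')"
    then obtain p where p: "p \<in> chart_dom \<psi>" "p \<in> chart_dom \<psi>'" "x = chart_map \<psi> p" by blast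
    then obtain \<kappa> where \<kappa>: "\<kappa> \<in> A" "p \<in> chart_dom \<kappa>"
      using submanifold_chart_dom(2)[OF \<psi>] smooth_manifold_cover[OF M] by blast
    note t = submanifold_transition[OF M \<psi> \<kappa>(1)] and t' = submanifold_transition[OF M \<psi>' \<kappa>(1)]
    note inv = chart_inv_map[OF chart_on_inj[OF on]] and inv' = chart_inv_map[OF chart_on_inj[OF on']]
    let ?U = "chart_map \<psi> ` (chart_dom \<psi> \<inter> (chart_dom \<psi>' \<inter> (S \<inter> chart_dom \<kappa>)))"
    let ?V = "chart_map \<psi>' ` (chart_dom \<psi>' \<inter> chart_dom \<kappa>)"
    have oU: "open ?U"
      using chart_image_open[OF on] chart_on_openin[OF on'] openin_subtopology_Int2
        chart_on_openin[OF smooth_manifold_chart_on[OF M \<kappa>(1)]] openin_Int by metis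
    have "smooth_on ?U (chart_map \<psi>' \<circ> chart_inv \<psi>)"
    proof (rule smooth_on_continuous_lift[OF oU smooth_transitionD(1)[OF t'] _ _ smooth_transitionD(5)[OF t']])
      show "continuous_on ?U (chart_map \<psi>' \<circ> chart_inv \<psi>)"
        by (rule continuous_on_subset[OF transition_continuous[OF on on']]) auto
      show "(chart_map \<psi>' \<circ> chart_inv \<psi>) ` ?U \<subseteq> ?V" using inv by auto
      show "inj (frechet_derivative (chart_map \<kappa> \<circ> chart_inv \<psi>') (at z))" if "z \<in> ?V" for z
        using \<psi>' \<kappa>(1) that unfolding submanifold_atlas_def by blast
      show "smooth_on ?U (chart_map \<kappa> \<circ> chart_inv \<psi>)"
        by (rule smooth_on_subset[OF smooth_transitionD(5)[OF t]]) auto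
      show "(chart_map \<kappa> \<circ> chart_inv \<psi>') ((chart_map \<psi>' \<circ> chart_inv \<psi>) y) = (chart_map \<kappa> \<circ> chart_inv \<psi>) y"
        if "y \<in> ?U" for y
        using that inv inv' by auto
    qed
    moreover have "x \<in> ?U" using p \<kappa>(2) submanifold_chart_dom(1)[OF \<psi>] by auto
    ultimately show "\<exists>U. open U \<and> x \<in> U \<and> smooth_on U (chart_map \<psi>' \<circ> chart_inv \<psi>)" using oU by blast
  qed
qed

text \<open>
  Near each point the inclusion in the coordinates of \<open>\<psi>\<close> is the inclusion in the coordinates of
  some \<open>\<psi>'\<close> composed with a change of charts, hence again a smooth immersion. This is the
  maximality of the submanifold atlas.
\<close>

lemma submanifold_chart_if_compatible:
  fixes \<psi> :: "('a, 'm::finite) chart"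
  assumes M: "smooth_manifold M A" and on: "chart_on (subtopology M S) \<psi>"
    and cover: "chart_dom \<psi> \<subseteq> (\<Union>\<psi>'\<in>(submanifold_atlas M A S :: ('a, 'm) chart set). chart_dom \<psi>')"
    and comp: "\<And>\<psi>'. \<psi>' \<in> submanifold_atlas M A S \<Longrightarrow> compatible \<psi> \<psi>'"
  shows "\<psi> \<in> submanifold_atlas M A S"
  unfolding submanifold_atlas_def
proof (intro CollectI conjI on ballI)
  fix \<kappa> assume \<kappa>: "\<kappa> \<in> A"
  note on\<kappa> = smooth_manifold_chart_on[OF M \<kappa>]
  have tr: "smooth_transition \<psi> \<psi>'" "smooth_transition \<psi>' \<psi>" if "\<psi>' \<in> submanifold_atlas M A S" for \<psi>' :: "('a, 'm) chart"
    using smooth_transition_if_smooth[OF on submanifold_chart_on[OF that]]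
      smooth_transition_if_smooth[OF submanifold_chart_on[OF that] on] comp[OF that]
    by (auto simp: compatible_def Int_commute)
  show "smooth_on (chart_map \<psi> ` (chart_dom \<psi> \<inter> chart_dom \<kappa>)) (chart_map \<kappa> \<circ> chart_inv \<psi>)"
  proof (rule smooth_on_local)
    fix x assume "x \<in> chart_map \<psi> ` (chart_dom \<psi> \<inter> chart_dom \<kappa>)"
    then obtain p where p: "p \<in> chart_dom \<psi>" "p \<in> chart_dom \<kappa>" "x = chart_map \<psi> p" by blast
    then obtain \<psi>' :: "('a, 'm) chart" where \<psi>': "\<psi>' \<in> submanifold_atlas M A S" "p \<in> chart_dom \<psi>'" using cover by blast
    note t' = submanifold_transition[OF M \<psi>'(1) \<kappa>]
    let ?U = "chart_map \<psi> ` (chart_dom \<psi> \<inter> chart_dom \<psi>' \<inter> chart_dom \<kappa>)"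
    have "openin (subtopology M S) (chart_dom \<psi>' \<inter> (S \<inter> chart_dom \<kappa>))"
      using chart_on_openin[OF submanifold_chart_on[OF \<psi>'(1)]] chart_on_openin[OF on\<kappa>]
      by (intro openin_Int openin_subtopology_Int2)
    moreover have "chart_dom \<psi> \<inter> (chart_dom \<psi>' \<inter> (S \<inter> chart_dom \<kappa>)) = chart_dom \<psi> \<inter> chart_dom \<psi>' \<inter> chart_dom \<kappa>"
      using submanifold_chart_dom(1)[OF \<psi>'(1)] by auto
    ultimately have oU: "open ?U" using chart_image_open[OF on] by metis
    have "smooth_on ?U (chart_map \<kappa> \<circ> chart_inv \<psi>)"
      by (rule transition_smooth_on_Int[OF tr(1)[OF \<psi>'(1)] oU smooth_transitionD(1,5)[OF t']])
    then show "\<exists>U. open U \<and> x \<in> U \<and> smooth_on U (chart_map \<kappa> \<circ> chart_inv \<psi>)"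
      using oU p \<psi>'(2) by blast
  qed
  fix x assume "x \<in> chart_map \<psi> ` (chart_dom \<psi> \<inter> chart_dom \<kappa>)"
  then obtain p where p: "p \<in> chart_dom \<psi>" "p \<in> chart_dom \<kappa>" "x = chart_map \<psi> p" by blast
  then obtain \<psi>' :: "('a, 'm) chart" where \<psi>': "\<psi>' \<in> submanifold_atlas M A S" "p \<in> chart_dom \<psi>'" using cover by blast
  note t' = submanifold_transition[OF M \<psi>'(1) \<kappa>]
  have "chart_deriv \<psi> (chart_map \<kappa>) p v =
      chart_deriv \<psi>' (chart_map \<kappa>) p (chart_deriv \<psi> (chart_map \<psi>') p v)" for v
    by (rule chart_deriv_chain[OF tr(1)[OF \<psi>'(1)] p(1) \<psi>'(2) transition_has_derivative[OF t' \<psi>'(2) p(2)]])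
  moreover have "inj (chart_deriv \<psi>' (chart_map \<kappa>) p)"
    by (rule submanifold_immersion[OF \<psi>'(1) \<kappa> \<psi>'(2) p(2)])
  moreover have "inj (chart_deriv \<psi> (chart_map \<psi>') p)"
    using transition_derivative_inverse[OF tr(2,1)[OF \<psi>'(1)] on \<psi>'(2) p(1)] by (rule inj_on_inverseI)
  ultimately have "inj (chart_deriv \<psi> (chart_map \<kappa>) p)" by (auto simp: inj_def)
  then show "inj (frechet_derivative (chart_map \<kappa> \<circ> chart_inv \<psi>) (at x))"
    by (simp add: chart_deriv_def p(3))
qed

text \<open>
  Forgetting the vanishing coordinate \<open>x\<^sub>k\<close> of a slice chart gives a chart of the slice. The
  bijection \<open>e\<close> renumbers the remaining coordinates by the index type of smaller cardinality.
\<close>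

lemma slice_submanifold_chart:
  fixes A :: "('a, 'n::finite) chart set" and e :: "'m::finite \<Rightarrow> 'n"
  assumes M: "smooth_manifold M A" and \<kappa>: "\<kappa> \<in> A"
    and slice: "S \<inter> chart_dom \<kappa> = {q \<in> chart_dom \<kappa>. chart_map \<kappa> q $ k = 0}"
    and e: "inj e" "range e = UNIV - {k}"
  shows "(S \<inter> chart_dom \<kappa>, \<lambda>q. \<chi> j. chart_map \<kappa> q $ e j) \<in> submanifold_atlas M A S"
    (is "?\<psi> \<in> _")
proof -
  note on = smooth_manifold_chart_on[OF M \<kappa>]
  note inv = chart_inv_map[OF chart_on_inj[OF on]]
  \<comment> \<open>the projection that forgets \<open>x\<^sub>k\<close>, and its section with image \<open>x\<^sub>k = 0\<close>\<close>
  define pr where "pr x = (\<chi> j. x $ e j)" for x :: "real^'n"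
  define em where "em y = (\<chi> i. if i = k then 0 else y $ inv_into UNIV e i)" for y :: "real^'m"
  have blpr: "bounded_linear pr"
    unfolding linear_conv_bounded_linear[symmetric] by (rule linearI) (auto simp: pr_def vec_eq_iff)
  have blem: "bounded_linear em"
    unfolding linear_conv_bounded_linear[symmetric] by (rule linearI) (auto simp: em_def vec_eq_iff)
  have ek: "e j \<noteq> k" for j using e(2) by auto
  have prem: "pr (em y) = y" for y using e(1) ek by (simp add: pr_def em_def vec_eq_iff)
  have empr: "em (pr x) = x" if "x $ k = 0" for x
  proof -
    have "e (inv_into UNIV e i) = i" if "i \<noteq> k" for i using e(2) that by (simp add: f_inv_into_f)
    then show ?thesis using that by (auto simp: pr_def em_def vec_eq_iff)
  qed
  have emk: "em y $ k = 0" for y by (simp add: em_def)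
  have \<psi>: "?\<psi> = (S \<inter> chart_dom \<kappa>, \<lambda>q. pr (chart_map \<kappa> q))" by (simp add: pr_def)
  have zero: "chart_map \<kappa> q $ k = 0" if "q \<in> S" "q \<in> chart_dom \<kappa>" for q using slice that by blast
  have inj: "inj_on (\<lambda>q. pr (chart_map \<kappa> q)) (S \<inter> chart_dom \<kappa>)"
    using empr zero inv by (intro inj_on_inverseI[where g = "\<lambda>y. chart_inv \<kappa> (em y)"]) auto
  have on': "chart_on (subtopology M S) ?\<psi>" unfolding \<psi>
  proof (rule chart_onI[OF _ inj])
    show "openin (subtopology M S) (S \<inter> chart_dom \<kappa>)"
      by (rule openin_subtopology_Int2[OF chart_on_openin[OF on]])
    show "open ((\<lambda>q. pr (chart_map \<kappa> q)) ` V)"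
      if V: "openin (subtopology M S) V" "V \<subseteq> S \<inter> chart_dom \<kappa>" for V
    proof -
      obtain W where W: "openin M W" "V = W \<inter> S" using V(1) by (auto simp: openin_subtopology)
      have "(\<lambda>q. pr (chart_map \<kappa> q)) ` V = em -` (chart_map \<kappa> ` (chart_dom \<kappa> \<inter> W))"
      proof (intro equalityI subsetI)
        fix y assume "y \<in> (\<lambda>q. pr (chart_map \<kappa> q)) ` V"
        then show "y \<in> em -` (chart_map \<kappa> ` (chart_dom \<kappa> \<inter> W))" using V W empr zero by fastforce
      next
        fix y assume "y \<in> em -` (chart_map \<kappa> ` (chart_dom \<kappa> \<inter> W))"
        then obtain q where q: "q \<in> chart_dom \<kappa>" "q \<in> W" "em y = chart_map \<kappa> q" by blast
        then have "q \<in> S" using slice emk[of y] by auto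
        moreover have "y = pr (chart_map \<kappa> q)" using q(3) prem by metis
        ultimately show "y \<in> (\<lambda>q. pr (chart_map \<kappa> q)) ` V" using q W(2) by blast
      qed
      then show ?thesis
        using open_vimage[OF chart_image_open[OF on W(1)] linear_continuous_on[OF blem]] by simp
    qed
    show "openin (subtopology M S) {q \<in> S \<inter> chart_dom \<kappa>. pr (chart_map \<kappa> q) \<in> W}" if "open W" for W
    proof -
      have "open (pr -` W)" by (rule open_vimage[OF that linear_continuous_on[OF blpr]])
      from openin_subtopology_Int2[OF chart_vimage_open[OF on this], of S]
      show ?thesis by (simp add: Int_def conj_assoc)
    qed
  qed
  have inv': "chart_inv ?\<psi> y = chart_inv \<kappa> (em y)" if "y \<in> chart_map ?\<psi> ` chart_dom ?\<psi>" for y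
  proof -
    obtain q where q: "q \<in> S" "q \<in> chart_dom \<kappa>" "y = pr (chart_map \<kappa> q)"
      using \<open>y \<in> chart_map ?\<psi> ` chart_dom ?\<psi>\<close> by (auto simp: pr_def)
    then have "chart_inv ?\<psi> y = q"
      using chart_inv_map[of ?\<psi> q] inj by (simp add: pr_def)
    then show ?thesis using q empr zero inv by simp
  qed
  show ?thesis
    unfolding submanifold_atlas_def
  proof (intro CollectI conjI on' ballI)
    fix \<kappa>2 assume \<kappa>2: "\<kappa>2 \<in> A"
    note on2 = smooth_manifold_chart_on[OF M \<kappa>2]
    note t = smooth_manifold_transition[OF M \<kappa> \<kappa>2] and t' = smooth_manifold_transition[OF M \<kappa>2 \<kappa>]
    let ?X = "chart_map ?\<psi> ` (chart_dom ?\<psi> \<inter> chart_dom \<kappa>2)"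
    have oX: "open ?X" by (rule chart_image_open_ambient[OF on' chart_on_openin[OF on2]])
    have eq: "(chart_map \<kappa>2 \<circ> chart_inv \<kappa>) (em y) = (chart_map \<kappa>2 \<circ> chart_inv ?\<psi>) y" if "y \<in> ?X" for y
      using inv'[of y] that by auto
    have emX: "em y \<in> chart_map \<kappa> ` (chart_dom \<kappa> \<inter> chart_dom \<kappa>2)" if "y \<in> ?X" for y
      using that empr zero unfolding \<psi> by auto
    show "smooth_on ?X (chart_map \<kappa>2 \<circ> chart_inv ?\<psi>)"
    proof (rule smooth_on_cong[OF oX eq])
      show "smooth_on ?X (\<lambda>y. (chart_map \<kappa>2 \<circ> chart_inv \<kappa>) (em y))"
        by (rule smooth_on_compose[OF oX smooth_transitionD(1)[OF t] _ smooth_on_linear[OF blem oX] smooth_transitionD(5)[OF t]])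
           (use emX in blast)
    qed
    fix y assume y: "y \<in> ?X"
    obtain q where q: "q \<in> chart_dom \<kappa>" "q \<in> chart_dom \<kappa>2" "em y = chart_map \<kappa> q" using emX[OF y] by blast
    have "((\<lambda>y. (chart_map \<kappa>2 \<circ> chart_inv \<kappa>) (em y)) has_derivative
        (\<lambda>v. chart_deriv \<kappa> (chart_map \<kappa>2) q (em v))) (at y)"
      using has_derivative_compose[OF bounded_linear_imp_has_derivative[OF blem], where g = "chart_map \<kappa>2 \<circ> chart_inv \<kappa>" and x = y and s = UNIV]
        transition_has_derivative[OF t q(1,2)] unfolding q(3)[symmetric] by (simp only:)
    then have "((chart_map \<kappa>2 \<circ> chart_inv ?\<psi>) has_derivative
        (\<lambda>v. chart_deriv \<kappa> (chart_map \<kappa>2) q (em v))) (at y)"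
      by (rule has_derivative_transform_within_open[OF _ oX y eq])
    then have "frechet_derivative (chart_map \<kappa>2 \<circ> chart_inv ?\<psi>) (at y) =
        (\<lambda>v. chart_deriv \<kappa> (chart_map \<kappa>2) q (em v))"
      by (rule frechet_derivative_at[symmetric])
    moreover have "inj (chart_deriv \<kappa> (chart_map \<kappa>2) q)"
      using transition_derivative_inverse[OF t' t on q(2,1)] by (rule inj_on_inverseI)
    moreover have "inj em" using prem by (rule inj_on_inverseI)
    ultimately show "inj (frechet_derivative (chart_map \<kappa>2 \<circ> chart_inv ?\<psi>) (at y))"
      by (auto simp: inj_def)
  qed
qed

lemma hypersurface_charts_cover:
  fixes A :: "('a, 'n::finite) chart set"
  assumes "CARD('n) = CARD('m::finite) + 1" "smooth_manifold M A" "hypersurface M A S"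
  shows "(\<Union>\<psi>\<in>(submanifold_atlas M A S :: ('a, 'm) chart set). chart_dom \<psi>) = S"
proof (intro equalityI subsetI)
  fix p assume "p \<in> S"
  then obtain \<kappa> k where \<kappa>: "\<kappa> \<in> A" "p \<in> chart_dom \<kappa>" "S \<inter> chart_dom \<kappa> = {q \<in> chart_dom \<kappa>. chart_map \<kappa> q $ k = 0}"
    using assms(3) unfolding hypersurface_def by blast
  have "card (UNIV :: 'm set) = card (UNIV - {k})" using assms(1) by (simp add: card_Diff_singleton)
  then obtain e :: "'m \<Rightarrow> 'n" where "bij_betw e UNIV (UNIV - {k})"
    using finite_same_card_bij[of "UNIV :: 'm set" "UNIV - {k}"] by auto
  then have e: "inj e" "range e = UNIV - {k}" by (auto simp: bij_betw_def)
  show "p \<in> (\<Union>\<psi>\<in>(submanifold_atlas M A S :: ('a, 'm) chart set). chart_dom \<psi>)"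
    using slice_submanifold_chart[OF assms(2) \<kappa>(1,3) e] \<kappa>(2) \<open>p \<in> S\<close> by (intro UN_I) auto
next
  fix p assume "p \<in> (\<Union>\<psi>\<in>(submanifold_atlas M A S :: ('a, 'm) chart set). chart_dom \<psi>)"
  then show "p \<in> S" using submanifold_chart_dom(1) by blast
qed

lemma hypersurface_smooth_manifold:
  fixes A :: "('a, 'n::finite) chart set"
  assumes "CARD('n) = CARD('m::finite) + 1" "smooth_manifold M A" "hypersurface M A S"
  shows "smooth_manifold (subtopology M S) (submanifold_atlas M A S :: ('a, 'm) chart set)"
proof -
  let ?B = "submanifold_atlas M A S :: ('a, 'm) chart set"
  have S: "S \<subseteq> topspace M" using assms(3) by (simp add: hypersurface_def)
  have "?B = {\<psi>. chart_on (subtopology M S) \<psi> \<and> (\<forall>\<psi>'\<in>?B. compatible \<psi> \<psi>')}"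
  proof (intro equalityI subsetI CollectI conjI ballI)
    fix \<psi> assume \<psi>: "\<psi> \<in> ?B"
    show "chart_on (subtopology M S) \<psi>" by (rule submanifold_chart_on[OF \<psi>])
    fix \<psi>' assume \<psi>': "\<psi>' \<in> ?B"
    show "compatible \<psi> \<psi>'"
      using smooth_transitionD(5)[OF submanifold_charts_transition[OF assms(2) \<psi> \<psi>']]
        smooth_transitionD(5)[OF submanifold_charts_transition[OF assms(2) \<psi>' \<psi>]]
      by (simp add: compatible_def Int_commute)
  next
    fix \<psi> assume \<psi>: "\<psi> \<in> {\<psi>. chart_on (subtopology M S) \<psi> \<and> (\<forall>\<psi>'\<in>?B. compatible \<psi> \<psi>')}"
    then have "chart_dom \<psi> \<subseteq> S" using openin_subset[OF chart_on_openin] by fastforce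
    then show "\<psi> \<in> ?B"
      using submanifold_chart_if_compatible[OF assms(2), of S \<psi>] hypersurface_charts_cover[OF assms] \<psi> by simp
  qed
  moreover have "Hausdorff_space (subtopology M S)" "second_countable (subtopology M S)"
    using assms(2) Hausdorff_space_subtopology second_countable_subtopology unfolding smooth_manifold_def by blast+
  moreover have "(\<Union>\<psi>\<in>?B. chart_dom \<psi>) = topspace (subtopology M S)"
    using hypersurface_charts_cover[OF assms] S by auto
  ultimately show ?thesis unfolding smooth_manifold_def by blast
qed

section \<open>Pullback of metrics\<close>

lemma ip_eq_inner: "ip G v w = v \<bullet> (G *v w)"
  by (simp add: ip_def inner_vec_def matrix_vector_mult_def sum_distrib_left mult_ac)

lemma ip_axis: "ip G (axis i 1) (axis j 1) = G $ i $ j"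
  by (simp add: ip_eq_inner inner_axis' matrix_vector_mult_basis column_def)

lemma linear_ip_left: "linear (\<lambda>v. ip G v w)"
  by (rule linearI) (simp_all add: ip_eq_inner inner_add_left)

lemma linear_ip_right: "linear (\<lambda>w. ip G v w)"
  by (rule linearI) (simp_all add: ip_eq_inner matrix_vector_right_distrib matrix_vector_mult_scaleR inner_add_right)

lemma ip_commute:
  assumes "\<And>i j. G $ i $ j = G $ j $ i"
  shows "ip G v w = ip G w v"
proof -
  have "ip G v w = (\<Sum>b\<in>UNIV. \<Sum>a\<in>UNIV. G $ a $ b * v $ a * w $ b)"
    unfolding ip_def by (rule sum.swap)
  also have "\<dots> = (\<Sum>b\<in>UNIV. \<Sum>a\<in>UNIV. G $ b $ a * w $ b * v $ a)"
  proof (intro sum.cong refl)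
    show "G $ a $ b * v $ a * w $ b = G $ b $ a * w $ b * v $ a" for a b
      using assms[of a b] by simp
  qed
  finally show ?thesis by (simp add: ip_def)
qed

lemma ip_scaleR_matrix: "ip (r *\<^sub>R G) v w = r * ip G v w"
  by (simp add: ip_def sum_distrib_left mult.assoc)

lemma ip_zero: "ip G 0 w = 0" "ip G v 0 = 0"
  by (simp_all add: ip_def)

lemma bilinear_eqI_axis:
  fixes B B' :: "real^'m \<Rightarrow> real^'m \<Rightarrow> real"
  assumes "\<And>w. linear (\<lambda>v. B v w)" "\<And>v. linear (B v)" "\<And>w. linear (\<lambda>v. B' v w)" "\<And>v. linear (B' v)"
    and eq: "\<And>i j. B (axis i 1) (axis j 1) = B' (axis i 1) (axis j 1)"
  shows "B v w = B' v w"
proof -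
  have "B (axis i 1) = B' (axis i 1)" for i
    by (rule linear_eqI_axis[OF assms(2,4) eq])
  then have "(\<lambda>v. B v w) = (\<lambda>v. B' v w)"
    by (intro linear_eqI_axis assms(1,3)) simp
  from fun_cong[OF this, of v] show ?thesis .
qed

lemma ip_pullback_iff:
  fixes J :: "real^'m \<Rightarrow> real^'n"
  assumes "linear J"
  shows "(\<forall>i j. H $ i $ j = ip G (J (axis i 1)) (J (axis j 1))) \<longleftrightarrow> (\<forall>v w. ip H v w = ip G (J v) (J w))"
proof (intro iffI allI)
  fix v w assume "\<forall>i j. H $ i $ j = ip G (J (axis i 1)) (J (axis j 1))"
  then have eq: "ip H (axis i 1) (axis j 1) = ip G (J (axis i 1)) (J (axis j 1))" for i j
    by (simp add: ip_axis)
  have lin: "linear (\<lambda>v. ip G (J v) (J w))" "linear (\<lambda>w. ip G (J v) (J w))" for v w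
    using linear_compose[OF assms linear_ip_left[of G "J w"]] linear_compose[OF assms linear_ip_right[of G "J v"]]
    by (simp_all add: o_def)
  show "ip H v w = ip G (J v) (J w)"
    by (rule bilinear_eqI_axis[of "ip H" "\<lambda>v w. ip G (J v) (J w)", OF linear_ip_left linear_ip_right lin eq])
next
  fix i j assume "\<forall>v w. ip H v w = ip G (J v) (J w)"
  then show "H $ i $ j = ip G (J (axis i 1)) (J (axis j 1))" by (simp flip: ip_axis)
qed

lemma pd_component:
  assumes "(f \<circ> chart_inv \<psi> has_derivative D) (at (chart_map \<psi> p))"
  shows "pd \<psi> i (\<lambda>q. f q $ a) p = D (axis i 1) $ a"
proof -
  have "((\<lambda>q. f q $ a) \<circ> chart_inv \<psi> has_derivative (\<lambda>v. D v $ a)) (at (chart_map \<psi> p))"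
    using bounded_linear.has_derivative[OF bounded_linear_vec_nth assms] by (simp add: o_def)
  from fun_cong[OF frechet_derivative_at[OF this]] show ?thesis by (simp add: pd_def)
qed

lemma pullback_tensor_iff:
  assumes tr: "\<And>\<kappa> \<psi>. \<kappa> \<in> A \<Longrightarrow> \<psi> \<in> B \<Longrightarrow> smooth_transition \<psi> \<kappa>"
  shows "pullback_tensor A B g \<gamma> \<longleftrightarrow> (\<forall>\<kappa>\<in>A. \<forall>\<psi>\<in>B. \<forall>p\<in>chart_dom \<kappa> \<inter> chart_dom \<psi>. \<forall>v w.
    ip (\<gamma> \<psi> p) v w = ip (g \<kappa> p) (chart_deriv \<psi> (chart_map \<kappa>) p v) (chart_deriv \<psi> (chart_map \<kappa>) p w))"
proof -
  have "(\<forall>i j. \<gamma> \<psi> p $ i $ j = (\<Sum>a\<in>UNIV. \<Sum>b\<in>UNIV.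
          pd \<psi> i (\<lambda>q. chart_map \<kappa> q $ a) p * pd \<psi> j (\<lambda>q. chart_map \<kappa> q $ b) p * g \<kappa> p $ a $ b)) \<longleftrightarrow>
      (\<forall>v w. ip (\<gamma> \<psi> p) v w = ip (g \<kappa> p) (chart_deriv \<psi> (chart_map \<kappa>) p v) (chart_deriv \<psi> (chart_map \<kappa>) p w))"
    if "\<kappa> \<in> A" "\<psi> \<in> B" "p \<in> chart_dom \<kappa> \<inter> chart_dom \<psi>" for \<kappa> \<psi> p
  proof -
    note p = IntD2[OF that(3)] IntD1[OF that(3)]
    show ?thesis
      unfolding ip_pullback_iff[OF transition_linear[OF tr[OF that(1,2)] p], symmetric]
        pd_component[OF transition_has_derivative[OF tr[OF that(1,2)] p]]
      by (simp add: ip_def mult_ac)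
  qed
  then show ?thesis unfolding pullback_tensor_def by (intro ball_cong refl) blast
qed

lemma riemannian_metricsD:
  assumes "g \<in> riemannian_metrics A" "\<kappa> \<in> A"
  shows "chart_smooth \<kappa> (\<lambda>p. g \<kappa> p $ i $ j)"
    and "p \<in> chart_dom \<kappa> \<Longrightarrow> g \<kappa> p $ i $ j = g \<kappa> p $ j $ i"
    and "p \<in> chart_dom \<kappa> \<Longrightarrow> v \<noteq> 0 \<Longrightarrow> ip (g \<kappa> p) v v > 0"
proof -
  have "(\<forall>i j. chart_smooth \<kappa> (\<lambda>p. g \<kappa> p $ i $ j)) \<and>
        (\<forall>p\<in>chart_dom \<kappa>. (\<forall>i j. g \<kappa> p $ i $ j = g \<kappa> p $ j $ i) \<and>
           (\<forall>v. v \<noteq> 0 \<longrightarrow> ip (g \<kappa> p) v v > 0))"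
    using assms unfolding riemannian_metrics_def by blast
  then show "chart_smooth \<kappa> (\<lambda>p. g \<kappa> p $ i $ j)"
    "p \<in> chart_dom \<kappa> \<Longrightarrow> g \<kappa> p $ i $ j = g \<kappa> p $ j $ i"
    "p \<in> chart_dom \<kappa> \<Longrightarrow> v \<noteq> 0 \<Longrightarrow> ip (g \<kappa> p) v v > 0" by blast+
qed

text \<open>
  What the geometry below uses about a submanifold: ambient coordinates restrict to smooth
  immersions in the charts of \<open>B\<close>.
\<close>

locale immersed_atlas =
  fixes M :: "'a topology" and A :: "('a, 'n::finite) chart set"
    and N :: "'a topology" and B :: "('a, 'm::finite) chart set"
  assumes M: "smooth_manifold M A" and N: "smooth_manifold N B"
    and transition: "\<kappa> \<in> A \<Longrightarrow> \<psi> \<in> B \<Longrightarrow> smooth_transition \<psi> \<kappa>"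
    and immersion: "\<kappa> \<in> A \<Longrightarrow> \<psi> \<in> B \<Longrightarrow> p \<in> chart_dom \<psi> \<Longrightarrow> p \<in> chart_dom \<kappa> \<Longrightarrow>
      inj (chart_deriv \<psi> (chart_map \<kappa>) p)"
    and subspace: "topspace N \<subseteq> topspace M"
begin

lemma ambient_chart:
  assumes "\<psi> \<in> B" "p \<in> chart_dom \<psi>"
  obtains \<kappa> where "\<kappa> \<in> A" "p \<in> chart_dom \<kappa>"
proof -
  have "p \<in> topspace N" using assms smooth_manifold_cover[OF N] by blast
  then have "p \<in> (\<Union>\<kappa>\<in>A. chart_dom \<kappa>)" using subspace smooth_manifold_cover[OF M] by blast
  then show ?thesis using that by blast
qed

lemma smooth_fun_restrict:
  assumes "smooth_fun A f" shows "smooth_fun B f"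
  unfolding smooth_fun_def
proof
  fix \<psi> assume \<psi>: "\<psi> \<in> B"
  then have "chart_dom \<psi> \<subseteq> (\<Union>\<kappa>\<in>A. chart_dom \<kappa>)"
    using subspace smooth_manifold_cover[OF M] smooth_manifold_cover[OF N] by blast
  then show "chart_smooth \<psi> f"
  proof (rule chart_smooth_from_cover[where A = A, rotated 2])
    show "smooth_transition \<psi> \<kappa>" if "\<kappa> \<in> A" for \<kappa> by (rule transition[OF that \<psi>])
    show "chart_smooth \<kappa> f" if "\<kappa> \<in> A" for \<kappa> using assms that by (simp add: smooth_fun_def)
  qed
qed

lemma chain:
  assumes "\<kappa> \<in> A" "\<kappa>' \<in> A" "\<psi> \<in> B" "p \<in> chart_dom \<kappa>" "p \<in> chart_dom \<kappa>'" "p \<in> chart_dom \<psi>"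
  shows "chart_deriv \<psi> (chart_map \<kappa>') p v = chart_deriv \<kappa> (chart_map \<kappa>') p (chart_deriv \<psi> (chart_map \<kappa>) p v)"
  by (rule chart_deriv_chain[OF transition[OF assms(1,3)] assms(6,4)
        transition_has_derivative[OF smooth_manifold_transition[OF M assms(1,2)] assms(4,5)]])

lemma chain':
  assumes "\<kappa> \<in> A" "\<psi> \<in> B" "\<psi>' \<in> B" "p \<in> chart_dom \<kappa>" "p \<in> chart_dom \<psi>" "p \<in> chart_dom \<psi>'"
  shows "chart_deriv \<psi>' (chart_map \<kappa>) p v = chart_deriv \<psi> (chart_map \<kappa>) p (chart_deriv \<psi>' (chart_map \<psi>) p v)"
  by (rule chart_deriv_chain[OF smooth_manifold_transition[OF N assms(3,2)] assms(6,5)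
        transition_has_derivative[OF transition[OF assms(1,2)] assms(5,4)]])

lemma pullback_iff:
  "pullback_tensor A B g \<gamma> \<longleftrightarrow> (\<forall>\<kappa>\<in>A. \<forall>\<psi>\<in>B. \<forall>p\<in>chart_dom \<kappa> \<inter> chart_dom \<psi>. \<forall>v w.
    ip (\<gamma> \<psi> p) v w = ip (g \<kappa> p) (chart_deriv \<psi> (chart_map \<kappa>) p v) (chart_deriv \<psi> (chart_map \<kappa>) p w))"
  by (rule pullback_tensor_iff) (rule transition)

lemma pullback_ip:
  assumes "pullback_tensor A B g \<gamma>" "\<kappa> \<in> A" "\<psi> \<in> B" "p \<in> chart_dom \<kappa>" "p \<in> chart_dom \<psi>"
  shows "ip (\<gamma> \<psi> p) v w = ip (g \<kappa> p) (chart_deriv \<psi> (chart_map \<kappa>) p v) (chart_deriv \<psi> (chart_map \<kappa>) p w)"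
  using assms(1)[unfolded pullback_iff, rule_format, OF assms(2,3)] assms(4,5) by blast

lemma tensor_law:
  assumes "g \<in> riemannian_metrics A" "\<kappa> \<in> A" "\<kappa>' \<in> A" "p \<in> chart_dom \<kappa>" "p \<in> chart_dom \<kappa>'"
  shows "ip (g \<kappa>' p) v w = ip (g \<kappa> p) (chart_deriv \<kappa>' (chart_map \<kappa>) p v) (chart_deriv \<kappa>' (chart_map \<kappa>) p w)"
proof -
  have "pullback_tensor A A g g" using assms(1) by (simp add: riemannian_metrics_def)
  then show ?thesis
    using pullback_tensor_iff[of A A g g] smooth_manifold_transition[OF M] assms(2-5) by blast
qed

text \<open>
  The components in the chart \<open>\<psi>\<close> at \<open>p\<close> can be computed with any ambient chart around \<open>p\<close>, as the
  transformation law of \<open>g\<close> and the chain rule cancel. A choice of chart at every point therefore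
  defines the pullback.
\<close>

lemma pullback_exists:
  assumes g: "g \<in> riemannian_metrics A"
  shows "\<exists>\<gamma>. pullback_tensor A B g \<gamma>"
proof
  define ch where "ch p = (SOME \<kappa>. \<kappa> \<in> A \<and> p \<in> chart_dom \<kappa>)" for p
  define J where "J \<psi> p = chart_deriv \<psi> (chart_map (ch p)) p" for \<psi> :: "('a, 'm) chart" and p
  define \<gamma> where "\<gamma> \<psi> p = (\<chi> i j. ip (g (ch p) p) (J \<psi> p (axis i 1)) (J \<psi> p (axis j 1)))" for \<psi> p
  show "pullback_tensor A B g \<gamma>"
    unfolding pullback_iff
  proof (intro ballI allI)
    fix \<kappa> \<psi> p v w assume *: "\<kappa> \<in> A" "\<psi> \<in> B" "p \<in> chart_dom \<kappa> \<inter> chart_dom \<psi>"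
    then have p: "p \<in> chart_dom \<kappa>" "p \<in> chart_dom \<psi>" by auto
    have ch: "ch p \<in> A" "p \<in> chart_dom (ch p)"
      using someI[of "\<lambda>\<kappa>. \<kappa> \<in> A \<and> p \<in> chart_dom \<kappa>" \<kappa>] * by (auto simp: ch_def)
    have "linear (J \<psi> p)" unfolding J_def by (rule transition_linear[OF transition[OF ch(1) *(2)] p(2) ch(2)])
    then have "ip (\<gamma> \<psi> p) v w = ip (g (ch p) p) (J \<psi> p v) (J \<psi> p w)"
      using ip_pullback_iff[of "J \<psi> p" "\<gamma> \<psi> p" "g (ch p) p"] by (simp add: \<gamma>_def)
    also have "\<dots> = ip (g \<kappa> p) (chart_deriv (ch p) (chart_map \<kappa>) p (J \<psi> p v)) (chart_deriv (ch p) (chart_map \<kappa>) p (J \<psi> p w))"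
      by (rule tensor_law[OF g *(1) ch(1) p(1) ch(2)])
    finally show "ip (\<gamma> \<psi> p) v w = ip (g \<kappa> p) (chart_deriv \<psi> (chart_map \<kappa>) p v) (chart_deriv \<psi> (chart_map \<kappa>) p w)"
      unfolding J_def using chain[OF ch(1) *(1,2) ch(2) p] by simp
  qed
qed

lemma pullback_riemannian:
  assumes g: "g \<in> riemannian_metrics A" and \<gamma>: "pullback_tensor A B g \<gamma>"
  shows "\<gamma> \<in> riemannian_metrics B"
  unfolding riemannian_metrics_def
proof (intro CollectI conjI ballI allI impI)
  have "\<forall>\<psi>\<in>B. \<forall>\<psi>'\<in>B. \<forall>p\<in>chart_dom \<psi> \<inter> chart_dom \<psi>'. \<forall>v w. ip (\<gamma> \<psi>' p) v w =
      ip (\<gamma> \<psi> p) (chart_deriv \<psi>' (chart_map \<psi>) p v) (chart_deriv \<psi>' (chart_map \<psi>) p w)"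
  proof (intro ballI allI)
    fix \<psi> \<psi>' p v w assume *: "\<psi> \<in> B" "\<psi>' \<in> B" "p \<in> chart_dom \<psi> \<inter> chart_dom \<psi>'"
    then have p: "p \<in> chart_dom \<psi>" "p \<in> chart_dom \<psi>'" by auto
    obtain \<kappa> where \<kappa>: "\<kappa> \<in> A" "p \<in> chart_dom \<kappa>" using ambient_chart *(1) p(1) by blast
    show "ip (\<gamma> \<psi>' p) v w = ip (\<gamma> \<psi> p) (chart_deriv \<psi>' (chart_map \<psi>) p v) (chart_deriv \<psi>' (chart_map \<psi>) p w)"
      using pullback_ip[OF \<gamma> \<kappa>(1) *(1) \<kappa>(2) p(1)] pullback_ip[OF \<gamma> \<kappa>(1) *(2) \<kappa>(2) p(2)]
        chain'[OF \<kappa>(1) *(1,2) \<kappa>(2) p] by simp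
  qed
  then show "pullback_tensor B B \<gamma> \<gamma>"
    using pullback_tensor_iff[of B B \<gamma> \<gamma>] smooth_manifold_transition[OF N] by blast
next
  fix \<psi> i j assume \<psi>: "\<psi> \<in> B"
  show "chart_smooth \<psi> (\<lambda>p. \<gamma> \<psi> p $ i $ j)"
    unfolding chart_smooth_def
  proof (rule smooth_on_local)
    fix x assume "x \<in> chart_map \<psi> ` chart_dom \<psi>"
    then obtain p where p: "p \<in> chart_dom \<psi>" "x = chart_map \<psi> p" by blast
    obtain \<kappa> where \<kappa>: "\<kappa> \<in> A" "p \<in> chart_dom \<kappa>" using ambient_chart[OF \<psi> p(1)] by blast
    note t = transition[OF \<kappa>(1) \<psi>]
    let ?S = "chart_map \<psi> ` (chart_dom \<psi> \<inter> chart_dom \<kappa>)"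
    let ?D = "\<lambda>x i. frechet_derivative (chart_map \<kappa> \<circ> chart_inv \<psi>) (at x) (axis i 1)"
    note oS = smooth_transitionD(1)[OF t]
    have D: "smooth_on ?S (\<lambda>x. ?D x i $ a)" for i a
      by (intro smooth_on_bounded_linear[OF bounded_linear_vec_nth oS] smooth_on_derivative oS smooth_transitionD(5)[OF t])
    have G: "smooth_on ?S ((\<lambda>q. g \<kappa> q $ a $ b) \<circ> chart_inv \<psi>)" for a b
      by (rule transition_smooth_on[OF t riemannian_metricsD(1)[OF g \<kappa>(1)]])
    have "smooth_on ?S ((\<lambda>p. \<gamma> \<psi> p $ i $ j) \<circ> chart_inv \<psi>)"
    proof (rule smooth_on_cong[OF oS])
      show "smooth_on ?S (\<lambda>x. \<Sum>a\<in>UNIV. \<Sum>b\<in>UNIV. ((\<lambda>q. g \<kappa> q $ a $ b) \<circ> chart_inv \<psi>) x * ?D x i $ a * ?D x j $ b)"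
        by (intro smooth_on_sum smooth_on_mult oS G D)
      fix y assume "y \<in> ?S"
      then obtain q where q: "q \<in> chart_dom \<psi>" "q \<in> chart_dom \<kappa>" "y = chart_map \<psi> q" by blast
      then have qi: "chart_inv \<psi> y = q" using chart_inv_map[OF smooth_transitionD(2)[OF t]] by simp
      have "\<gamma> \<psi> q $ i $ j = ip (g \<kappa> q) (?D y i) (?D y j)"
        using pullback_ip[OF \<gamma> \<kappa>(1) \<psi> q(2,1), of "axis i 1" "axis j 1"] by (simp add: ip_axis chart_deriv_def q(3))
      then show "(\<Sum>a\<in>UNIV. \<Sum>b\<in>UNIV. ((\<lambda>q. g \<kappa> q $ a $ b) \<circ> chart_inv \<psi>) y * ?D y i $ a * ?D y j $ b) =
          ((\<lambda>p. \<gamma> \<psi> p $ i $ j) \<circ> chart_inv \<psi>) y"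
        by (simp add: qi ip_def)
    qed
    then show "\<exists>U. open U \<and> x \<in> U \<and> smooth_on U ((\<lambda>p. \<gamma> \<psi> p $ i $ j) \<circ> chart_inv \<psi>)"
      using oS p \<kappa>(2) by blast
  qed
next
  fix \<psi> p i j assume \<psi>: "\<psi> \<in> B" "p \<in> chart_dom \<psi>"
  obtain \<kappa> where \<kappa>: "\<kappa> \<in> A" "p \<in> chart_dom \<kappa>" using ambient_chart[OF \<psi>] by blast
  note pb = pullback_ip[OF \<gamma> \<kappa>(1) \<psi>(1) \<kappa>(2) \<psi>(2)]
  show "\<gamma> \<psi> p $ i $ j = \<gamma> \<psi> p $ j $ i"
    unfolding ip_axis[symmetric] pb by (rule ip_commute) (rule riemannian_metricsD(2)[OF g \<kappa>])
next
  fix \<psi> p and v :: "real^'m" assume \<psi>: "\<psi> \<in> B" "p \<in> chart_dom \<psi>" and "v \<noteq> 0"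
  obtain \<kappa> where \<kappa>: "\<kappa> \<in> A" "p \<in> chart_dom \<kappa>" using ambient_chart[OF \<psi>] by blast
  have "chart_deriv \<psi> (chart_map \<kappa>) p v \<noteq> 0"
    using immersion[OF \<kappa>(1) \<psi> \<kappa>(2)] transition_linear[OF transition[OF \<kappa>(1) \<psi>(1)] \<psi>(2) \<kappa>(2)] \<open>v \<noteq> 0\<close>
    unfolding linear_injective_0[OF transition_linear[OF transition[OF \<kappa>(1) \<psi>(1)] \<psi>(2) \<kappa>(2)]] by blast
  then show "ip (\<gamma> \<psi> p) v v > 0"
    unfolding pullback_ip[OF \<gamma> \<kappa>(1) \<psi>(1) \<kappa>(2) \<psi>(2)] by (rule riemannian_metricsD(3)[OF g \<kappa>])
qed

end

lemma hypersurface_immersed_atlas: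
  fixes A :: "('a, 'n::finite) chart set"
  assumes "CARD('n) = CARD('m::finite) + 1" "smooth_manifold M A" "hypersurface M A S"
  shows "immersed_atlas M A (subtopology M S) (submanifold_atlas M A S :: ('a, 'm) chart set)"
proof
  show "smooth_manifold (subtopology M S) (submanifold_atlas M A S :: ('a, 'm) chart set)"
    by (rule hypersurface_smooth_manifold[OF assms(1,2,3)])
  show "smooth_manifold M A" by (rule assms(2))
  show "smooth_transition \<psi> \<kappa>" if "\<kappa> \<in> A" "\<psi> \<in> submanifold_atlas M A S" for \<kappa> and \<psi> :: "('a, 'm) chart"
    by (rule submanifold_transition[OF assms(2) that(2,1)])
  show "inj (chart_deriv \<psi> (chart_map \<kappa>) p)"
    if "\<kappa> \<in> A" "\<psi> \<in> submanifold_atlas M A S" "p \<in> chart_dom \<psi>" "p \<in> chart_dom \<kappa>"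
    for \<kappa> p and \<psi> :: "('a, 'm) chart"
    by (rule submanifold_immersion[OF that(2,1,3,4)])
qed simp

section \<open>Conformal classes\<close>

lemma smooth_fun_add:
  assumes "smooth_manifold M A" "smooth_fun A f" "smooth_fun A h"
  shows "smooth_fun A (\<lambda>p. f p + h p)"
  unfolding smooth_fun_def chart_smooth_def
proof
  fix \<kappa> assume \<kappa>: "\<kappa> \<in> A"
  have "smooth_on (chart_map \<kappa> ` chart_dom \<kappa>) (\<lambda>x. (f \<circ> chart_inv \<kappa>) x + (h \<circ> chart_inv \<kappa>) x)"
    using assms(2,3) \<kappa> chart_on_open_image[OF smooth_manifold_chart_on[OF assms(1) \<kappa>]]
    by (intro smooth_on_add) (simp_all add: smooth_fun_def chart_smooth_def o_def)
  then show "smooth_on (chart_map \<kappa> ` chart_dom \<kappa>) ((\<lambda>p. f p + h p) \<circ> chart_inv \<kappa>)"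
    by (simp add: o_def)
qed

lemma smooth_fun_uminus:
  assumes "smooth_manifold M A" "smooth_fun A f"
  shows "smooth_fun A (\<lambda>p. - f p)"
  unfolding smooth_fun_def chart_smooth_def
proof
  fix \<kappa> assume \<kappa>: "\<kappa> \<in> A"
  have "smooth_on (chart_map \<kappa> ` chart_dom \<kappa>) (\<lambda>x. - (f \<circ> chart_inv \<kappa>) x)"
    using assms(2) \<kappa> chart_on_open_image[OF smooth_manifold_chart_on[OF assms(1) \<kappa>]]
    by (intro smooth_on_bounded_linear[OF bounded_linear_minus[OF bounded_linear_ident]])
      (simp_all add: smooth_fun_def chart_smooth_def o_def)
  then show "smooth_on (chart_map \<kappa> ` chart_dom \<kappa>) ((\<lambda>p. - f p) \<circ> chart_inv \<kappa>)"
    by (simp add: o_def)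
qed

lemma equiv_conformal_rel:
  assumes M: "smooth_manifold M A"
  shows "equiv (riemannian_metrics A) (conformal_rel A)"
proof (rule equivI)
  show "conformal_rel A \<subseteq> riemannian_metrics A \<times> riemannian_metrics A"
    by (auto simp: conformal_rel_def)
  have "smooth_fun A (\<lambda>_. 0)" "rescaled A (\<lambda>_. 0) g g" for g
    by (simp_all add: smooth_fun_def chart_smooth_def o_def smooth_on_const rescaled_def)
  then show "refl_on (riemannian_metrics A) (conformal_rel A)"
    unfolding refl_on_def conformal_rel_def by blast
  show "sym (conformal_rel A)"
  proof (rule symI)
    fix g g' assume "(g, g') \<in> conformal_rel A"
    then obtain \<omega> where \<omega>: "g \<in> riemannian_metrics A" "g' \<in> riemannian_metrics A" "smooth_fun A \<omega>" "rescaled A \<omega> g g'"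
      by (auto simp: conformal_rel_def)
    have "rescaled A (\<lambda>p. - \<omega> p) g' g"
      using \<omega>(4) by (simp add: rescaled_def exp_minus)
    then show "(g', g) \<in> conformal_rel A"
      using \<omega> smooth_fun_uminus[OF M \<omega>(3)] unfolding conformal_rel_def by blast
  qed
  show "trans (conformal_rel A)"
  proof (rule transI)
    fix g g' g'' assume "(g, g') \<in> conformal_rel A" "(g', g'') \<in> conformal_rel A"
    then obtain \<omega> \<omega>' where \<omega>: "g \<in> riemannian_metrics A" "g'' \<in> riemannian_metrics A"
      "smooth_fun A \<omega>" "rescaled A \<omega> g g'" "smooth_fun A \<omega>'" "rescaled A \<omega>' g' g''"
      by (auto simp: conformal_rel_def)
    have "rescaled A (\<lambda>p. \<omega> p + \<omega>' p) g g''"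
      using \<omega>(4,6) by (simp add: rescaled_def exp_add[symmetric] algebra_simps)
    then show "(g, g'') \<in> conformal_rel A"
      using \<omega>(1,2) smooth_fun_add[OF M \<omega>(3,5)] unfolding conformal_rel_def by blast
  qed
qed

text \<open>
  If \<open>g = exp (2 * \<omega>) *\<^sub>R g0\<close>, then the pullbacks are related by the restriction of \<open>\<omega>\<close>. So all
  pullbacks of metrics of one class lie in the class of a single one.
\<close>

lemma (in immersed_atlas) induced_class:
  assumes c: "c \<in> riemannian_metrics A // conformal_rel A"
  shows "conformal_rel B `` {\<gamma>. \<exists>g\<in>c. pullback_tensor A B g \<gamma>} \<in> riemannian_metrics B // conformal_rel B"
proof -
  note eqA = equiv_conformal_rel[OF M] and eqB = equiv_conformal_rel[OF N]
  have cR: "c \<subseteq> riemannian_metrics A" using in_quotient_imp_subset[OF eqA c] .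
  obtain g0 where g0: "g0 \<in> c" using in_quotient_imp_non_empty[OF eqA c] by blast
  obtain \<gamma>0 where \<gamma>0: "pullback_tensor A B g0 \<gamma>0" using pullback_exists g0 cR by blast
  have R0: "\<gamma>0 \<in> riemannian_metrics B" using pullback_riemannian[OF _ \<gamma>0] g0 cR by blast
  have rel: "(\<gamma>0, \<gamma>) \<in> conformal_rel B" if g: "g \<in> c" and \<gamma>: "pullback_tensor A B g \<gamma>" for g \<gamma>
  proof -
    have "(g0, g) \<in> conformal_rel A" using in_quotient_imp_in_rel[OF eqA c] g0 g by blast
    then obtain \<omega> where \<omega>: "smooth_fun A \<omega>" "rescaled A \<omega> g0 g" by (auto simp: conformal_rel_def)
    have "rescaled B \<omega> \<gamma>0 \<gamma>"
      unfolding rescaled_def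
    proof (intro ballI)
      fix \<psi> p assume \<psi>: "\<psi> \<in> B" "p \<in> chart_dom \<psi>"
      obtain \<kappa> where \<kappa>: "\<kappa> \<in> A" "p \<in> chart_dom \<kappa>" using ambient_chart[OF \<psi>] by blast
      have "ip (\<gamma> \<psi> p) v w = ip (exp (2 * \<omega> p) *\<^sub>R \<gamma>0 \<psi> p) v w" for v w
        using \<omega>(2) \<kappa> pullback_ip[OF \<gamma> \<kappa>(1) \<psi>(1) \<kappa>(2) \<psi>(2)] pullback_ip[OF \<gamma>0 \<kappa>(1) \<psi>(1) \<kappa>(2) \<psi>(2)]
        by (simp add: rescaled_def ip_scaleR_matrix)
      then have "\<gamma> \<psi> p $ i $ j = (exp (2 * \<omega> p) *\<^sub>R \<gamma>0 \<psi> p) $ i $ j" for i j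
        unfolding ip_axis[symmetric] .
      then show "\<gamma> \<psi> p = exp (2 * \<omega> p) *\<^sub>R \<gamma>0 \<psi> p" by (simp add: vec_eq_iff)
    qed
    then show ?thesis
      using R0 pullback_riemannian[OF _ \<gamma>] g cR smooth_fun_restrict[OF \<omega>(1)]
      unfolding conformal_rel_def by blast
  qed
  have "conformal_rel B `` {\<gamma>. \<exists>g\<in>c. pullback_tensor A B g \<gamma>} = conformal_rel B `` {\<gamma>0}"
  proof (intro equalityI subsetI)
    fix \<gamma>' assume "\<gamma>' \<in> conformal_rel B `` {\<gamma>. \<exists>g\<in>c. pullback_tensor A B g \<gamma>}"
    then obtain g \<gamma> where "g \<in> c" "pullback_tensor A B g \<gamma>" "(\<gamma>, \<gamma>') \<in> conformal_rel B" by blast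
    then show "\<gamma>' \<in> conformal_rel B `` {\<gamma>0}"
      using rel[of g \<gamma>] eqB unfolding equiv_def by (blast dest: transD)
  qed (use g0 \<gamma>0 in blast)
  then show ?thesis using quotientI[OF R0, of "conformal_rel B"] by (simp only:)
qed

section \<open>The Levi-Civita connection in Koszul form\<close>

lemma has_derivative_ip:
  assumes "\<And>i j. ((\<lambda>x. G x $ i $ j) has_derivative (\<lambda>v. G' v $ i $ j)) (at x)"
    and "(Y has_derivative Y') (at x)" "(Z has_derivative Z') (at x)"
  shows "((\<lambda>x. ip (G x) (Y x) (Z x)) has_derivative
    (\<lambda>v. ip (G' v) (Y x) (Z x) + ip (G x) (Y' v) (Z x) + ip (G x) (Y x) (Z' v))) (at x)"
proof -
  have Y: "((\<lambda>x. Y x $ i) has_derivative (\<lambda>v. Y' v $ i)) (at x)" for i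
    by (rule bounded_linear.has_derivative[OF bounded_linear_vec_nth assms(2)])
  have Z: "((\<lambda>x. Z x $ i) has_derivative (\<lambda>v. Z' v $ i)) (at x)" for i
    by (rule bounded_linear.has_derivative[OF bounded_linear_vec_nth assms(3)])
  have "((\<lambda>x. \<Sum>a\<in>UNIV. \<Sum>b\<in>UNIV. G x $ a $ b * Y x $ a * Z x $ b) has_derivative
    (\<lambda>v. \<Sum>a\<in>UNIV. \<Sum>b\<in>UNIV. G x $ a $ b * Y x $ a * Z' v $ b +
        (G x $ a $ b * Y' v $ a + G' v $ a $ b * Y x $ a) * Z x $ b)) (at x)"
    by (intro has_derivative_sum has_derivative_mult assms(1) Y Z)
  moreover have "(\<lambda>v. \<Sum>a\<in>UNIV. \<Sum>b\<in>UNIV. G x $ a $ b * Y x $ a * Z' v $ b +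
        (G x $ a $ b * Y' v $ a + G' v $ a $ b * Y x $ a) * Z x $ b) =
      (\<lambda>v. ip (G' v) (Y x) (Z x) + ip (G x) (Y' v) (Z x) + ip (G x) (Y x) (Z' v))"
    by (simp add: ip_def sum.distrib[symmetric] algebra_simps)
  ultimately show ?thesis by (simp add: ip_def)
qed

text \<open>
  The directional derivative of the components of \<open>g\<close>. It is not a tensor, but it lets the
  Christoffel symbols be treated as a trilinear form on coordinate vectors.
\<close>

definition metric_deriv :: "('a, 'n::finite) metric \<Rightarrow> ('a, 'n) chart \<Rightarrow> 'a \<Rightarrow> real^'n \<Rightarrow> real^'n^'n" where
  "metric_deriv g \<kappa> p v = (\<chi> i j. chart_deriv \<kappa> (\<lambda>q. g \<kappa> q $ i $ j) p v)"

text \<open>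
  The Christoffel symbols of the first kind: \<open>koszul g \<kappa> p w v u\<close> is the inner product of \<open>w\<close> with
  \<open>\<nabla>\<^sub>v u\<close> at \<open>p\<close>, for a field \<open>u\<close> with constant components.
\<close>

definition koszul :: "('a, 'n::finite) metric \<Rightarrow> ('a, 'n) chart \<Rightarrow> 'a \<Rightarrow> real^'n \<Rightarrow> real^'n \<Rightarrow> real^'n \<Rightarrow> real" where
  "koszul g \<kappa> p w v u = (ip (metric_deriv g \<kappa> p v) w u + ip (metric_deriv g \<kappa> p u) w v
     - ip (metric_deriv g \<kappa> p w) v u) / 2"

text \<open>
  The properties of a Riemannian metric in one chart, so that the same computations apply to an
  ambient metric and to the metric that it induces on a submanifold.
\<close>

locale metric_at =
  fixes g :: "('a, 'n::finite) metric" and \<kappa> :: "('a, 'n) chart" and p :: 'a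
  assumes dom: "p \<in> chart_dom \<kappa>" and inj: "inj_on (chart_map \<kappa>) (chart_dom \<kappa>)"
    and op: "open (chart_map \<kappa> ` chart_dom \<kappa>)"
    and smooth: "chart_smooth \<kappa> (\<lambda>q. g \<kappa> q $ i $ j)"
    and sym: "q \<in> chart_dom \<kappa> \<Longrightarrow> g \<kappa> q $ i $ j = g \<kappa> q $ j $ i"
    and pos: "q \<in> chart_dom \<kappa> \<Longrightarrow> v \<noteq> 0 \<Longrightarrow> ip (g \<kappa> q) v v > 0"
begin

lemma metric_has_derivative:
  "((\<lambda>x. g \<kappa> (chart_inv \<kappa> x) $ i $ j) has_derivative (\<lambda>v. metric_deriv g \<kappa> p v $ i $ j)) (at (chart_map \<kappa> p))"
  using chart_smooth_has_derivative[OF smooth dom, of i j] by (simp add: metric_deriv_def o_def)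

lemma linear_metric_deriv: "linear (metric_deriv g \<kappa> p)"
proof (rule linearI)
  have lin: "linear (chart_deriv \<kappa> (\<lambda>q. g \<kappa> q $ i $ j) p)" for i j
    using chart_smooth_has_derivative[OF smooth dom] has_derivative_linear by blast
  show "metric_deriv g \<kappa> p (u + v) = metric_deriv g \<kappa> p u + metric_deriv g \<kappa> p v" for u v
    by (simp add: metric_deriv_def vec_eq_iff linear_add[OF lin])
  show "metric_deriv g \<kappa> p (r *\<^sub>R v) = r *\<^sub>R metric_deriv g \<kappa> p v" for r v
    by (simp add: metric_deriv_def vec_eq_iff linear_cmul[OF lin])
qed

lemma metric_deriv_sym: "metric_deriv g \<kappa> p v $ i $ j = metric_deriv g \<kappa> p v $ j $ i"
proof -
  have "chart_deriv \<kappa> (\<lambda>q. g \<kappa> q $ i $ j) p = chart_deriv \<kappa> (\<lambda>q. g \<kappa> q $ j $ i) p"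
    unfolding chart_deriv_def
  proof (rule frechet_derivative_cong_open[OF op])
    show "((\<lambda>q. g \<kappa> q $ i $ j) \<circ> chart_inv \<kappa>) y = ((\<lambda>q. g \<kappa> q $ j $ i) \<circ> chart_inv \<kappa>) y"
      if "y \<in> chart_map \<kappa> ` chart_dom \<kappa>" for y
      using sym[OF chart_inv_in[OF that]] by simp
  qed (use dom in blast)
  then show ?thesis by (simp add: metric_deriv_def)
qed

lemma linear_ip_metric_deriv: "linear (\<lambda>v. ip (metric_deriv g \<kappa> p v) w u)"
  by (rule linearI) (simp_all add: ip_def linear_add[OF linear_metric_deriv] linear_cmul[OF linear_metric_deriv]
      sum.distrib[symmetric] sum_distrib_left algebra_simps)

lemma koszul_linear: "linear (\<lambda>w. koszul g \<kappa> p w v u)" "linear (\<lambda>v. koszul g \<kappa> p w v u)"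
    "linear (\<lambda>u. koszul g \<kappa> p w v u)"
  by (rule linearI; simp add: koszul_def linear_add[OF linear_ip_metric_deriv] linear_cmul[OF linear_ip_metric_deriv]
      linear_add[OF linear_ip_left] linear_cmul[OF linear_ip_left] linear_add[OF linear_ip_right]
      linear_cmul[OF linear_ip_right] add_divide_distrib diff_divide_distrib algebra_simps)+

lemma metric_inverse: "q \<in> chart_dom \<kappa> \<Longrightarrow> g \<kappa> q *v (matrix_inv (g \<kappa> q) *v x) = x"
proof -
  assume q: "q \<in> chart_dom \<kappa>"
  have "\<exists>B. g \<kappa> q ** B = mat 1 \<and> B ** g \<kappa> q = mat 1"
    using pos_def_invertible[OF pos[OF q]] by (simp add: invertible_def)
  then have "g \<kappa> q ** matrix_inv (g \<kappa> q) = mat 1"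
    unfolding matrix_inv_def by (rule someI2_ex) simp
  then show ?thesis by (simp add: matrix_vector_mul_assoc)
qed

lemma christoffel_koszul:
  "christoffel g \<kappa> a b c p = (matrix_inv (g \<kappa> p) *v (\<chi> e. koszul g \<kappa> p (axis e 1) (axis b 1) (axis c 1))) $ a"
proof -
  have "pd \<kappa> i (\<lambda>q. g \<kappa> q $ j $ l) p = ip (metric_deriv g \<kappa> p (axis i 1)) (axis j 1) (axis l 1)" for i j l
    by (simp add: ip_axis metric_deriv_def pd_chart_deriv)
  then show ?thesis
    by (simp add: christoffel_def koszul_def matrix_vector_mult_def sum_divide_distrib)
qed

lemma christoffel_sum:
  "(\<chi> a. \<Sum>b\<in>UNIV. v $ b * (\<Sum>c\<in>UNIV. christoffel g \<kappa> a b c p * u $ c)) =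
    matrix_inv (g \<kappa> p) *v (\<chi> e. koszul g \<kappa> p (axis e 1) v u)"
proof -
  let ?K = "\<lambda>v u. \<chi> e. koszul g \<kappa> p (axis e 1) v u"
  have lin1: "linear (\<lambda>v. matrix_inv (g \<kappa> p) *v ?K v u)" for u
    by (rule linearI) (simp_all add: linear_add[OF koszul_linear(2)] linear_cmul[OF koszul_linear(2)]
      matrix_vector_mult_def vec_eq_iff sum.distrib[symmetric] sum_distrib_left algebra_simps)
  have lin2: "linear (\<lambda>u. matrix_inv (g \<kappa> p) *v ?K v u)" for v
    by (rule linearI) (simp_all add: linear_add[OF koszul_linear(3)] linear_cmul[OF koszul_linear(3)]
      matrix_vector_mult_def vec_eq_iff sum.distrib[symmetric] sum_distrib_left algebra_simps)
  have "matrix_inv (g \<kappa> p) *v ?K v u =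
      (\<Sum>b\<in>UNIV. v $ b *\<^sub>R (\<Sum>c\<in>UNIV. u $ c *\<^sub>R (matrix_inv (g \<kappa> p) *v ?K (axis b 1) (axis c 1))))"
    unfolding linear_eq_sum_axis[OF lin1[of u], of v] linear_eq_sum_axis[OF lin2, of _ u] by (rule refl)
  then show ?thesis
    by (simp add: vec_eq_iff christoffel_koszul mult.commute)
qed

lemma cov_deriv_sum:
  assumes Y: "(Y \<circ> chart_inv \<kappa> has_derivative Y') (at (chart_map \<kappa> p))"
  shows "(\<Sum>b\<in>UNIV. v $ b *\<^sub>R cov_deriv g \<kappa> b Y p) =
    Y' v + matrix_inv (g \<kappa> p) *v (\<chi> e. koszul g \<kappa> p (axis e 1) v (Y p))"
proof -
  have "cov_deriv g \<kappa> b Y p = Y' (axis b 1) + (\<chi> a. \<Sum>c\<in>UNIV. christoffel g \<kappa> a b c p * Y p $ c)" for b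
    by (simp add: cov_deriv_def pd_component[OF Y] vec_eq_iff)
  then have "(\<Sum>b\<in>UNIV. v $ b *\<^sub>R cov_deriv g \<kappa> b Y p) = (\<Sum>b\<in>UNIV. v $ b *\<^sub>R Y' (axis b 1)) +
      (\<Sum>b\<in>UNIV. v $ b *\<^sub>R (\<chi> a. \<Sum>c\<in>UNIV. christoffel g \<kappa> a b c p * Y p $ c))"
    by (simp add: scaleR_add_right sum.distrib)
  also have "(\<Sum>b\<in>UNIV. v $ b *\<^sub>R Y' (axis b 1)) = Y' v"
    using linear_eq_sum_axis[OF has_derivative_linear[OF Y], of v] by simp
  also have "(\<Sum>b\<in>UNIV. v $ b *\<^sub>R (\<chi> a. \<Sum>c\<in>UNIV. christoffel g \<kappa> a b c p * Y p $ c)) =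
      (\<chi> a. \<Sum>b\<in>UNIV. v $ b * (\<Sum>c\<in>UNIV. christoffel g \<kappa> a b c p * Y p $ c))"
    by (simp add: vec_eq_iff)
  finally show ?thesis unfolding christoffel_sum .
qed

text \<open>
  Pairing with \<open>w\<close> removes the inverse of the metric from the Christoffel symbols. From here on
  covariant derivatives appear only in this form.
\<close>

lemma cov_deriv_koszul:
  assumes Y: "(Y \<circ> chart_inv \<kappa> has_derivative Y') (at (chart_map \<kappa> p))"
  shows "ip (g \<kappa> p) w (\<Sum>b\<in>UNIV. v $ b *\<^sub>R cov_deriv g \<kappa> b Y p) = ip (g \<kappa> p) w (Y' v) + koszul g \<kappa> p w v (Y p)"
proof -
  have "w \<bullet> (\<chi> e. koszul g \<kappa> p (axis e 1) v (Y p)) = koszul g \<kappa> p w v (Y p)"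
    unfolding linear_eq_sum_axis[OF koszul_linear(1)[of v "Y p"], of w] by (simp add: inner_vec_def)
  then show ?thesis
    unfolding cov_deriv_sum[OF Y] linear_add[OF linear_ip_right]
    by (simp add: ip_eq_inner metric_inverse[OF dom])
qed

end

lemma riemannian_metric_at:
  assumes "smooth_manifold M A" "g \<in> riemannian_metrics A" "\<kappa> \<in> A" "p \<in> chart_dom \<kappa>"
  shows "metric_at g \<kappa> p"
proof
  note on = smooth_manifold_chart_on[OF assms(1,3)]
  show "inj_on (chart_map \<kappa>) (chart_dom \<kappa>)" "open (chart_map \<kappa> ` chart_dom \<kappa>)"
    using chart_on_inj[OF on] chart_on_open_image[OF on] .
  show "chart_smooth \<kappa> (\<lambda>q. g \<kappa> q $ i $ j)" for i j
    by (rule riemannian_metricsD(1)[OF assms(2,3)])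
  show "g \<kappa> q $ i $ j = g \<kappa> q $ j $ i" if "q \<in> chart_dom \<kappa>" for q i j
    by (rule riemannian_metricsD(2)[OF assms(2,3) that])
  show "0 < ip (g \<kappa> q) v v" if "q \<in> chart_dom \<kappa>" "v \<noteq> 0" for q v
    by (rule riemannian_metricsD(3)[OF assms(2,3) that])
qed (rule assms(4))

text \<open>
  The law for the Levi-Civita connection under a conformal change. Of the correction terms only the
  last survives when \<open>w\<close> is normal and \<open>v\<close>, \<open>u\<close> are tangent to a hypersurface, and it is
  proportional to the metric: this is the conformal invariance of umbilicity.
\<close>

lemma koszul_rescaled:
  assumes g: "metric_at g \<kappa> p" and \<omega>: "chart_smooth \<kappa> \<omega>"
    and res: "\<And>q. q \<in> chart_dom \<kappa> \<Longrightarrow> g' \<kappa> q = exp (2 * \<omega> q) *\<^sub>R g \<kappa> q"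
  shows "koszul g' \<kappa> p w v u = exp (2 * \<omega> p) * (koszul g \<kappa> p w v u +
    chart_deriv \<kappa> \<omega> p v * ip (g \<kappa> p) w u + chart_deriv \<kappa> \<omega> p u * ip (g \<kappa> p) w v
    - chart_deriv \<kappa> \<omega> p w * ip (g \<kappa> p) v u)"
proof -
  interpret metric_at g \<kappa> p by (rule g)
  have pinv: "chart_inv \<kappa> (chart_map \<kappa> p) = p" by (rule chart_inv_map[OF inj dom])
  have "metric_deriv g' \<kappa> p v $ i $ j =
      exp (2 * \<omega> p) * (metric_deriv g \<kappa> p v $ i $ j + 2 * chart_deriv \<kappa> \<omega> p v * g \<kappa> p $ i $ j)" for v i j
  proof -
    have 1: "((\<lambda>x. \<omega> (chart_inv \<kappa> x)) has_derivative chart_deriv \<kappa> \<omega> p) (at (chart_map \<kappa> p))"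
      using chart_smooth_has_derivative[OF \<omega> dom] by (simp add: o_def)
    have "((\<lambda>x. exp (2 * \<omega> (chart_inv \<kappa> x)) * g \<kappa> (chart_inv \<kappa> x) $ i $ j) has_derivative
        (\<lambda>v. exp (2 * \<omega> p) * (metric_deriv g \<kappa> p v $ i $ j + 2 * chart_deriv \<kappa> \<omega> p v * g \<kappa> p $ i $ j)))
      (at (chart_map \<kappa> p))"
      by (rule derivative_eq_intros refl 1 metric_has_derivative[of i j])+ (simp add: pinv algebra_simps)
    then have "((\<lambda>q. g' \<kappa> q $ i $ j) \<circ> chart_inv \<kappa> has_derivative
        (\<lambda>v. exp (2 * \<omega> p) * (metric_deriv g \<kappa> p v $ i $ j + 2 * chart_deriv \<kappa> \<omega> p v * g \<kappa> p $ i $ j)))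
      (at (chart_map \<kappa> p))"
    proof (rule has_derivative_transform_within_open[OF _ op])
      show "exp (2 * \<omega> (chart_inv \<kappa> x)) * g \<kappa> (chart_inv \<kappa> x) $ i $ j = ((\<lambda>q. g' \<kappa> q $ i $ j) \<circ> chart_inv \<kappa>) x"
        if "x \<in> chart_map \<kappa> ` chart_dom \<kappa>" for x
        using res[OF chart_inv_in[OF that]] by simp
    qed (use dom in blast)
    from fun_cong[OF frechet_derivative_at[OF this], of v] show ?thesis
      by (simp add: metric_deriv_def chart_deriv_def)
  qed
  then have "metric_deriv g' \<kappa> p v = exp (2 * \<omega> p) *\<^sub>R (metric_deriv g \<kappa> p v + (2 * chart_deriv \<kappa> \<omega> p v) *\<^sub>R g \<kappa> p)" for v
    by (simp add: vec_eq_iff)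
  moreover have "ip (A + B) x y = ip A x y + ip B x y" for A B :: "real^'b^'b" and x y
    by (simp add: ip_def sum.distrib[symmetric] algebra_simps)
  ultimately have "ip (metric_deriv g' \<kappa> p v) x y =
      exp (2 * \<omega> p) * (ip (metric_deriv g \<kappa> p v) x y + 2 * chart_deriv \<kappa> \<omega> p v * ip (g \<kappa> p) x y)" for v x y
    by (simp only: ip_scaleR_matrix)
  then show ?thesis
    unfolding koszul_def by (simp add: field_simps)
qed

section \<open>Parallel tractors\<close>

text \<open>
  A parallel tractor seen in one scale and one chart. Its first slot says that the differential of
  the scale \<open>\<sigma>\<close> is \<open>\<mu>\<close>; its second slot is an equation for the Hessian of \<open>\<sigma>\<close>.
\<close>

locale parallel_tractor_at = metric_at g \<kappa> p
  for g :: "('a, 'n::finite) metric" and \<kappa> p +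
  fixes A :: "('a, 'n) chart set" and c and K :: "('a, 'n) tractor"
  assumes parallel: "parallel_tractor A c K" and gc: "g \<in> c" and \<kappa>: "\<kappa> \<in> A"
begin

abbreviation "mu_up q \<equiv> matrix_inv (g \<kappa> q) *v tmu K g \<kappa> q"

lemma sigma_smooth: "chart_smooth \<kappa> (tsigma K g)" and mu_smooth: "chart_smooth \<kappa> (tmu K g \<kappa>)"
proof -
  have "smooth_fun A (tsigma K g)" "smooth_covector_field A (tmu K g)"
    using parallel gc unfolding parallel_tractor_def tractor_section_def by blast+
  then show "chart_smooth \<kappa> (tsigma K g)" "chart_smooth \<kappa> (tmu K g \<kappa>)"
    using \<kappa> unfolding smooth_fun_def smooth_covector_field_def by blast+
qed

lemma sigma_deriv: "q \<in> chart_dom \<kappa> \<Longrightarrow> chart_deriv \<kappa> (tsigma K g) q v = tmu K g \<kappa> q \<bullet> v"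
proof -
  assume q: "q \<in> chart_dom \<kappa>"
  have "tractor_connection g \<kappa> a K q = (0, 0, 0)" for a
    using parallel gc \<kappa> q unfolding parallel_tractor_def by blast
  then have "pd \<kappa> a (tsigma K g) q = tmu K g \<kappa> q $ a" for a
    unfolding tractor_connection_def Let_def by simp
  moreover have "linear (chart_deriv \<kappa> (tsigma K g) q)"
    using chart_smooth_has_derivative[OF sigma_smooth q] has_derivative_linear by blast
  ultimately show ?thesis
    using linear_eq_sum_axis[of "chart_deriv \<kappa> (tsigma K g) q" v]
    by (simp add: pd_chart_deriv inner_vec_def mult.commute)
qed

text \<open>
  The raised field \<open>\<mu>\<^sup>b\<close> solves \<open>g\<^sub>b\<^sub>c \<mu>\<^sup>c = \<mu>\<^sub>b\<close>, so Cramer's rule gives its smoothness.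
\<close>

lemma mu_up_smooth: "chart_smooth \<kappa> mu_up"
  unfolding chart_smooth_def smooth_on_def
proof
  fix k
  let ?S = "chart_map \<kappa> ` chart_dom \<kappa>"
  let ?G = "\<lambda>x. g \<kappa> (chart_inv \<kappa> x)" and ?m = "\<lambda>x. tmu K g \<kappa> (chart_inv \<kappa> x)"
  have "Ck_on k ?S (mu_up \<circ> chart_inv \<kappa>)"
  proof (rule Ck_on_solution[where A = ?G and b = ?m, OF op])
    show "Ck_on k ?S (\<lambda>x. ?G x $ i $ j)" for i j
      using smooth[of i j] by (simp add: chart_smooth_def smooth_on_def o_def)
    show "Ck_on k ?S (\<lambda>x. ?m x $ i)" for i
      using mu_smooth by (intro Ck_on_bounded_linear[OF bounded_linear_vec_nth op]) (simp add: chart_smooth_def smooth_on_def o_def)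
    fix x assume "x \<in> ?S"
    then have q: "chart_inv \<kappa> x \<in> chart_dom \<kappa>" by (rule chart_inv_in)
    show "det (?G x) \<noteq> 0" using pos_def_invertible[OF pos[OF q]] by (simp add: invertible_det_nz)
    show "?G x *v (mu_up \<circ> chart_inv \<kappa>) x = ?m x" using metric_inverse[OF q] by simp
  qed
  then show "Ck_on k ?S (mu_up \<circ> chart_inv \<kappa>)" .
qed

lemma mu_eq_ip: "q \<in> chart_dom \<kappa> \<Longrightarrow> tmu K g \<kappa> q \<bullet> w = ip (g \<kappa> q) w (mu_up q)"
  by (simp add: ip_eq_inner metric_inverse inner_commute)

text \<open>
  At a zero of \<open>\<sigma>\<close> the Schouten term of the tractor connection drops out, and what remains is
  \<open>Hess \<sigma> = - \<rho> g\<close>. Here the Hessian is written out as the second coordinate derivative of \<open>\<sigma>\<close>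
  minus the derivative of \<open>\<sigma>\<close> along the connection term.
\<close>

lemma mu_deriv:
  assumes zero: "tsigma K g p = 0"
  shows "chart_deriv \<kappa> (tmu K g \<kappa>) p v \<bullet> w = koszul g \<kappa> p (mu_up p) v w - trho K g p * ip (g \<kappa> p) v w"
proof -
  let ?x = "chart_map \<kappa> p"
  have pinv: "chart_inv \<kappa> (chart_map \<kappa> p) = p" by (rule chart_inv_map[OF inj dom])
  define Y' where "Y' = chart_deriv \<kappa> mu_up p"
  have Y: "(mu_up \<circ> chart_inv \<kappa> has_derivative Y') (at ?x)"
    unfolding Y'_def by (rule chart_smooth_has_derivative[OF mu_up_smooth dom])
  have "tractor_connection g \<kappa> a K p = (0, 0, 0)" for a
    using parallel gc \<kappa> dom unfolding parallel_tractor_def by blast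
  then have "cov_deriv g \<kappa> b mu_up p + trho K g p *\<^sub>R axis b 1 = 0" for b
    unfolding tractor_connection_def Let_def by (simp add: zero)
  then have cov: "cov_deriv g \<kappa> b mu_up p = - (trho K g p *\<^sub>R axis b 1)" for b
    by (simp add: eq_neg_iff_add_eq_0)
  have "(\<Sum>b\<in>UNIV. v $ b *\<^sub>R cov_deriv g \<kappa> b mu_up p) = - trho K g p *\<^sub>R (\<Sum>b\<in>UNIV. v $ b *\<^sub>R axis b 1)"
    unfolding cov by (simp add: scaleR_sum_right sum_negf mult.commute)
  also have "(\<Sum>b\<in>UNIV. v $ b *\<^sub>R axis b 1) = v"
    by (simp add: basis_expansion flip: scalar_mult_eq_scaleR)
  finally have "- trho K g p * ip (g \<kappa> p) w v = ip (g \<kappa> p) w (Y' v) + koszul g \<kappa> p w v (mu_up p)"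
    using cov_deriv_koszul[OF Y, of w v] by (simp only: linear_cmul[OF linear_ip_right] real_scaleR_def)
  moreover have "chart_deriv \<kappa> (tmu K g \<kappa>) p v \<bullet> w = ip (metric_deriv g \<kappa> p v) w (mu_up p) + ip (g \<kappa> p) w (Y' v)"
  proof -
    have "((\<lambda>x. ip (g \<kappa> (chart_inv \<kappa> x)) w ((mu_up \<circ> chart_inv \<kappa>) x)) has_derivative
        (\<lambda>v. ip (metric_deriv g \<kappa> p v) w ((mu_up \<circ> chart_inv \<kappa>) ?x) + ip (g \<kappa> (chart_inv \<kappa> ?x)) 0 ((mu_up \<circ> chart_inv \<kappa>) ?x)
          + ip (g \<kappa> (chart_inv \<kappa> ?x)) w (Y' v))) (at ?x)"
      by (rule has_derivative_ip[OF metric_has_derivative has_derivative_const Y])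
    then have 1: "((\<lambda>x. ip (g \<kappa> (chart_inv \<kappa> x)) w ((mu_up \<circ> chart_inv \<kappa>) x)) has_derivative
        (\<lambda>v. ip (metric_deriv g \<kappa> p v) w (mu_up p) + ip (g \<kappa> p) w (Y' v))) (at ?x)"
      by (simp add: pinv ip_zero)
    have "((\<lambda>x. (tmu K g \<kappa> \<circ> chart_inv \<kappa>) x \<bullet> w) has_derivative
        (\<lambda>v. ip (metric_deriv g \<kappa> p v) w (mu_up p) + ip (g \<kappa> p) w (Y' v))) (at ?x)"
    proof (rule has_derivative_transform_within_open[OF 1 op])
      show "?x \<in> chart_map \<kappa> ` chart_dom \<kappa>" using dom by simp
      show "ip (g \<kappa> (chart_inv \<kappa> x)) w ((mu_up \<circ> chart_inv \<kappa>) x) = (tmu K g \<kappa> \<circ> chart_inv \<kappa>) x \<bullet> w"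
        if "x \<in> chart_map \<kappa> ` chart_dom \<kappa>" for x
        using mu_eq_ip[OF chart_inv_in[OF that]] by simp
    qed
    moreover have "((\<lambda>x. (tmu K g \<kappa> \<circ> chart_inv \<kappa>) x \<bullet> w) has_derivative
        (\<lambda>v. chart_deriv \<kappa> (tmu K g \<kappa>) p v \<bullet> w)) (at ?x)"
      by (rule has_derivative_inner_left[OF chart_smooth_has_derivative[OF mu_smooth dom]])
    ultimately show ?thesis by (rule fun_cong[OF has_derivative_unique, symmetric])
  qed
  ultimately show ?thesis
    using ip_commute[OF metric_deriv_sym, of v w "mu_up p"] ip_commute[OF metric_deriv_sym, of "mu_up p" v w]
      ip_commute[OF metric_deriv_sym, of w v "mu_up p"] ip_commute[OF sym[OF dom], of v w]
    by (simp add: koszul_def field_simps)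
qed

end

section \<open>Second derivatives of maps\<close>

lemma second_derivative_has_derivative:
  assumes "open S" "smooth_on S \<Phi>" "x \<in> S"
  shows "((\<lambda>y. frechet_derivative \<Phi> (at y) w) has_derivative
    (\<lambda>v. frechet_derivative (\<lambda>y. frechet_derivative \<Phi> (at y) w) (at x) v)) (at x)"
  by (rule smooth_on_has_derivative[OF smooth_on_derivative[OF assms(1,2)] assms(3)])

lemma second_derivative_symmetric_vec:
  fixes \<Phi> :: "real^'m \<Rightarrow> real^'n"
  assumes "open S" "smooth_on S \<Phi>" "x \<in> S"
  shows "frechet_derivative (\<lambda>y. frechet_derivative \<Phi> (at y) w) (at x) v =
    frechet_derivative (\<lambda>y. frechet_derivative \<Phi> (at y) v) (at x) w"
proof -
  have comp: "frechet_derivative (\<lambda>y. frechet_derivative \<Phi> (at y) w) (at x) v $ a =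
      frechet_derivative (\<lambda>y. frechet_derivative (\<lambda>y. \<Phi> y $ a) (at y) w) (at x) v" for v w a
  proof -
    have 1: "frechet_derivative (\<lambda>y. \<Phi> y $ a) (at y) w = frechet_derivative \<Phi> (at y) w $ a" if "y \<in> S" for y
      using frechet_derivative_at[OF bounded_linear.has_derivative[OF bounded_linear_vec_nth
            smooth_on_has_derivative[OF assms(2) that]], of a, symmetric] by simp
    have "frechet_derivative (\<lambda>y. frechet_derivative (\<lambda>y. \<Phi> y $ a) (at y) w) (at x) =
        frechet_derivative (\<lambda>y. frechet_derivative \<Phi> (at y) w $ a) (at x)"
      by (rule frechet_derivative_cong_open[OF assms(1,3) 1])
    also have "\<dots> = (\<lambda>v. frechet_derivative (\<lambda>y. frechet_derivative \<Phi> (at y) w) (at x) v $ a)"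
      by (rule frechet_derivative_at[OF bounded_linear.has_derivative[OF bounded_linear_vec_nth
            second_derivative_has_derivative[OF assms]], symmetric])
    finally show ?thesis by simp
  qed
  have "Ck_on 2 S (\<lambda>y. \<Phi> y $ a)" for a
    by (rule Ck_on_bounded_linear[OF bounded_linear_vec_nth assms(1) smooth_onD[OF assms(2)]])
  from second_derivative_symmetric[OF assms(1,3) this] show ?thesis
    unfolding vec_eq_iff comp by blast
qed

text \<open>
  The product rule for a differential that is evaluated on a vector field. Expanding the
  field in the standard basis reduces it to scalar coefficients times partial derivatives.
\<close>

lemma derivative_of_vector_field_has_derivative:
  fixes \<Phi> :: "real^'m \<Rightarrow> 'b::real_normed_vector"
  assumes "open S" "smooth_on S \<Phi>" "x \<in> S" "(Y has_derivative Y') (at x)"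
  shows "((\<lambda>y. frechet_derivative \<Phi> (at y) (Y y)) has_derivative
    (\<lambda>v. frechet_derivative \<Phi> (at x) (Y' v) + frechet_derivative (\<lambda>y. frechet_derivative \<Phi> (at y) (Y x)) (at x) v)) (at x)"
proof -
  let ?D = "\<lambda>y. frechet_derivative \<Phi> (at y)"
  let ?H = "\<lambda>w v. frechet_derivative (\<lambda>y. ?D y w) (at x) v"
  have lin: "?D y w = (\<Sum>i\<in>UNIV. w $ i *\<^sub>R ?D y (axis i 1))" if "y \<in> S" for y w
    by (rule linear_eq_sum_axis[OF smooth_on_linear_derivative[OF assms(2) that]])
  have d: "((\<lambda>y. ?D y (axis i 1)) has_derivative ?H (axis i 1)) (at x)" for i
    by (rule second_derivative_has_derivative[OF assms(1-3)])
  have Yi: "((\<lambda>y. Y y $ i) has_derivative (\<lambda>v. Y' v $ i)) (at x)" for i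
    by (rule bounded_linear.has_derivative[OF bounded_linear_vec_nth assms(4)])
  have H: "?H w v = (\<Sum>i\<in>UNIV. w $ i *\<^sub>R ?H (axis i 1) v)" for w v
  proof -
    have "((\<lambda>y. \<Sum>i\<in>UNIV. w $ i *\<^sub>R ?D y (axis i 1)) has_derivative (\<lambda>v. \<Sum>i\<in>UNIV. w $ i *\<^sub>R ?H (axis i 1) v)) (at x)"
      by (intro has_derivative_sum has_derivative_scaleR_right d)
    then have "((\<lambda>y. ?D y w) has_derivative (\<lambda>v. \<Sum>i\<in>UNIV. w $ i *\<^sub>R ?H (axis i 1) v)) (at x)"
      by (rule has_derivative_transform_within_open[OF _ assms(1,3)]) (rule lin[symmetric])
    from fun_cong[OF frechet_derivative_at[OF this], of v] show ?thesis by simp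
  qed
  have "((\<lambda>y. \<Sum>i\<in>UNIV. Y y $ i *\<^sub>R ?D y (axis i 1)) has_derivative
      (\<lambda>v. \<Sum>i\<in>UNIV. Y x $ i *\<^sub>R ?H (axis i 1) v + Y' v $ i *\<^sub>R ?D x (axis i 1))) (at x)"
    by (intro has_derivative_sum has_derivative_scaleR d Yi)
  then have "((\<lambda>y. ?D y (Y y)) has_derivative
      (\<lambda>v. \<Sum>i\<in>UNIV. Y x $ i *\<^sub>R ?H (axis i 1) v + Y' v $ i *\<^sub>R ?D x (axis i 1))) (at x)"
    by (rule has_derivative_transform_within_open[OF _ assms(1,3)]) (rule lin[symmetric])
  moreover have "(\<Sum>i\<in>UNIV. Y x $ i *\<^sub>R ?H (axis i 1) v + Y' v $ i *\<^sub>R ?D x (axis i 1)) = ?D x (Y' v) + ?H (Y x) v" for v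
    unfolding sum.distrib H[of "Y x" v] lin[OF assms(3), of "Y' v"] by (rule add.commute)
  ultimately show ?thesis by simp
qed

section \<open>Tangent spaces of level sets\<close>

text \<open>
  A function that vanishes on \<open>S\<close> vanishes along every curve in \<open>S\<close>. This is applied to a defining
  function of \<open>S\<close> and to its derivative along a field that is tangent along \<open>S\<close>.
\<close>

lemma tangent_derivative_zero:
  fixes h :: "'a \<Rightarrow> real"
  assumes inj: "inj_on (chart_map \<psi>) (chart_dom \<psi>)" and X: "X \<in> tangent_space \<psi> S p"
    and h: "(h \<circ> chart_inv \<psi> has_derivative h') (at (chart_map \<psi> p))"
    and zero: "\<And>q. q \<in> S \<Longrightarrow> q \<in> chart_dom \<psi> \<Longrightarrow> h q = 0"
  shows "h' X = 0"
proof -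
  obtain x where x: "x (0::real) = p" "eventually (\<lambda>t. x t \<in> S \<inter> chart_dom \<psi>) (nhds 0)"
    "((chart_map \<psi> \<circ> x) has_vector_derivative X) (at 0)"
    using X unfolding tangent_space_def by blast
  have "((\<lambda>t. (h \<circ> chart_inv \<psi>) ((chart_map \<psi> \<circ> x) t)) has_derivative (\<lambda>t. h' (t *\<^sub>R X))) (at 0)"
    using has_derivative_compose[OF x(3)[unfolded has_vector_derivative_def], of "h \<circ> chart_inv \<psi>" h'] h x(1) by simp
  moreover have "\<forall>\<^sub>F t in at 0. (h \<circ> chart_inv \<psi>) ((chart_map \<psi> \<circ> x) t) = 0"
    unfolding eventually_at_filter using x(2)
    by (rule eventually_mono) (simp add: chart_inv_map[OF inj] zero)
  moreover have "(h \<circ> chart_inv \<psi>) ((chart_map \<psi> \<circ> x) 0) = 0"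
    using eventually_nhds_x_imp_x[OF x(2)] by (simp add: chart_inv_map[OF inj] zero)
  ultimately have "((\<lambda>t. 0) has_derivative (\<lambda>t. h' (t *\<^sub>R X))) (at 0)"
    using has_derivative_transform_eventually[where g = "\<lambda>t. 0"] by fastforce
  from has_derivative_unique[OF this has_derivative_const] have "(\<lambda>t::real. h' (t *\<^sub>R X)) = (\<lambda>t. 0)" .
  from fun_cong[OF this, of 1] show ?thesis by simp
qed

text \<open>
  In a slice chart adapted to \<open>f\<close> the kernel of the differential consists of the vectors with
  vanishing \<open>k\<close>-th component, and these are velocities of straight lines inside the level set.
\<close>

lemma kernel_subset_tangent_space:
  fixes f :: "'a \<Rightarrow> real"
  assumes N: "smooth_manifold N B" and \<psi>: "\<psi> \<in> B" "p \<in> chart_dom \<psi>" and f: "chart_smooth \<psi> f"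
    and k: "pd \<psi> k f p \<noteq> 0" and p: "f p = 0" and v: "chart_deriv \<psi> f p v = 0"
  shows "v \<in> tangent_space \<psi> {q \<in> topspace N. f q = 0} p"
proof -
  obtain \<kappa> where \<kappa>: "\<kappa> \<in> B" "p \<in> chart_dom \<kappa>" "\<And>q. q \<in> chart_dom \<kappa> \<Longrightarrow> chart_map \<kappa> q $ k = f q"
    using slice_chart[OF N \<psi> f k] by blast
  note t = smooth_manifold_transition[OF N \<psi>(1) \<kappa>(1)] and t' = smooth_manifold_transition[OF N \<kappa>(1) \<psi>(1)]
  note on = smooth_manifold_chart_on[OF N \<psi>(1)] and on' = smooth_manifold_chart_on[OF N \<kappa>(1)]
  note inv = chart_inv_map[OF chart_on_inj[OF on]] and inv' = chart_inv_map[OF chart_on_inj[OF on']]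
  define w where "w = chart_deriv \<psi> (chart_map \<kappa>) p v"
  have "w $ k = 0"
  proof -
    have "((\<lambda>x. (chart_map \<kappa> \<circ> chart_inv \<psi>) x $ k) has_derivative (\<lambda>v. chart_deriv \<psi> (chart_map \<kappa>) p v $ k))
        (at (chart_map \<psi> p))"
      by (rule bounded_linear.has_derivative[OF bounded_linear_vec_nth transition_has_derivative[OF t \<psi>(2) \<kappa>(2)]])
    then have "(f \<circ> chart_inv \<psi> has_derivative (\<lambda>v. chart_deriv \<psi> (chart_map \<kappa>) p v $ k)) (at (chart_map \<psi> p))"
      by (rule has_derivative_transform_within_open[OF _ smooth_transitionD(1)[OF t]]) (use \<psi>(2) \<kappa>(2,3) inv in auto)
    from fun_cong[OF frechet_derivative_at[OF this], of v] show ?thesis using v by (simp add: w_def chart_deriv_def)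
  qed
  define l where "l t = chart_map \<kappa> p + t *\<^sub>R w" for t :: real
  define x where "x t = chart_inv \<kappa> (l t)" for t
  have dl: "(l has_derivative (\<lambda>t. t *\<^sub>R w)) (at 0)"
    unfolding l_def by (auto intro!: derivative_eq_intros)
  have "open (l -` (chart_map \<kappa> ` (chart_dom \<kappa> \<inter> chart_dom \<psi>)))"
    by (rule open_vimage[OF smooth_transitionD(1)[OF t']]) (auto simp: l_def intro!: continuous_intros)
  moreover have "0 \<in> l -` (chart_map \<kappa> ` (chart_dom \<kappa> \<inter> chart_dom \<psi>))" using \<kappa>(2) \<psi>(2) by (simp add: l_def)
  ultimately have ev: "\<forall>\<^sub>F t in nhds 0. l t \<in> chart_map \<kappa> ` (chart_dom \<kappa> \<inter> chart_dom \<psi>)"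
    using eventually_nhds_in_open by (simp only: vimage_eq[symmetric])
  have "x 0 = p" by (simp add: x_def l_def inv'[OF \<kappa>(2)])
  moreover have "\<forall>\<^sub>F t in nhds 0. x t \<in> {q \<in> topspace N. f q = 0} \<inter> chart_dom \<psi>"
    using ev
  proof eventually_elim
    case (elim t)
    then obtain q where q: "q \<in> chart_dom \<kappa>" "q \<in> chart_dom \<psi>" "l t = chart_map \<kappa> q" by blast
    have "f q = (chart_map \<kappa> p + t *\<^sub>R w) $ k" using \<kappa>(3)[OF q(1)] q(3) by (simp add: l_def)
    also have "\<dots> = 0" using \<kappa>(3)[OF \<kappa>(2)] p \<open>w $ k = 0\<close> by simp
    finally have "f q = 0" .
    moreover have "q \<in> topspace N" using openin_subset[OF chart_on_openin[OF on]] q(2) by blast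
    moreover have "x t = q" using q inv' by (simp add: x_def)
    ultimately show ?case using q by simp
  qed
  moreover have "((chart_map \<psi> \<circ> x) has_vector_derivative v) (at 0)"
  proof -
    have "((\<lambda>t. (chart_map \<psi> \<circ> chart_inv \<kappa>) (l t)) has_derivative
        (\<lambda>t. chart_deriv \<kappa> (chart_map \<psi>) p (t *\<^sub>R w))) (at 0)"
      using has_derivative_compose[OF dl, of "chart_map \<psi> \<circ> chart_inv \<kappa>" "chart_deriv \<kappa> (chart_map \<psi>) p"]
        transition_has_derivative[OF t' \<kappa>(2) \<psi>(2)] by (simp add: l_def)
    moreover have "chart_deriv \<kappa> (chart_map \<psi>) p (t *\<^sub>R w) = t *\<^sub>R v" for t
      unfolding linear_cmul[OF transition_linear[OF t' \<kappa>(2) \<psi>(2)]] w_def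
        transition_derivative_inverse[OF t' t on \<kappa>(2) \<psi>(2)] by (rule refl)
    ultimately show ?thesis by (simp add: has_vector_derivative_def x_def o_def)
  qed
  ultimately show ?thesis unfolding tangent_space_def by blast
qed

section \<open>Geometry of the induced metric\<close>

context immersed_atlas
begin

text \<open>
  The Gauss formula. With \<open>J\<close> and \<open>H\<close> the first and second derivative of the inclusion in
  coordinates, the ambient covariant derivative of \<open>J u\<close> along \<open>J v\<close> is the connection term of \<open>g\<close>
  plus \<open>H v u\<close>, and the induced connection is its tangential part. In the Koszul expression all
  other second derivatives of the inclusion cancel, by the symmetry of \<open>H\<close> and of \<open>g\<close>.
\<close>

lemma koszul_pullback:
  assumes g: "g \<in> riemannian_metrics A" and \<gamma>: "pullback_tensor A B g \<gamma>"
    and \<kappa>: "\<kappa> \<in> A" "p \<in> chart_dom \<kappa>" and \<psi>: "\<psi> \<in> B" "p \<in> chart_dom \<psi>"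
  defines "J \<equiv> chart_deriv \<psi> (chart_map \<kappa>) p"
    and "H \<equiv> \<lambda>v w. frechet_derivative (\<lambda>y. frechet_derivative (chart_map \<kappa> \<circ> chart_inv \<psi>) (at y) w) (at (chart_map \<psi> p)) v"
  shows "koszul \<gamma> \<psi> p w v u = koszul g \<kappa> p (J w) (J v) (J u) + ip (g \<kappa> p) (J w) (H v u)"
proof -
  interpret G: metric_at g \<kappa> p by (rule riemannian_metric_at[OF M g \<kappa>])
  interpret C: metric_at \<gamma> \<psi> p by (rule riemannian_metric_at[OF N pullback_riemannian[OF g \<gamma>] \<psi>])
  note t = transition[OF \<kappa>(1) \<psi>(1)]
  let ?S = "chart_map \<psi> ` (chart_dom \<psi> \<inter> chart_dom \<kappa>)" and ?\<Phi> = "chart_map \<kappa> \<circ> chart_inv \<psi>"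
  let ?x = "chart_map \<psi> p"
  note oS = smooth_transitionD(1)[OF t] and s\<Phi> = smooth_transitionD(5)[OF t]
  have xS: "?x \<in> ?S" using \<kappa>(2) \<psi>(2) by blast
  have inv: "chart_inv \<psi> ?x = p" by (rule chart_inv_map[OF C.inj C.dom])
  have J: "frechet_derivative ?\<Phi> (at ?x) = J" by (simp add: J_def chart_deriv_def)
  have dg: "((\<lambda>x. g \<kappa> (chart_inv \<psi> x) $ i $ j) has_derivative (\<lambda>v. metric_deriv g \<kappa> p (J v) $ i $ j)) (at ?x)" for i j
    using chart_deriv_chain_has_derivative[OF t \<psi>(2) \<kappa>(2) chart_smooth_has_derivative[OF G.smooth \<kappa>(2)], of i j]
    by (simp add: J_def metric_deriv_def o_def)
  have md: "ip (metric_deriv \<gamma> \<psi> p v) w u =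
      ip (metric_deriv g \<kappa> p (J v)) (J w) (J u) + ip (g \<kappa> p) (H v w) (J u) + ip (g \<kappa> p) (J w) (H v u)" for v w u
  proof -
    have "((\<lambda>x. ip (g \<kappa> (chart_inv \<psi> x)) (frechet_derivative ?\<Phi> (at x) w) (frechet_derivative ?\<Phi> (at x) u)) has_derivative
        (\<lambda>v. ip (metric_deriv g \<kappa> p (J v)) (J w) (J u) + ip (g \<kappa> p) (H v w) (J u) + ip (g \<kappa> p) (J w) (H v u))) (at ?x)"
      using has_derivative_ip[OF dg second_derivative_has_derivative[OF oS s\<Phi> xS, of w]
          second_derivative_has_derivative[OF oS s\<Phi> xS, of u]]
      unfolding H_def J inv .
    then have 1: "((\<lambda>x. ip (\<gamma> \<psi> (chart_inv \<psi> x)) w u) has_derivative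
        (\<lambda>v. ip (metric_deriv g \<kappa> p (J v)) (J w) (J u) + ip (g \<kappa> p) (H v w) (J u) + ip (g \<kappa> p) (J w) (H v u))) (at ?x)"
    proof (rule has_derivative_transform_within_open[OF _ oS xS])
      fix x assume "x \<in> ?S"
      then obtain q where q: "q \<in> chart_dom \<psi>" "q \<in> chart_dom \<kappa>" "x = chart_map \<psi> q" by blast
      then show "ip (g \<kappa> (chart_inv \<psi> x)) (frechet_derivative ?\<Phi> (at x) w) (frechet_derivative ?\<Phi> (at x) u) =
          ip (\<gamma> \<psi> (chart_inv \<psi> x)) w u"
        using pullback_ip[OF \<gamma> \<kappa>(1) \<psi>(1) q(2,1), of w u] chart_inv_map[OF C.inj q(1)] by (simp add: chart_deriv_def)
    qed
    have "((\<lambda>x. ip (\<gamma> \<psi> (chart_inv \<psi> x)) w u) has_derivative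
        (\<lambda>v. ip (metric_deriv \<gamma> \<psi> p v) w u + ip (\<gamma> \<psi> (chart_inv \<psi> ?x)) 0 u + ip (\<gamma> \<psi> (chart_inv \<psi> ?x)) w 0)) (at ?x)"
      by (rule has_derivative_ip[OF C.metric_has_derivative has_derivative_const has_derivative_const])
    from fun_cong[OF has_derivative_unique[OF 1 this], of v] show ?thesis by (simp add: ip_zero)
  qed
  have Hsym: "H v w = H w v" for v w
    unfolding H_def by (rule second_derivative_symmetric_vec[OF oS s\<Phi> xS])
  note gsym = ip_commute[OF G.sym[OF \<kappa>(2)]]
  show ?thesis
    unfolding koszul_def md
    using Hsym[of v u] Hsym[of w u] Hsym[of w v] gsym[of "H v w" "J u"] gsym[of "H u w" "J v"] gsym[of "J v" "H u w"]
    by (simp add: field_simps)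
qed

lemma restricted_scale_deriv:
  assumes K: "parallel_tractor_at g \<kappa> p A c K" and \<psi>: "\<psi> \<in> B" and q: "q \<in> chart_dom \<psi>" "q \<in> chart_dom \<kappa>"
  shows "chart_deriv \<psi> (tsigma K g) q v = tmu K g \<kappa> q \<bullet> chart_deriv \<psi> (chart_map \<kappa>) q v"
proof -
  interpret parallel_tractor_at g \<kappa> p A c K by (rule K)
  show ?thesis
    using chart_deriv_chain[OF transition[OF \<kappa> \<psi>] q chart_smooth_has_derivative[OF sigma_smooth q(2)], of v]
      sigma_deriv[OF q(2)] by simp
qed

text \<open>
  Together with \<open>mu_deriv\<close> this expresses the Hessian of the restriction of \<open>\<sigma>\<close> through ambient data.
\<close>

lemma restricted_scale_hessian:
  assumes K: "parallel_tractor_at g \<kappa> p A c K" and \<psi>: "\<psi> \<in> B" "p \<in> chart_dom \<psi>"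
    and Y: "(Y \<circ> chart_inv \<psi> has_derivative Y') (at (chart_map \<psi> p))"
  defines "J \<equiv> chart_deriv \<psi> (chart_map \<kappa>) p"
    and "H \<equiv> \<lambda>v w. frechet_derivative (\<lambda>y. frechet_derivative (chart_map \<kappa> \<circ> chart_inv \<psi>) (at y) w) (at (chart_map \<psi> p)) v"
  shows "((\<lambda>q. chart_deriv \<psi> (tsigma K g) q (Y q)) \<circ> chart_inv \<psi> has_derivative
    (\<lambda>v. chart_deriv \<kappa> (tmu K g \<kappa>) p (J v) \<bullet> J (Y p) + tmu K g \<kappa> p \<bullet> (J (Y' v) + H v (Y p)))) (at (chart_map \<psi> p))"
proof -
  interpret parallel_tractor_at g \<kappa> p A c K by (rule K)
  note t = transition[OF \<kappa> \<psi>(1)]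
  let ?S = "chart_map \<psi> ` (chart_dom \<psi> \<inter> chart_dom \<kappa>)" and ?\<Phi> = "chart_map \<kappa> \<circ> chart_inv \<psi>"
  let ?x = "chart_map \<psi> p"
  note oS = smooth_transitionD(1)[OF t] and s\<Phi> = smooth_transitionD(5)[OF t]
  note invq = chart_inv_map[OF smooth_transitionD(2)[OF t]]
  have xS: "?x \<in> ?S" using dom \<psi>(2) by blast
  have inv: "chart_inv \<psi> ?x = p" by (rule invq[OF \<psi>(2)])
  have J: "frechet_derivative ?\<Phi> (at ?x) = J" by (simp add: J_def chart_deriv_def)
  have "(tmu K g \<kappa> \<circ> chart_inv \<psi> has_derivative (\<lambda>v. chart_deriv \<kappa> (tmu K g \<kappa>) p (J v))) (at ?x)"
    unfolding J_def by (rule chart_deriv_chain_has_derivative[OF t \<psi>(2) dom chart_smooth_has_derivative[OF mu_smooth dom]])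
  from has_derivative_inner[OF this derivative_of_vector_field_has_derivative[OF oS s\<Phi> xS Y]]
  have "((\<lambda>x. (tmu K g \<kappa> \<circ> chart_inv \<psi>) x \<bullet> frechet_derivative ?\<Phi> (at x) ((Y \<circ> chart_inv \<psi>) x)) has_derivative
    (\<lambda>v. chart_deriv \<kappa> (tmu K g \<kappa>) p (J v) \<bullet> J (Y p) + tmu K g \<kappa> p \<bullet> (J (Y' v) + H v (Y p)))) (at ?x)"
    by (simp add: J H_def inv add.commute)
  then show ?thesis
  proof (rule has_derivative_transform_within_open[OF _ oS xS])
    fix x assume "x \<in> ?S"
    then obtain q where q: "q \<in> chart_dom \<psi>" "q \<in> chart_dom \<kappa>" "x = chart_map \<psi> q" by blast
    then show "(tmu K g \<kappa> \<circ> chart_inv \<psi>) x \<bullet> frechet_derivative ?\<Phi> (at x) ((Y \<circ> chart_inv \<psi>) x) =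
        ((\<lambda>q. chart_deriv \<psi> (tsigma K g) q (Y q)) \<circ> chart_inv \<psi>) x"
      using restricted_scale_deriv[OF K \<psi>(1) q(1,2)] invq[OF q(1)] by (simp add: chart_deriv_def)
  qed
qed

text \<open>
  The umbilicity computation for the level set of the restriction \<open>f\<close> of \<open>\<sigma>\<close>. It needs the ambient
  gradient of \<open>\<sigma>\<close> to be tangent to the submanifold (hypothesis \<open>grad\<close>): then the normal component
  in the Gauss formula does not contribute to the Hessian of \<open>f\<close>, and \<open>Hess f = - \<rho> \<gamma>\<close>. As
  \<open>df (Y)\<close> has derivative zero along \<open>X\<close>, \<open>df (\<nabla>\<^sub>X Y) = - Hess f (X, Y)\<close> is a multiple of
  \<open>\<gamma> (X, Y)\<close>, and the conformal factor contributes a further multiple.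
\<close>

lemma second_fundamental_form_scale_level:
  assumes K: "parallel_tractor_at g \<kappa> p A c K" and g: "g \<in> riemannian_metrics A"
    and \<gamma>: "pullback_tensor A B g \<gamma>"
    and \<omega>: "smooth_fun B \<omega>" "rescaled B \<omega> \<gamma> \<gamma>'" and \<gamma>': "\<gamma>' \<in> riemannian_metrics B"
    and \<psi>: "\<psi> \<in> B" "p \<in> chart_dom \<psi>" and zero: "tsigma K g p = 0"
    and grad: "matrix_inv (g \<kappa> p) *v tmu K g \<kappa> p = chart_deriv \<psi> (chart_map \<kappa>) p m"
    and n: "\<And>z. ip (\<gamma> \<psi> p) z n = l * chart_deriv \<psi> (tsigma K g) p z"
    and X: "chart_deriv \<psi> (tsigma K g) p X = 0"
    and Y: "chart_smooth \<psi> Y" "chart_deriv \<psi> (tsigma K g) p (Y p) = 0"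
      "chart_deriv \<psi> (\<lambda>q. chart_deriv \<psi> (tsigma K g) q (Y q)) p X = 0"
  shows "second_fundamental_form \<gamma>' \<psi> n X Y p = (l * trho K g p - chart_deriv \<psi> \<omega> p n) * ip (\<gamma>' \<psi> p) X (Y p)"
proof -
  interpret parallel_tractor_at g \<kappa> p A c K by (rule K)
  interpret C: metric_at \<gamma> \<psi> p by (rule riemannian_metric_at[OF N pullback_riemannian[OF g \<gamma>] \<psi>])
  interpret C': metric_at \<gamma>' \<psi> p by (rule riemannian_metric_at[OF N \<gamma>' \<psi>])
  note t = transition[OF \<kappa> \<psi>(1)]
  let ?\<Phi> = "chart_map \<kappa> \<circ> chart_inv \<psi>" and ?x = "chart_map \<psi> p"
  define J where "J = chart_deriv \<psi> (chart_map \<kappa>) p"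
  define H where "H v w = frechet_derivative (\<lambda>y. frechet_derivative ?\<Phi> (at y) w) (at ?x) v" for v w
  define Y' where "Y' = chart_deriv \<psi> Y p"
  have dY: "(Y \<circ> chart_inv \<psi> has_derivative Y') (at ?x)"
    unfolding Y'_def by (rule chart_smooth_has_derivative[OF Y(1) \<psi>(2)])
  have linJ: "linear J" unfolding J_def by (rule transition_linear[OF t \<psi>(2) dom])
  have pb: "ip (\<gamma> \<psi> p) v w = ip (g \<kappa> p) (J v) (J w)" for v w
    unfolding J_def by (rule pullback_ip[OF \<gamma> \<kappa> \<psi>(1) dom \<psi>(2)])
  have df: "chart_deriv \<psi> (tsigma K g) p z = tmu K g \<kappa> p \<bullet> J z" for z
    unfolding J_def by (rule restricted_scale_deriv[OF K \<psi> dom])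
  \<comment> \<open>\<open>n\<close> is a multiple of the gradient of \<open>f\<close>, and \<open>m\<close> is that gradient, since \<open>J m\<close> is the gradient of \<open>\<sigma>\<close>\<close>
  have "ip (\<gamma> \<psi> p) z (n - l *\<^sub>R m) = 0" for z
    using n[of z] mu_eq_ip[OF dom, of "J z"] pb[of z m] grad
    by (simp add: df linear_diff[OF linear_ip_right] linear_cmul[OF linear_ip_right] J_def)
  then have "n - l *\<^sub>R m = 0" using C.pos[OF \<psi>(2), of "n - l *\<^sub>R m"] by force
  then have Jn: "J n = l *\<^sub>R mu_up p" using grad linear_cmul[OF linJ] by (simp add: J_def)
  have hess: "chart_deriv \<kappa> (tmu K g \<kappa>) p (J X) \<bullet> J (Y p) + tmu K g \<kappa> p \<bullet> (J (Y' X) + H X (Y p)) = 0"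
    using fun_cong[OF frechet_derivative_at[OF restricted_scale_hessian[OF K \<psi> dY]], of X] Y(3)
    unfolding J_def H_def chart_deriv_def by simp
  have "koszul \<gamma> \<psi> p n X (Y p) = koszul g \<kappa> p (J n) (J X) (J (Y p)) + ip (g \<kappa> p) (J n) (H X (Y p))"
    unfolding J_def H_def by (rule koszul_pullback[OF g \<gamma> \<kappa> dom \<psi>])
  also have "\<dots> = l * (koszul g \<kappa> p (mu_up p) (J X) (J (Y p)) + tmu K g \<kappa> p \<bullet> H X (Y p))"
    unfolding Jn mu_eq_ip[OF dom] ip_commute[OF sym[OF dom], of "H X (Y p)"]
    by (simp add: linear_cmul[OF koszul_linear(1)] linear_cmul[OF linear_ip_left] algebra_simps)
  also have "\<dots> = l * (trho K g p * ip (\<gamma> \<psi> p) X (Y p) - tmu K g \<kappa> p \<bullet> J (Y' X))"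
  proof -
    have "koszul g \<kappa> p (mu_up p) (J X) (J (Y p)) + tmu K g \<kappa> p \<bullet> H X (Y p) =
        trho K g p * ip (\<gamma> \<psi> p) X (Y p) - tmu K g \<kappa> p \<bullet> J (Y' X)"
      using mu_deriv[OF zero, of "J X" "J (Y p)"] hess by (simp add: pb inner_add_right)
    then show ?thesis by (simp only:)
  qed
  finally have k0: "koszul \<gamma> \<psi> p n X (Y p) + ip (\<gamma> \<psi> p) n (Y' X) = l * trho K g p * ip (\<gamma> \<psi> p) X (Y p)"
    using n[of "Y' X"] df[of "Y' X"] ip_commute[OF C.sym[OF \<psi>(2)], of n "Y' X"] by (simp add: algebra_simps)
  have sm: "chart_smooth \<psi> \<omega>" using \<omega>(1) \<psi>(1) by (simp add: smooth_fun_def)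
  have res: "\<gamma>' \<psi> q = exp (2 * \<omega> q) *\<^sub>R \<gamma> \<psi> q" if "q \<in> chart_dom \<psi>" for q
    using \<omega>(2) \<psi>(1) that by (simp add: rescaled_def)
  have nX: "ip (\<gamma> \<psi> p) n X = 0" "ip (\<gamma> \<psi> p) n (Y p) = 0"
    using n[of X] n[of "Y p"] X Y(2) ip_commute[OF C.sym[OF \<psi>(2)], of n] by simp_all
  have "second_fundamental_form \<gamma>' \<psi> n X Y p = ip (\<gamma>' \<psi> p) n (Y' X) + koszul \<gamma>' \<psi> p n X (Y p)"
    unfolding second_fundamental_form_def
    using C'.cov_deriv_koszul[OF dY, of n X] ip_commute[OF C'.sym[OF \<psi>(2)]] by simp
  also have "\<dots> = exp (2 * \<omega> p) * (ip (\<gamma> \<psi> p) n (Y' X) + koszul \<gamma> \<psi> p n X (Y p)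
      - chart_deriv \<psi> \<omega> p n * ip (\<gamma> \<psi> p) X (Y p))"
  proof -
    have "koszul \<gamma>' \<psi> p n X (Y p) = exp (2 * \<omega> p) * (koszul \<gamma> \<psi> p n X (Y p) +
        chart_deriv \<psi> \<omega> p X * ip (\<gamma> \<psi> p) n (Y p) + chart_deriv \<psi> \<omega> p (Y p) * ip (\<gamma> \<psi> p) n X
        - chart_deriv \<psi> \<omega> p n * ip (\<gamma> \<psi> p) X (Y p))"
      by (rule koszul_rescaled[OF C.metric_at_axioms sm]) (rule res)
    then show ?thesis unfolding res[OF \<psi>(2)] ip_scaleR_matrix nX by (simp add: algebra_simps)
  qed
  also have "ip (\<gamma> \<psi> p) n (Y' X) + koszul \<gamma> \<psi> p n X (Y p) = l * trho K g p * ip (\<gamma> \<psi> p) X (Y p)"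
    using k0 by simp
  finally show ?thesis unfolding res[OF \<psi>(2)] ip_scaleR_matrix by (simp add: algebra_simps)
qed

end

section \<open>The intersection of the two singularity sets\<close>

locale orthogonal_spacelike_tractors =
  fixes M :: "'a topology" and A :: "('a, 'n::finite) chart set" and c :: "('a, 'n) metric set"
    and K1 K2 :: "('a, 'n) tractor"
  assumes conformal: "conformal_manifold M A c"
    and parallel: "parallel_tractor A c K1" "parallel_tractor A c K2"
    and spacelike: "g \<in> c \<Longrightarrow> \<kappa> \<in> A \<Longrightarrow> p \<in> chart_dom \<kappa> \<Longrightarrow> tractor_metric g \<kappa> K1 K1 p > 0"
      "g \<in> c \<Longrightarrow> \<kappa> \<in> A \<Longrightarrow> p \<in> chart_dom \<kappa> \<Longrightarrow> tractor_metric g \<kappa> K2 K2 p > 0"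
    and orthogonal: "g \<in> c \<Longrightarrow> \<kappa> \<in> A \<Longrightarrow> p \<in> chart_dom \<kappa> \<Longrightarrow> tractor_metric g \<kappa> K1 K2 p = 0"
begin

lemma M: "smooth_manifold M A" and conformal_class: "c \<in> riemannian_metrics A // conformal_rel A"
  using conformal by (simp_all add: conformal_manifold_def)

lemma class_metric: "g \<in> c \<Longrightarrow> g \<in> riemannian_metrics A"
  using in_quotient_imp_subset[OF equiv_conformal_rel[OF M] conformal_class] by blast

lemma class_metric_at: "g \<in> c \<Longrightarrow> \<kappa> \<in> A \<Longrightarrow> p \<in> chart_dom \<kappa> \<Longrightarrow> metric_at g \<kappa> p"
  by (rule riemannian_metric_at[OF M class_metric])

lemma class_tractor_at:
  assumes "parallel_tractor A c K" "g \<in> c" "\<kappa> \<in> A" "p \<in> chart_dom \<kappa>"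
  shows "parallel_tractor_at g \<kappa> p A c K"
  using class_metric_at[OF assms(2-4)] assms(1-3)
  by (simp add: parallel_tractor_at_def parallel_tractor_at_axioms_def)

lemma scale_smooth: "parallel_tractor A c K \<Longrightarrow> g \<in> c \<Longrightarrow> smooth_fun A (tsigma K g)"
  unfolding parallel_tractor_def tractor_section_def by blast

lemma singularity_set_eq:
  assumes K: "parallel_tractor A c K" and g: "g \<in> c"
  shows "singularity_set A c K = {p \<in> topspace M. tsigma K g p = 0}"
proof (intro equalityI subsetI)
  fix p assume "p \<in> singularity_set A c K"
  then show "p \<in> {p \<in> topspace M. tsigma K g p = 0}"
    using g smooth_manifold_cover[OF M] by (auto simp: singularity_set_def tractor_metric_canonical)
next
  fix p assume p: "p \<in> {p \<in> topspace M. tsigma K g p = 0}"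
  then have "p \<in> \<Union> (chart_dom ` A)" using smooth_manifold_cover[OF M] by blast
  moreover have "tsigma K g' p = 0" if g': "g' \<in> c" and \<kappa>: "\<kappa> \<in> A" "p \<in> chart_dom \<kappa>" for g' \<kappa>
  proof -
    have "(g, g') \<in> conformal_rel A"
      using in_quotient_imp_in_rel[OF equiv_conformal_rel[OF M] conformal_class] g g' by blast
    then obtain \<omega> where \<omega>: "smooth_fun A \<omega>" "rescaled A \<omega> g g'" by (auto simp: conformal_rel_def)
    have "tractor_section A c 0 K" using K by (simp add: parallel_tractor_def)
    then have "tsigma K g' p = exp ((0 + 1) * \<omega> p) * tsigma K g p"
      using g g' \<omega> \<kappa> unfolding tractor_section_def Let_def by blast
    then show ?thesis using p by simp
  qed
  ultimately show "p \<in> singularity_set A c K"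
    unfolding singularity_set_def tractor_metric_canonical by blast
qed

text \<open>
  Where \<open>\<sigma>\<^sub>2\<close> vanishes, \<open>h (K\<^sub>2, K\<^sub>2)\<close> is the square norm of \<open>\<mu>\<^sub>2\<close>.
\<close>

lemma gradient_nonzero:
  assumes "g \<in> c" "\<kappa> \<in> A" "p \<in> chart_dom \<kappa>" "tsigma K2 g p = 0"
  shows "tmu K2 g \<kappa> p \<noteq> 0"
  using spacelike(2)[OF assms(1-3)] assms(4) by (auto simp: tractor_metric_def ip_zero)

lemma hypersurface_singularity_set: "hypersurface M A (singularity_set A c K2)"
proof -
  obtain g where g: "g \<in> c"
    using in_quotient_imp_non_empty[OF equiv_conformal_rel[OF M] conformal_class] by blast
  show ?thesis
    unfolding singularity_set_eq[OF parallel(2) g]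
  proof (rule regular_level_hypersurface[OF M scale_smooth[OF parallel(2) g]])
    fix p \<kappa> assume *: "tsigma K2 g p = 0" "\<kappa> \<in> A" "p \<in> chart_dom \<kappa>"
    interpret parallel_tractor_at g \<kappa> p A c K2 by (rule class_tractor_at[OF parallel(2) g *(2,3)])
    obtain k where "tmu K2 g \<kappa> p $ k \<noteq> 0"
      using gradient_nonzero[OF g *(2,3,1)] by (metis vec_eq_iff zero_index)
    then show "\<exists>k. pd \<kappa> k (tsigma K2 g) p \<noteq> 0"
      using sigma_deriv[OF *(3)] by (auto simp: pd_chart_deriv inner_axis)
  qed
qed

end

text \<open>
  Here \<open>B\<close> is the atlas of the singularity set of \<open>K2\<close>; naming it fixes the index type of its
  coordinates.
\<close>

locale singularity_hypersurface = orthogonal_spacelike_tractors M A c K1 K2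
  for M :: "'a topology" and A :: "('a, 'n::finite) chart set" and c K1 K2 +
  fixes B :: "('a, 'm::finite) chart set"
  assumes card: "CARD('n) = CARD('m) + 1"
    and B: "B = submanifold_atlas M A (singularity_set A c K2)"
begin

sublocale immersed_atlas M A "subtopology M (singularity_set A c K2)" B
  unfolding B by (rule hypersurface_immersed_atlas[OF card M hypersurface_singularity_set])

lemma intersection_eq:
  assumes "g \<in> c"
  shows "singularity_set A c K1 \<inter> singularity_set A c K2 =
    {p \<in> topspace (subtopology M (singularity_set A c K2)). tsigma K1 g p = 0}"
  using singularity_set_eq[OF parallel(1) assms] by auto

lemma scale_zero:
  assumes "g \<in> c" "\<psi> \<in> B" "p \<in> chart_dom \<psi>"
  shows "tsigma K2 g p = 0"
  using submanifold_chart_dom(1)[of \<psi> M A "singularity_set A c K2"] assms(2,3)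
    singularity_set_eq[OF parallel(2) assms(1)] unfolding B by blast

text \<open>
  At common zeros of the scales, \<open>h (K\<^sub>1, K\<^sub>2) = 0\<close> says that the gradient of \<open>\<sigma>\<^sub>1\<close> is orthogonal to
  that of \<open>\<sigma>\<^sub>2\<close>. The tangent space of the hypersurface lies in the kernel of \<open>d\<sigma>\<^sub>2\<close> and has the
  same dimension, so it contains the gradient of \<open>\<sigma>\<^sub>1\<close>, on which \<open>d\<sigma>\<^sub>1\<close> takes the
  value \<open>h (K\<^sub>1, K\<^sub>1) > 0\<close>.
\<close>

lemma gradient_tangent:
  assumes g: "g \<in> c" and \<psi>: "\<psi> \<in> B" "p \<in> chart_dom \<psi>" and \<kappa>: "\<kappa> \<in> A" "p \<in> chart_dom \<kappa>"
    and zero: "tsigma K1 g p = 0"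
  obtains m where "matrix_inv (g \<kappa> p) *v tmu K1 g \<kappa> p = chart_deriv \<psi> (chart_map \<kappa>) p m"
    "chart_deriv \<psi> (tsigma K1 g) p m \<noteq> 0"
proof -
  interpret T1: parallel_tractor_at g \<kappa> p A c K1 by (rule class_tractor_at[OF parallel(1) g \<kappa>])
  interpret T2: parallel_tractor_at g \<kappa> p A c K2 by (rule class_tractor_at[OF parallel(2) g \<kappa>])
  note zero2 = scale_zero[OF g \<psi>]
  let ?J = "chart_deriv \<psi> (chart_map \<kappa>) p"
  have linJ: "linear ?J" by (rule transition_linear[OF transition[OF \<kappa>(1) \<psi>(1)] \<psi>(2) \<kappa>(2)])
  have on: "chart_on (subtopology M (singularity_set A c K2)) \<psi>" using \<psi>(1) B submanifold_chart_on by blast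
  have "tmu K2 g \<kappa> p \<bullet> ?J v = 0" for v
  proof -
    have "chart_deriv \<psi> (tsigma K2 g) p = frechet_derivative (\<lambda>_. 0) (at (chart_map \<psi> p))"
      unfolding chart_deriv_def
    proof (rule frechet_derivative_cong_open[OF chart_on_open_image[OF on]])
      show "(tsigma K2 g \<circ> chart_inv \<psi>) x = 0" if "x \<in> chart_map \<psi> ` chart_dom \<psi>" for x
        using scale_zero[OF g \<psi>(1) chart_inv_in[OF that]] by simp
    qed (use \<psi>(2) in blast)
    then show ?thesis
      using restricted_scale_deriv[OF T2.parallel_tractor_at_axioms \<psi> \<kappa>(2), of v] by simp
  qed
  then have sub: "range ?J \<subseteq> {x. tmu K2 g \<kappa> p \<bullet> x = 0}" by auto
  have "dim (range ?J) = CARD('m)"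
    using dim_image_eq[OF linJ, of UNIV] immersion[OF \<kappa>(1) \<psi> \<kappa>(2)] by simp
  moreover have "dim {x. tmu K2 g \<kappa> p \<bullet> x = 0} = CARD('m)"
    using dim_hyperplane[OF gradient_nonzero[OF g \<kappa> zero2]] card by simp
  ultimately have range: "range ?J = {x. tmu K2 g \<kappa> p \<bullet> x = 0}"
    using sub subspace_hyperplane linear_subspace_image[OF linJ subspace_UNIV]
    by (intro subspace_dim_equal) auto
  have o: "tmu K1 g \<kappa> p \<bullet> T2.mu_up p = 0"
    using orthogonal[OF g \<kappa>] by (simp add: tractor_metric_def zero zero2 ip_eq_inner)
  have "tmu K2 g \<kappa> p \<bullet> T1.mu_up p = 0"
    using T1.mu_eq_ip[OF \<kappa>(2), of "T2.mu_up p"] T2.mu_eq_ip[OF \<kappa>(2), of "T1.mu_up p"] o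
      ip_commute[OF T1.sym[OF \<kappa>(2)], of "T1.mu_up p" "T2.mu_up p"] by simp
  then obtain m where m: "T1.mu_up p = ?J m" using range by blast
  have "tmu K1 g \<kappa> p \<bullet> T1.mu_up p > 0"
    using spacelike(1)[OF g \<kappa>] by (simp add: tractor_metric_def zero ip_eq_inner)
  then have "chart_deriv \<psi> (tsigma K1 g) p m \<noteq> 0"
    using restricted_scale_deriv[OF T1.parallel_tractor_at_axioms \<psi> \<kappa>(2), of m] m by simp
  with m that show ?thesis by blast
qed

lemma restricted_scale_smooth: "g \<in> c \<Longrightarrow> smooth_fun B (tsigma K1 g)"
  by (rule smooth_fun_restrict[OF scale_smooth[OF parallel(1)]])

lemma restricted_scale_linear:
  assumes "g \<in> c" "\<psi> \<in> B" "p \<in> chart_dom \<psi>"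
  shows "linear (chart_deriv \<psi> (tsigma K1 g) p)"
proof -
  have "chart_smooth \<psi> (tsigma K1 g)"
    using restricted_scale_smooth[OF assms(1)] assms(2) by (simp add: smooth_fun_def)
  from has_derivative_linear[OF chart_smooth_has_derivative[OF this assms(3)]] show ?thesis .
qed

lemma restricted_scale_regular:
  assumes "g \<in> c" "\<psi> \<in> B" "p \<in> chart_dom \<psi>" "tsigma K1 g p = 0"
  shows "\<exists>k. pd \<psi> k (tsigma K1 g) p \<noteq> 0"
proof -
  obtain \<kappa> where \<kappa>: "\<kappa> \<in> A" "p \<in> chart_dom \<kappa>" using ambient_chart[OF assms(2,3)] by blast
  obtain m where m: "chart_deriv \<psi> (tsigma K1 g) p m \<noteq> 0"
    using gradient_tangent[OF assms(1-3) \<kappa> assms(4)] by blast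
  have "chart_deriv \<psi> (tsigma K1 g) p m = (\<Sum>i\<in>UNIV. m $ i *\<^sub>R pd \<psi> i (tsigma K1 g) p)"
    unfolding pd_chart_deriv by (rule linear_eq_sum_axis[OF restricted_scale_linear[OF assms(1-3)]])
  moreover have "(\<Sum>i\<in>UNIV. m $ i *\<^sub>R pd \<psi> i (tsigma K1 g) p) = 0" if "\<nexists>k. pd \<psi> k (tsigma K1 g) p \<noteq> 0"
    using that by (intro sum.neutral) simp
  ultimately show ?thesis using m by argo
qed

lemma hypersurface_intersection:
  "hypersurface (subtopology M (singularity_set A c K2)) B (singularity_set A c K1 \<inter> singularity_set A c K2)"
proof -
  obtain g where g: "g \<in> c"
    using in_quotient_imp_non_empty[OF equiv_conformal_rel[OF M] conformal_class] by blast
  show ?thesis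
    unfolding intersection_eq[OF g]
    by (rule regular_level_hypersurface[OF N restricted_scale_smooth[OF g]])
      (rule restricted_scale_regular[OF g])
qed

lemma intersection_umbilic:
  assumes \<gamma>': "\<gamma>' \<in> induced_conformal M A c (singularity_set A c K2)"
  shows "umbilic_wrt B \<gamma>' (singularity_set A c K1 \<inter> singularity_set A c K2)"
  unfolding umbilic_wrt_def
proof (intro ballI allI impI)
  let ?S = "singularity_set A c K1 \<inter> singularity_set A c K2"
  fix \<psi> p n assume \<psi>: "\<psi> \<in> B" and pS: "p \<in> ?S \<inter> chart_dom \<psi>" and n: "unit_normal \<gamma>' \<psi> ?S p n"
  obtain g \<gamma> where g: "g \<in> c" "pullback_tensor A B g \<gamma>" "(\<gamma>, \<gamma>') \<in> conformal_rel B"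
    using \<gamma>' unfolding induced_conformal_def Let_def B[symmetric] by blast
  then obtain \<omega> where \<omega>: "smooth_fun B \<omega>" "rescaled B \<omega> \<gamma> \<gamma>'" and \<gamma>'R: "\<gamma>' \<in> riemannian_metrics B"
    by (auto simp: conformal_rel_def)
  let ?f = "tsigma K1 g"
  have p: "p \<in> chart_dom \<psi>" "?f p = 0" using pS intersection_eq[OF g(1)] by auto
  obtain \<kappa> where \<kappa>: "\<kappa> \<in> A" "p \<in> chart_dom \<kappa>" using ambient_chart[OF \<psi> p(1)] by blast
  note T1 = class_tractor_at[OF parallel(1) g(1) \<kappa>]
  obtain m where m: "matrix_inv (g \<kappa> p) *v tmu K1 g \<kappa> p = chart_deriv \<psi> (chart_map \<kappa>) p m"
    "chart_deriv \<psi> ?f p m \<noteq> 0"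
    using gradient_tangent[OF g(1) \<psi> p(1) \<kappa> p(2)] by blast
  have sf: "chart_smooth \<psi> ?f" using restricted_scale_smooth[OF g(1)] \<psi> by (simp add: smooth_fun_def)
  note lin = restricted_scale_linear[OF g(1) \<psi> p(1)]
  note inj = chart_on_inj[OF smooth_manifold_chart_on[OF N \<psi>]]
  have kernel: "ip (\<gamma>' \<psi> p) z n = 0" if "chart_deriv \<psi> ?f p z = 0" for z
  proof -
    obtain k where "pd \<psi> k ?f p \<noteq> 0" using restricted_scale_regular[OF g(1) \<psi> p] by blast
    then have "z \<in> tangent_space \<psi> ?S p"
      unfolding intersection_eq[OF g(1)] by (rule kernel_subset_tangent_space[OF N \<psi> p(1) sf _ p(2) that])
    then show ?thesis using n by (simp add: unit_normal_def)
  qed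
  \<comment> \<open>the functional \<open>\<gamma> (-, n)\<close> vanishes on the kernel of \<open>df\<close>; \<open>l\<close> is the factor of proportionality\<close>
  define l where "l = exp (- 2 * \<omega> p) * (ip (\<gamma>' \<psi> p) m n / chart_deriv \<psi> ?f p m)"
  have normal: "ip (\<gamma> \<psi> p) z n = l * chart_deriv \<psi> ?f p z" for z
  proof -
    define r where "r = chart_deriv \<psi> ?f p z / chart_deriv \<psi> ?f p m"
    have "chart_deriv \<psi> ?f p (z - r *\<^sub>R m) = 0"
      using m(2) by (simp add: linear_diff[OF lin] linear_cmul[OF lin] r_def)
    from kernel[OF this] have "ip (\<gamma>' \<psi> p) z n = r * ip (\<gamma>' \<psi> p) m n"
      by (simp add: linear_diff[OF linear_ip_left] linear_cmul[OF linear_ip_left])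
    moreover have "ip (\<gamma> \<psi> p) z n = exp (- 2 * \<omega> p) * ip (\<gamma>' \<psi> p) z n"
      using \<omega>(2) \<psi> p(1) by (simp add: rescaled_def ip_scaleR_matrix exp_minus)
    ultimately show ?thesis by (simp add: l_def r_def)
  qed
  have tangent: "chart_deriv \<psi> ?f q X = 0" if "q \<in> chart_dom \<psi>" "X \<in> tangent_space \<psi> ?S q" for q X
  proof (rule tangent_derivative_zero[OF inj that(2) chart_smooth_has_derivative[OF sf that(1)]])
    show "?f y = 0" if "y \<in> ?S" for y using that unfolding intersection_eq[OF g(1)] by blast
  qed
  show "\<exists>H. \<forall>X\<in>tangent_space \<psi> ?S p. \<forall>Y. tangent_field \<psi> ?S Y \<longrightarrow>
      second_fundamental_form \<gamma>' \<psi> n X Y p = H * ip (\<gamma>' \<psi> p) X (Y p)"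
  proof (intro exI ballI allI impI)
    fix X Y assume X: "X \<in> tangent_space \<psi> ?S p" and Y: "tangent_field \<psi> ?S Y"
    have sY: "chart_smooth \<psi> Y" and tY: "\<And>q. q \<in> ?S \<Longrightarrow> q \<in> chart_dom \<psi> \<Longrightarrow> Y q \<in> tangent_space \<psi> ?S q"
      using Y by (auto simp: tangent_field_def)
    have vanish: "chart_deriv \<psi> ?f q (Y q) = 0" if "q \<in> ?S" "q \<in> chart_dom \<psi>" for q
      by (rule tangent[OF that(2) tY[OF that]])
    let ?h = "\<lambda>q. chart_deriv \<psi> ?f q (Y q)"
    note dh = restricted_scale_hessian[OF T1 \<psi> p(1) chart_smooth_has_derivative[OF sY p(1)]]
    have "chart_deriv \<psi> ?h p X = 0"
      unfolding chart_deriv_def[of \<psi> ?h] frechet_derivative_at[OF dh, symmetric]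
      by (rule tangent_derivative_zero[OF inj X dh vanish])
    moreover have "chart_deriv \<psi> ?f p (Y p) = 0" using vanish pS by blast
    ultimately show "second_fundamental_form \<gamma>' \<psi> n X Y p =
        (l * trho K1 g p - chart_deriv \<psi> \<omega> p n) * ip (\<gamma>' \<psi> p) X (Y p)"
      by (intro second_fundamental_form_scale_level[OF T1 class_metric[OF g(1)] g(2) \<omega> \<gamma>'R \<psi> p m(1) normal
          tangent[OF p(1) X] sY])
  qed
qed

lemma totally_umbilic_intersection:
  "totally_umbilic_hypersurface (subtopology M (singularity_set A c K2)) B
    (induced_conformal M A c (singularity_set A c K2)) (singularity_set A c K1 \<inter> singularity_set A c K2)"
proof -
  have "induced_conformal M A c (singularity_set A c K2) \<in> riemannian_metrics B // conformal_rel B"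
    using induced_class[OF conformal_class] unfolding induced_conformal_def Let_def B .
  then show ?thesis
    unfolding totally_umbilic_hypersurface_def conformal_manifold_def
    using N hypersurface_intersection intersection_umbilic by blast
qed

end

theorem proposition2p12:
  fixes M :: "'a topology"
    and A :: "('a, 'n::finite) chart set"
    and c :: "('a, 'n) metric set"
    and K1 K2 :: "('a, 'n) tractor"
  assumes "CARD('n) \<ge> 3"
    and "CARD('n) = CARD('m::finite) + 1"
    and "conformal_manifold M A c"
    and "connected_space M"
    and "parallel_tractor A c K1"
    and "parallel_tractor A c K2"
    and "lin_indep_tractors A c K1 K2"
    and "\<forall>g\<in>c. \<forall>\<kappa>\<in>A. \<forall>p\<in>chart_dom \<kappa>. tractor_S g \<kappa> K2 p < 0"
    and "singularity_set A c K2 \<noteq> {}"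
    and "\<forall>g\<in>c. \<forall>\<kappa>\<in>A. \<forall>p\<in>chart_dom \<kappa>. tractor_metric g \<kappa> K1 K1 p > 0"
    and "\<forall>g\<in>c. \<forall>\<kappa>\<in>A. \<forall>p\<in>chart_dom \<kappa>. tractor_metric g \<kappa> K2 K2 p > 0"
    and "\<forall>g\<in>c. \<forall>\<kappa>\<in>A. \<forall>p\<in>chart_dom \<kappa>. tractor_metric g \<kappa> K1 K2 p = 0"
  shows "singularity_set A c K1 \<inter> singularity_set A c K2 = {} \<or>
    totally_umbilic_hypersurface
      (subtopology M (singularity_set A c K2))
      (submanifold_atlas M A (singularity_set A c K2) :: ('a, 'm) chart set)
      (induced_conformal M A c (singularity_set A c K2))
      (singularity_set A c K1 \<inter> singularity_set A c K2)"
proof (rule disjI2)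
  interpret singularity_hypersurface M A c K1 K2
    "submanifold_atlas M A (singularity_set A c K2) :: ('a, 'm) chart set"
    by unfold_locales (use assms in auto)
  show "totally_umbilic_hypersurface
      (subtopology M (singularity_set A c K2))
      (submanifold_atlas M A (singularity_set A c K2) :: ('a, 'm) chart set)
      (induced_conformal M A c (singularity_set A c K2))
      (singularity_set A c K1 \<inter> singularity_set A c K2)"
    by (rule totally_umbilic_intersection)
qed

end
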